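(* Let $\epsilon>0$. Let $\alpha$ be a real number and let $a$ and $q\ge 1$ be integers with $(a,q)=1$ and $|\alpha-a/q|<1/q^2$. Then for every $N\ge 2$ and $H\ge 1$, $$\frac{\sqrt{\log N}}{N}\sum_{h\le H}|S(h\alpha;N)|\ll_\epsilon H(Nq)^{\epsilon}\bigl(q^{-1/4}+N^{-1/8}+H^{-1/4}N^{-1/2}q^{1/4}\bigr),$$ where $S(\beta;N)=\sum_{n\le N}b(n)e(n^2\beta)$ for real $\beta$, and the implied constant depends only on $\epsilon$.
   Context: $e(x)=e^{2\pi i x}$. $\mathfrak{B}$ denotes the set of odd positive integers that can be written as a sum of two coprime squares, $n=u^2+v^2$ with $u,v\in\mathbb{Z}$, $\gcd(u,v)=1$; $b(n)$ is the characteristic function of $\mathfrak{B}$, i.e. $b(n)=1$ if $n\in\mathfrak{B}$ and $b(n)=0$ otherwise. Sums over $n\le N$ and $h\le H$ run over positive integers. *)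

theory Defs
  imports "HOL-Analysis.Analysis"
begin

definition e :: "real \<Rightarrow> complex" where
  "e x = exp (2 * of_real pi * \<i> * of_real x)"

definition BB :: "nat set" where
  "BB = {n. odd n \<and> (\<exists>u v :: int. coprime u v \<and> int n = u\<^sup>2 + v\<^sup>2)}"

definition b :: "nat \<Rightarrow> real" where
  "b n = (if n \<in> BB then 1 else 0)"

(* The cut-off N is a real number; for N \<ge> 1 the index set is the set of positive integers n \<le> N. *)
definition S :: "real \<Rightarrow> real \<Rightarrow> complex" where
  "S \<beta> N = (\<Sum>n = 1..nat \<lfloor>N\<rfloor>. of_real (b n) * e ((real n)\<^sup>2 * \<beta>))"

end

(*
The set of odd sums of two coprime squares consists of the odd integers all of whose primes are 1 mod 4,
so on n = 1 mod 4 one has b(n) = sum of nu(D) over D | n, where nu is the Moebius function restricted to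
products of primes 3 mod 4. Let Delta = 1/q + N^(-1/2) + q/(H N^2) and cut this sum at z = Delta^(-1/2).
The part D < z is a type I sum. In the part D >= z the divisors cancel in pairs D, pD, with p the least
prime 3 mod 4 of n, and only products km = n with z <= k <= N/z survive: the only larger k possible would
be a prime 3 mod 4 whose cofactor is 1 mod 4. The resulting bilinear sums have the coupling
"least prime of k <= least prime 3 mod 4 of m", which is resolved by the highest differing binary digit.
Weyl differencing (after Cauchy-Schwarz in the bilinear case, as in Ghosh's treatment of p^2 alpha) saves
Delta^(1/2) in the mean square over h exactly when D <= z in the type I sums and z <= k <= N/z in the
bilinear ones. For H > 2q the mean square reduces to H <= 2q, because |S|^2 has nonnegative Fourier
coefficients.
*)
theory Submission
  imports Defs "HOL-Number_Theory.Number_Theory" "HOL-Computational_Algebra.Squarefree"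
begin

section \<open>Odd sums of two coprime squares\<close>

text \<open>Put E = Delta^(1/2), so that z = 1/E. Up to logarithms and divisor counts the mean
  square over h is at most H N^2 E; Cauchy-Schwarz over h leaves E^(1/2) = Delta^(1/4), and the
  fourth roots of the three summands of Delta are the three terms of the theorem. The summand
  N^(-1/2) is the price of the balanced bilinear range, where the longer variable may be only about
  sqrt N long. It also gives z^3 <= N, on which the bound k <= N/z rests. The reduction to H <= 2q
  is forced by the shape of the bound: differencing produces frequencies t of size up to N^2 H, and
  counting their factorisations would cost H^epsilon, while only (N q)^epsilon is available. The
  coupling of k and m is rewritten with binary digits because an inequality between labels would not
  survive Cauchy-Schwarz, whereas an equality of labels splits one variable into disjoint classes
  and costs nothing. The congruence k m = 1 (mod 4) becomes part of the same label.\<close>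

lemma prime_factor_sum_two_coprime_squares:
  fixes x y p :: nat
  assumes "coprime x y" "prime p" "odd p" "p dvd x\<^sup>2 + y\<^sup>2"
  shows "p mod 4 = 1"
proof (rule ccontr)
  assume "p mod 4 \<noteq> 1"
  with \<open>odd p\<close> have "p mod 4 = 3" by presburger
  then obtain j where j: "p = 4 * j + 3" by (metis mult.commute mult_div_mod_eq)
  have nx: "\<not> p dvd x"
  proof
    assume "p dvd x"
    then have "p dvd y\<^sup>2" using assms(4) by (metis dvd_add_right_iff dvd_power dvd_trans pos2)
    then have "p dvd y" using assms(2) prime_dvd_power_nat by blast
    with \<open>p dvd x\<close> assms(1,2) show False by (meson coprime_common_divisor not_prime_unit)
  qed
  have ny: "\<not> p dvd y"
  proof
    assume "p dvd y"
    then have "p dvd x\<^sup>2" using assms(4) by (metis dvd_add_left_iff dvd_power dvd_trans pos2)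
    then have "p dvd x" using assms(2) prime_dvd_power_nat by blast
    with nx show False by simp
  qed
  have "[int (x\<^sup>2) = - int (y\<^sup>2)] (mod int p)"
    using assms(4) by (simp add: cong_iff_dvd_diff flip: of_nat_add of_nat_power)
  \<comment> \<open>The exponent 2 j + 1 = (p - 1) / 2 is odd, so the minus sign survives while
    Fermat turns both powers into 1. This yields 1 = -1 modulo the odd prime p.\<close>
  then have "[int (x\<^sup>2) ^ (2*j+1) = (- int (y\<^sup>2)) ^ (2*j+1)] (mod int p)" by (rule cong_pow)
  moreover have "int (x\<^sup>2) ^ (2*j+1) = int (x ^ (p - 1))" "(- int (y\<^sup>2)) ^ (2*j+1) = - int (y ^ (p - 1))"
  proof -
    have "p - 1 = 2 * (2*j+1)" using j by simp
    then show "int (x\<^sup>2) ^ (2*j+1) = int (x ^ (p - 1))" "(- int (y\<^sup>2)) ^ (2*j+1) = - int (y ^ (p - 1))"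
      by (simp_all only: power_mult of_nat_power power_minus_odd odd_two_times_div_two_succ even_mult_iff) simp_all
  qed
  ultimately have "[int (x ^ (p - 1)) = - int (y ^ (p - 1))] (mod int p)" by simp
  moreover have "[int (x ^ (p - 1)) = int 1] (mod int p)" "[int (y ^ (p - 1)) = int 1] (mod int p)"
    using fermat_theorem[OF assms(2) nx] fermat_theorem[OF assms(2) ny] by (simp_all only: cong_int_iff)
  ultimately have "[1 = (- 1 :: int)] (mod int p)"
    by (metis cong_minus_minus_iff cong_sym cong_trans of_nat_1)
  then have "int p dvd 2" by (simp add: cong_iff_dvd_diff)
  then have "p dvd 2" by presburger
  then have "p = 2" using assms(2) primes_dvd_imp_eq two_is_prime_nat by blast
  with \<open>odd p\<close> show False by simp
qed

lemma minus_one_square_mod_prime: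
  assumes "prime (p :: nat)" "p mod 4 = 1"
  shows "\<exists>r :: int. int p dvd r\<^sup>2 + 1"
proof -
  obtain j where j: "p = 4 * j + 1" by (metis assms(2) mult.commute mult_div_mod_eq)
  have "p > 2" using assms prime_ge_2_nat[of p] by (cases "p = 2") auto
  have "[Legendre (-1) (int p) = (-1) ^ ((p - 1) div 2)] (mod int p)"
    using euler_criterion[OF assms(1) \<open>p > 2\<close>] by blast
  moreover have "((-1) :: int) ^ ((p - 1) div 2) = 1" using j by simp
  ultimately have *: "[Legendre (-1) (int p) = 1] (mod int p)" by simp
  have "QuadRes (int p) (-1)"
  proof (rule ccontr)
    assume "\<not> QuadRes (int p) (-1)"
    then have "Legendre (-1) (int p) = 0 \<or> Legendre (-1) (int p) = -1" by (auto simp: Legendre_def)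
    with * have "int p dvd 1 \<or> int p dvd 2" by (auto simp: cong_iff_dvd_diff)
    with \<open>p > 2\<close> show False by (auto dest: zdvd_imp_le)
  qed
  then show ?thesis by (auto simp: QuadRes_def cong_iff_dvd_diff)
qed

text \<open>Induction that strips one prime p from n = p m. If p still divides m, the root modulo m
  is lifted as in Hensel's lemma; otherwise the roots modulo p and modulo m are glued by the Chinese
  remainder theorem. Since every p is 1 modulo 4, the prime 2, where lifting would fail, does not
  occur.\<close>

lemma minus_one_square_mod:
  assumes "n > 0" "\<And>p. prime p \<Longrightarrow> p dvd n \<Longrightarrow> p mod 4 = (1 :: nat)"
  shows "\<exists>r :: int. int n dvd r\<^sup>2 + 1"
  using assms
proof (induction n rule: less_induct)
  case (less n)
  show ?case
  proof (cases "n = 1")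
    case False
    then obtain p where p: "prime p" "p dvd n" using prime_factor_nat by blast
    then obtain m where m: "n = p * m" by blast
    have "m < n" "m > 0" using less.prems(1) m prime_gt_1_nat[OF p(1)] by auto
    then obtain r :: int where r: "int m dvd r\<^sup>2 + 1"
      using less.IH[of m] less.prems(2) m by auto
    have p4: "p mod 4 = 1" using less.prems(2) p by blast
    show ?thesis
    proof (cases "p dvd m")
      case True
      obtain t where t: "r\<^sup>2 + 1 = int m * t" using r by blast
      have "coprime (2 * r) (int p)"
      proof (rule coprimeI)
        fix c assume c: "c dvd 2 * r" "c dvd int p"
        have "int p dvd r\<^sup>2 + 1" using True r by (meson dvd_trans of_nat_dvd_iff)
        then have "c dvd r\<^sup>2 + 1" using c dvd_trans by blast
        then have "c dvd 4 * (r\<^sup>2 + 1) - 2 * r * (2 * r)" using c by (meson dvd_diff dvd_mult dvd_mult2)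
        then have "c dvd 4" by (simp add: power2_eq_square algebra_simps)
        moreover have "coprime (int p) 4"
        proof -
          have "odd p" using p4 by presburger
          then have "coprime (int p) 2" by simp
          then have "coprime (int p) (2 ^ 2)" by (simp only: coprime_power_right_iff) simp
          then show ?thesis by simp
        qed
        ultimately show "is_unit c" using c by (meson coprime_common_divisor)
      qed
      \<comment> \<open>The new root is r + x m. Its square plus 1 equals m (t + 2 r x) + (x m)^2;
        the last term is divisible by m p because p divides m, so only a linear congruence for x
        remains.\<close>
      then obtain x where x: "[2 * r * x = - t] (mod int p)"
        by (metis cong_solve_coprime_int cong_scalar_right mult.assoc mult_1)
      then have "int p dvd t + 2 * r * x"
        by (simp add: cong_iff_dvd_diff add.commute)
      then have "int m * int p dvd int m * (t + 2 * r * x)" by simp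
      moreover have "int m * int p dvd (x * int m)\<^sup>2"
        using True by (simp add: power2_eq_square algebra_simps mult_dvd_mono)
      ultimately have "int m * int p dvd int m * (t + 2 * r * x) + (x * int m)\<^sup>2" by simp
      moreover have "int m * (t + 2 * r * x) + (x * int m)\<^sup>2 = (r + x * int m)\<^sup>2 + 1"
        using t by (simp add: power2_eq_square algebra_simps)
      ultimately show ?thesis unfolding m by (metis mult.commute of_nat_mult)
    next
      case False
      then have "coprime p m" using p(1) prime_imp_coprime_nat by blast
      then have cop: "coprime (int p) (int m)" by simp
      obtain s where s: "int p dvd s\<^sup>2 + 1" using minus_one_square_mod_prime[OF p(1) p4] by blast
      obtain x where x: "[x = s] (mod int p)" "[x = r] (mod int m)"
        using binary_chinese_remainder_int[OF cop] by blast
      have "[x\<^sup>2 + 1 = s\<^sup>2 + 1] (mod int p)" "[x\<^sup>2 + 1 = r\<^sup>2 + 1] (mod int m)"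
        using x by (auto intro!: cong_add cong_pow)
      then have "int p dvd x\<^sup>2 + 1" "int m dvd x\<^sup>2 + 1"
        using s r by (auto simp: cong_dvd_iff)
      then have "int p * int m dvd x\<^sup>2 + 1" using cop by (rule divides_mult)
      then show ?thesis unfolding m by auto
    qed
  qed auto
qed

text \<open>Thue's lemma gives \<open>x \<equiv> r y\<close> with \<open>x\<^sup>2 + y\<^sup>2 \<in> {n, 2 n}\<close>; coprimality comes from
  \<open>x\<^sup>2 + y\<^sup>2 = y (\<dots>) + k x\<close> after writing \<open>x = r y + k n\<close> and dividing by \<open>n\<close>.\<close>
lemma coprime_squares_of_minus_one_square:
  fixes r :: int and n :: nat
  assumes "odd n" "int n dvd r\<^sup>2 + 1"
  shows "\<exists>u v :: int. coprime u v \<and> int n = u\<^sup>2 + v\<^sup>2"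
proof (cases "n = 1")
  case True
  then have "coprime (1::int) 0 \<and> int n = 1\<^sup>2 + 0\<^sup>2" by simp
  then show ?thesis by blast
next
  case False
  then have n1: "n > 1" using assms(1) odd_pos by fastforce
  define K where "K = nat \<lfloor>sqrt n\<rfloor>"
  have Kle: "real K \<le> sqrt n" unfolding K_def by simp
  have Kgt: "sqrt n < real K + 1" unfolding K_def by linarith
  have K1: "K * K \<le> n"
    by (metis Kle of_nat_0_le_iff of_nat_le_iff of_nat_mult power2_eq_square real_le_rsqrt sqrt_le_D real_sqrt_pow2_iff power_mono real_sqrt_pow2)
  have "real n < (real K + 1)\<^sup>2" using Kgt
    by (metis abs_of_nonneg add_nonneg_nonneg of_nat_0_le_iff real_sqrt_abs real_sqrt_less_iff zero_le_one)
  then have K2: "n < (K + 1) * (K + 1)"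
    by (metis (mono_tags, lifting) of_nat_1 of_nat_add of_nat_less_iff of_nat_mult power2_eq_square)
  define f where "f = (\<lambda>(x::nat, y::nat). (int x - r * int y) mod int n)"
  have "f ` ({0..K} \<times> {0..K}) \<subseteq> {0..<int n}" unfolding f_def using n1 by auto
  then have "card (f ` ({0..K} \<times> {0..K})) \<le> n"
    by (metis card_atLeastLessThan_int card_mono diff_zero finite_atLeastLessThan_int nat_int)
  also have "n < card ({0..K} \<times> {0..K})" using K2 by (simp add: card_cartesian_product)
  finally have "\<not> inj_on f ({0..K} \<times> {0..K})" by (rule pigeonhole)
  then obtain x1 y1 x2 y2 where xy: "x1 \<le> K" "y1 \<le> K" "x2 \<le> K" "y2 \<le> K" "(x1, y1) \<noteq> (x2, y2)"
      "f (x1, y1) = f (x2, y2)"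
    by (auto simp: inj_on_def)
  define x where "x = int x1 - int x2"
  define y where "y = int y1 - int y2"
  have nz: "x \<noteq> 0 \<or> y \<noteq> 0" using xy(5) by (auto simp: x_def y_def)
  have bd: "\<bar>x\<bar> \<le> int K" "\<bar>y\<bar> \<le> int K" using xy by (auto simp: x_def y_def)
  have "int n dvd (int x1 - r * int y1) - (int x2 - r * int y2)"
    using xy(6) unfolding f_def by (simp add: mod_eq_dvd_iff)
  then have "int n dvd x - r * y" by (simp add: x_def y_def algebra_simps)
  then obtain k where k: "x = r * y + k * int n" by (metis add.commute diff_eq_eq dvd_def mult.commute)
  obtain t where t: "r\<^sup>2 + 1 = int n * t" using assms(2) by blast
  have key: "x\<^sup>2 + y\<^sup>2 = int n * (y * (y * t + r * k) + k * x)"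
  proof -
    have "x\<^sup>2 + y\<^sup>2 = y\<^sup>2 * (r\<^sup>2 + 1) + r * y * k * int n + k * int n * x"
      unfolding k by (simp add: power2_eq_square algebra_simps)
    then show ?thesis unfolding t by (simp add: power2_eq_square algebra_simps)
  qed
  define c where "c = y * (y * t + r * k) + k * x"
  have x2: "x\<^sup>2 \<le> int n" "y\<^sup>2 \<le> int n"
  proof -
    have "\<bar>x\<bar> * \<bar>x\<bar> \<le> int K * int K" "\<bar>y\<bar> * \<bar>y\<bar> \<le> int K * int K" using bd by (intro mult_mono; simp)+
    then show "x\<^sup>2 \<le> int n" "y\<^sup>2 \<le> int n" using K1
      by (auto simp: power2_eq_square abs_mult_self_eq simp flip: of_nat_mult)
  qed
  have "int n * c > 0" using key nz unfolding c_def
    by (metis sum_power2_gt_zero_iff)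
  then have "c > 0" using n1 by (simp add: zero_less_mult_iff)
  have "int n * c \<le> int n * 2" using key x2 unfolding c_def by linarith
  then have "c \<le> 2" using n1 by simp
  have gcd: "d dvd c" if "d dvd x" "d dvd y" for d using that unfolding c_def by simp
  \<comment> \<open>Equality in both bounds on x^2 and y^2 would give |x| = |y|, a common divisor
    and hence a divisor of c = 2. As n is odd this leaves |x| = 1 and n = 1.\<close>
  have "c \<noteq> 2"
  proof
    assume "c = 2"
    then have "x\<^sup>2 + y\<^sup>2 = 2 * int n" using key unfolding c_def by simp
    then have "x\<^sup>2 = int n" "y\<^sup>2 = int n" using x2 by linarith+
    then have "\<bar>x\<bar> = \<bar>y\<bar>" by (metis power2_eq_iff_nonneg abs_ge_zero power2_abs)
    then have "x dvd y" by (metis dvd_abs_iff abs_dvd_iff dvd_refl)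
    then have "x dvd 2" using gcd[of x] \<open>c = 2\<close> by simp
    then have "\<bar>x\<bar> \<le> 2" using dvd_imp_le_int[of 2 x] by simp
    moreover have "odd x" using assms(1) \<open>x\<^sup>2 = int n\<close> by (metis even_of_nat even_power pos2)
    ultimately have "\<bar>x\<bar> = 1" by presburger
    then have "int n = 1" using \<open>x\<^sup>2 = int n\<close> by (metis one_power2 power2_abs)
    then show False using False by simp
  qed
  with \<open>c > 0\<close> \<open>c \<le> 2\<close> have "c = 1" by simp
  then have "int n = x\<^sup>2 + y\<^sup>2" using key unfolding c_def by simp
  moreover have "coprime x y" using gcd \<open>c = 1\<close> by (auto intro: coprimeI)
  ultimately show ?thesis by blast
qed

lemma mem_BB_iff: "n \<in> BB \<longleftrightarrow> odd n \<and> (\<forall>p. prime p \<longrightarrow> p dvd n \<longrightarrow> p mod 4 = 1)"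
proof (intro iffI conjI allI impI)
  assume n: "n \<in> BB"
  then show "odd n" by (simp add: BB_def)
  from n obtain u v :: int where uv: "coprime u v" "int n = u\<^sup>2 + v\<^sup>2" by (auto simp: BB_def)
  fix p assume p: "prime p" "p dvd n"
  have "coprime (nat \<bar>u\<bar>) (nat \<bar>v\<bar>)" using uv(1) by (simp add: coprime_nat_abs_left_iff)
  moreover have "n = (nat \<bar>u\<bar>)\<^sup>2 + (nat \<bar>v\<bar>)\<^sup>2"
  proof -
    have "int n = int ((nat \<bar>u\<bar>)\<^sup>2 + (nat \<bar>v\<bar>)\<^sup>2)" using uv(2) by simp
    then show ?thesis by (simp only: of_nat_eq_iff)
  qed
  moreover have "odd p" using \<open>odd n\<close> p dvd_trans by blast
  ultimately show "p mod 4 = 1" using prime_factor_sum_two_coprime_squares p by metis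
next
  assume "odd n \<and> (\<forall>p. prime p \<longrightarrow> p dvd n \<longrightarrow> p mod 4 = 1)"
  moreover from this have "n > 0" using odd_pos by blast
  ultimately show "n \<in> BB" unfolding BB_def
    using minus_one_square_mod[of n] coprime_squares_of_minus_one_square[of n] by auto
qed

section \<open>Decomposition of the characteristic function\<close>

definition primes_3mod4 :: "nat \<Rightarrow> nat set" where
  "primes_3mod4 n = {p \<in> prime_factors n. p mod 4 = 3}"

definition moebius_3mod4 :: "nat \<Rightarrow> real" where
  "moebius_3mod4 d = (if squarefree d \<and> (\<forall>p \<in> prime_factors d. p mod 4 = 3)
           then (-1) ^ card (prime_factors d) else 0)"

definition least_prime :: "nat \<Rightarrow> nat" where
  "least_prime k = Min (prime_factors k)"

text \<open>The value \<open>N + 1\<close> stands for \<open>\<infinity>\<close>; only \<open>m \<le> N\<close> occurs.\<close>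
definition least_prime_3mod4 :: "nat \<Rightarrow> nat \<Rightarrow> nat" where
  "least_prime_3mod4 N m = (if primes_3mod4 m = {} then N + 1 else Min (primes_3mod4 m))"

text \<open>Its support consists of the upper members k = p D of the pairs D, p D which the cut at z
  separates: D = k / p < z <= k with p = \<open>least_prime k\<close>. The cap N / z is built in
  because it confines both factors of n = k m to ranges where the bilinear estimate saves;
  \<open>critical_divisor_le\<close> shows that it discards nothing for n = 1 (mod 4).\<close>

definition critical_weight :: "real \<Rightarrow> real \<Rightarrow> nat \<Rightarrow> real" where
  "critical_weight N z k = (if z \<le> real k \<and> real k \<le> N / z \<and> real k / real (least_prime k) < z then moebius_3mod4 k else 0)"

lemma moebius_3mod4_1 [simp]: "moebius_3mod4 1 = 1" "moebius_3mod4 (Suc 0) = 1"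
  by (simp_all add: moebius_3mod4_def)

lemma moebius_3mod4_pos: "moebius_3mod4 d \<noteq> 0 \<Longrightarrow> d > 0"
  by (rule ccontr) (simp add: moebius_3mod4_def)

lemma abs_moebius_3mod4_le: "\<bar>moebius_3mod4 d\<bar> \<le> 1"
  by (simp add: moebius_3mod4_def)

lemma moebius_3mod4_prime_mult:
  assumes "prime p" "p mod 4 = 3" "\<not> p dvd d"
  shows "moebius_3mod4 (p * d) = - moebius_3mod4 d"
proof (cases "d = 0")
  case False
  have cop: "coprime p d" using assms(1,3) prime_imp_coprime_nat by blast
  have "squarefree (p * d) \<longleftrightarrow> squarefree d"
    using cop assms(1) squarefree_mult_coprime squarefree_multD squarefree_prime by blast
  moreover have pf: "prime_factors (p * d) = insert p (prime_factors d)"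
    using False assms(1) by (subst prime_factors_product) (auto simp: prime_prime_factors)
  moreover have "p \<notin> prime_factors d" using assms(3) by auto
  ultimately show ?thesis using assms(2) by (simp add: moebius_3mod4_def)
qed (simp add: moebius_3mod4_def)

lemma moebius_3mod4_squarefree: "moebius_3mod4 d \<noteq> 0 \<Longrightarrow> squarefree d"
  by (auto simp: moebius_3mod4_def split: if_splits)

lemma moebius_3mod4_prime_factor: "moebius_3mod4 d \<noteq> 0 \<Longrightarrow> p \<in> prime_factors d \<Longrightarrow> p mod 4 = 3"
  by (auto simp: moebius_3mod4_def split: if_splits)

lemma finite_primes_3mod4 [simp]: "finite (primes_3mod4 n)"
  by (simp add: primes_3mod4_def)

text \<open>The divisors with and without the prime \<open>p\<close> are paired by \<open>D \<mapsto> p D\<close>; a pair contributes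
  unless the cut at \<open>z\<close> separates its two members.\<close>
lemma sum_moebius_3mod4_divisors_truncated:
  assumes n: "n > 0" and ne: "primes_3mod4 n \<noteq> {}" and p: "p = Min (primes_3mod4 n)" and z: "z > 1"
  shows "(\<Sum>D | D dvd n \<and> real D < z. moebius_3mod4 D) +
         (\<Sum>k | k dvd n \<and> moebius_3mod4 k \<noteq> 0 \<and> z \<le> real k \<and> least_prime k = p \<and> real k / real p < z. moebius_3mod4 k) = 0"
proof -
  have pin: "p \<in> primes_3mod4 n" using ne p by simp
  then have pp: "prime p" "p mod 4 = 3" "p dvd n" by (auto simp: primes_3mod4_def)
  then have p1: "p \<ge> 1" using prime_ge_1_nat by blast
  \<comment> \<open>The set \<open>A\<close> holds the lower members of the pairs. The products p D
    with D in \<open>A\<close> split into those below z, which form \<open>A'\<close> and cancel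
    against \<open>A\<close>, and those from z on, which are exactly the k of the second
    sum.\<close>
  define A where "A = {D. D dvd n \<and> real D < z \<and> moebius_3mod4 D \<noteq> 0 \<and> \<not> p dvd D}"
  define A' where "A' = {D. D dvd n \<and> real D < z \<and> moebius_3mod4 D \<noteq> 0 \<and> p dvd D}"
  have fin: "finite {D. D dvd n \<and> Q D}" for Q
    by (rule finite_subset[of _ "{D. D dvd n}"]) (use n in auto)
  have finA: "finite A" "finite A'" unfolding A_def A'_def by (auto intro: fin)
  have *: "p * D dvd n \<and> moebius_3mod4 (p * D) = - moebius_3mod4 D" if "D \<in> A" for D
  proof -
    have "coprime p D" using that pp(1) prime_imp_coprime_nat by (auto simp: A_def)
    then have "p * D dvd n" using that pp(3) by (auto simp: A_def intro: divides_mult)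
    then show ?thesis using moebius_3mod4_prime_mult[OF pp(1,2)] that by (auto simp: A_def)
  qed
  have **: "\<exists>D. k = p * D \<and> D dvd n \<and> moebius_3mod4 D \<noteq> 0 \<and> \<not> p dvd D" if "k dvd n" "moebius_3mod4 k \<noteq> 0" "p dvd k" for k
  proof -
    obtain D where D: "k = p * D" using \<open>p dvd k\<close> by blast
    have "\<not> p dvd D"
    proof
      assume "p dvd D"
      then have "p ^ 2 dvd k" unfolding D by (auto simp: power2_eq_square)
      then show False using moebius_3mod4_squarefree[OF that(2)] squarefreeD pp(1) not_prime_unit by blast
    qed
    moreover have "D dvd n" using that(1) D by (metis dvd_mult_right)
    moreover have "moebius_3mod4 D \<noteq> 0" using moebius_3mod4_prime_mult[OF pp(1,2) calculation(1)] that(2) D by auto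
    ultimately show ?thesis using D by blast
  qed
  have inj: "inj_on (\<lambda>D. p * D) X" for X using p1 by (auto simp: inj_on_def)
  have le: "real D \<le> real (p * D)" for D using p1 by (metis le_add1 mult_eq_if not_one_le_zero of_nat_le_iff)
  have A'_eq: "A' = (\<lambda>D. p * D) ` {D \<in> A. real (p * D) < z}"
  proof (intro equalityI subsetI)
    fix k assume k: "k \<in> A'"
    then obtain D where D: "k = p * D" "D dvd n" "moebius_3mod4 D \<noteq> 0" "\<not> p dvd D"
      using **[of k] by (auto simp: A'_def)
    have "real D < z" using le[of D] k D(1) by (auto simp: A'_def)
    then show "k \<in> (\<lambda>D. p * D) ` {D \<in> A. real (p * D) < z}"
      using D k by (auto simp: A_def A'_def)
  next
    fix k assume "k \<in> (\<lambda>D. p * D) ` {D \<in> A. real (p * D) < z}"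
    then obtain D where D: "k = p * D" "D \<in> A" "real (p * D) < z" by auto
    then show "k \<in> A'" using *[of D] by (auto simp: A_def A'_def)
  qed
  let ?K = "{k. k dvd n \<and> moebius_3mod4 k \<noteq> 0 \<and> z \<le> real k \<and> least_prime k = p \<and> real k / real p < z}"
  have K_eq: "?K = (\<lambda>D. p * D) ` {D \<in> A. \<not> real (p * D) < z}"
  proof (intro equalityI subsetI)
    fix k assume k: "k \<in> ?K"
    have "k > 1" using k z by auto
    then have "prime_factors k \<noteq> {}" by (simp add: prime_factorization_empty_iff)
    then have "least_prime k \<in> prime_factors k" unfolding least_prime_def by (intro Min_in) auto
    then have "p dvd k" using k by auto
    then obtain D where D: "k = p * D" "D dvd n" "moebius_3mod4 D \<noteq> 0" "\<not> p dvd D"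
      using **[of k] k by auto
    have "real D < z" using k D(1) p1 by auto
    then show "k \<in> (\<lambda>D. p * D) ` {D \<in> A. \<not> real (p * D) < z}"
      using D k by (auto simp: A_def)
  next
    fix k assume "k \<in> (\<lambda>D. p * D) ` {D \<in> A. \<not> real (p * D) < z}"
    then obtain D where D: "k = p * D" "D \<in> A" "\<not> real (p * D) < z" by auto
    have k: "k dvd n" "moebius_3mod4 k \<noteq> 0" using *[OF D(2)] D by (auto simp: A_def)
    have "prime_factors k \<subseteq> primes_3mod4 n"
      using moebius_3mod4_prime_factor[OF k(2)] k(1) n by (auto simp: primes_3mod4_def in_prime_factors_iff intro: dvd_trans)
    moreover have "p \<in> prime_factors k" using D(1) pp(1) k moebius_3mod4_pos[of k] by (auto simp: in_prime_factors_iff)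
    ultimately have "least_prime k = p" unfolding least_prime_def p
      by (intro antisym Min_le Min.boundedI) (auto simp: p[symmetric] intro: Min_le Min_antimono)
    then show "k \<in> ?K" using k D p1 by (auto simp: A_def)
  qed
  have 1: "(\<Sum>D | D dvd n \<and> real D < z. moebius_3mod4 D) = sum moebius_3mod4 (A \<union> A')"
    by (rule sum.mono_neutral_right) (use fin in \<open>auto simp: A_def A'_def\<close>)
  also have "\<dots> = sum moebius_3mod4 A + sum moebius_3mod4 A'"
    using finA by (intro sum.union_disjoint) (auto simp: A_def A'_def)
  also have "sum moebius_3mod4 A' = (\<Sum>D \<in> {D \<in> A. real (p * D) < z}. - moebius_3mod4 D)"
    unfolding A'_eq using * by (subst sum.reindex[OF inj]) (auto intro!: sum.cong)
  finally have s1: "(\<Sum>D | D dvd n \<and> real D < z. moebius_3mod4 D) = sum moebius_3mod4 A + (\<Sum>D \<in> {D \<in> A. real (p * D) < z}. - moebius_3mod4 D)" .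
  have s2: "sum moebius_3mod4 ?K = (\<Sum>D \<in> {D \<in> A. \<not> real (p * D) < z}. - moebius_3mod4 D)"
    unfolding K_eq using * by (subst sum.reindex[OF inj]) (auto intro!: sum.cong)
  have "sum moebius_3mod4 A = sum moebius_3mod4 ({D \<in> A. real (p * D) < z} \<union> {D \<in> A. \<not> real (p * D) < z})"
    by (rule sum.cong) auto
  also have "\<dots> = sum moebius_3mod4 {D \<in> A. real (p * D) < z} + sum moebius_3mod4 {D \<in> A. \<not> real (p * D) < z}"
    using finA by (intro sum.union_disjoint) auto
  finally show ?thesis unfolding s1 s2 by (simp add: sum_negf)
qed

lemma mod4_eq_1_if_no_primes_3mod4:
  fixes n :: nat
  assumes "odd n" "primes_3mod4 n = {}"
  shows "n mod 4 = 1"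
  using assms
proof (induction n rule: less_induct)
  case (less n)
  show ?case
  proof (cases "n = 1")
    case False
    then obtain p where p: "prime p" "p dvd n" using prime_factor_nat by blast
    then obtain m where m: "n = p * m" by blast
    have n0: "n > 0" using less.prems(1) odd_pos by blast
    then have m0: "m < n" "m > 0" using m prime_gt_1_nat[OF p(1)] by auto
    have "primes_3mod4 m \<subseteq> primes_3mod4 n" using m n0 by (auto simp: primes_3mod4_def in_prime_factors_iff)
    then have "m mod 4 = 1" using less.IH[OF m0(1)] less.prems m by auto
    moreover have "p mod 4 = 1"
    proof -
      have "p \<notin> primes_3mod4 n" using less.prems by simp
      then have "p mod 4 \<noteq> 3" using p n0 by (auto simp: primes_3mod4_def in_prime_factors_iff)
      moreover have "odd p" using less.prems(1) m by simp
      ultimately show ?thesis by presburger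
    qed
    ultimately show ?thesis unfolding m by (simp add: mod_mult_eq[of p 4 m, symmetric])
  qed simp
qed

lemma mem_BB_iff_primes_3mod4: "n mod 4 = 1 \<Longrightarrow> n \<in> BB \<longleftrightarrow> primes_3mod4 n = {}"
proof -
  assume n: "n mod 4 = 1"
  then have "odd n" "n > 0" by presburger+
  have "p mod 4 = 1 \<longleftrightarrow> p mod 4 \<noteq> 3" if "p dvd n" for p
  proof -
    have "odd p" using that \<open>odd n\<close> dvd_trans by blast
    then show ?thesis by presburger
  qed
  then show ?thesis using \<open>odd n\<close> \<open>n > 0\<close> by (auto simp: mem_BB_iff primes_3mod4_def in_prime_factors_iff)
qed

lemma BB_mod4: "n \<in> BB \<Longrightarrow> n mod 4 = 1"
  by (rule mod4_eq_1_if_no_primes_3mod4) (auto simp: mem_BB_iff primes_3mod4_def in_prime_factors_iff)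

text \<open>The parity obstacle disappears here: \<open>k > N / z\<close> could only be a prime \<open>\<equiv> 3\<close> whose cofactor is
  free of primes \<open>\<equiv> 3 (mod 4)\<close>, contradicting \<open>n \<equiv> 1 (mod 4)\<close>.\<close>
lemma critical_divisor_le:
  fixes N z :: real
  assumes n: "n mod 4 = 1" "real n \<le> N" and z: "z > 1" "z ^ 3 \<le> N"
    and k: "k dvd n" "moebius_3mod4 k \<noteq> 0" "z \<le> real k" "least_prime k = Min (primes_3mod4 n)" "real k / real (least_prime k) < z"
  shows "real k \<le> N / z"
proof -
  have n0: "n > 0" using n by presburger
  have "k > 1" using k z by auto
  then have "prime_factors k \<noteq> {}" by (simp add: prime_factorization_empty_iff)
  then have lpin: "least_prime k \<in> prime_factors k" unfolding least_prime_def by (intro Min_in) auto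
  then have p: "prime (least_prime k)" "least_prime k mod 4 = 3" "least_prime k dvd k" using moebius_3mod4_prime_factor[OF k(2)] by auto
  then obtain d where d: "k = least_prime k * d" by blast
  have d0: "d > 0" using d \<open>k > 1\<close> by (cases d) auto
  have lp0: "least_prime k > 0" using p(1) prime_gt_0_nat by blast
  have dz: "real d < z" using k(5) lp0 by (subst (asm) d) simp
  have zN: "z \<le> N / z" "z * z \<le> N / z"
  proof -
    show "z * z \<le> N / z" using z by (simp add: field_simps power3_eq_cube)
    moreover have "z \<le> z * z" using z by simp
    ultimately show "z \<le> N / z" by linarith
  qed
  show ?thesis
  proof (cases "d = 1")
    case False
    \<comment> \<open>Any prime factor r of d satisfies p <= r <= d < z for p =
      \<open>least_prime k\<close>. So k = p d is at most z^2, and z^3 <= N finishes this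
      case.\<close>
    then obtain r where r: "prime r" "r dvd d" using prime_factor_nat by blast
    then have "r \<in> prime_factors k" using d \<open>k > 1\<close>
      by (metis dvd_mult in_prime_factors_iff not_one_less_zero)
    then have "least_prime k \<le> r" unfolding least_prime_def by simp
    also have "r \<le> d" using r(2) d0 by (simp add: dvd_imp_le)
    finally have "real (least_prime k) < z" using dz by linarith
    then have "real (least_prime k) * real d \<le> z * z" using dz z by (intro mult_mono) auto
    then have "real k \<le> z * z" using d by (metis of_nat_mult)
    then show ?thesis using zN by linarith
  next
    case True
    then have kp: "k = least_prime k" using d by simp
    obtain m where m: "n = k * m" using k(1) by blast
    show ?thesis
    proof (rule ccontr)
      assume *: "\<not> real k \<le> N / z"
      \<comment> \<open>If k were larger than N / z, the cofactor m would be smaller than z <= N / z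
        < k. A prime 3 mod 4 dividing m would then be smaller than k, the least such prime of n; so
        m is 1 mod 4 and n = k m is 3 mod 4.\<close>
      have "real m < z"
      proof (rule ccontr)
        assume "\<not> real m < z"
        then have "N / z * z < real k * real m" using * z n0 m
          by (intro mult_less_le_imp_less) (auto intro: divide_nonneg_pos order_trans[OF of_nat_0_le_iff n(2)])
        then show False using m n(2) z by simp
      qed
      then have mk: "m < k" using * zN by linarith
      have "odd n" using n(1) by presburger
      then have m0: "m > 0" "odd m" using m n0 by auto
      have "primes_3mod4 m = {}"
      proof (rule ccontr)
        assume "primes_3mod4 m \<noteq> {}"
        then obtain r where r: "r \<in> primes_3mod4 m" by blast
        then have "r \<in> primes_3mod4 n" using m n0 by (auto simp: primes_3mod4_def in_prime_factors_iff)
        then have "k \<le> r" using k(4) kp by (metis Min_le finite_primes_3mod4)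
        moreover have "r \<le> m" using r m0 by (auto simp: primes_3mod4_def dvd_imp_le)
        ultimately show False using mk by simp
      qed
      then have "m mod 4 = 1" using m0 mod4_eq_1_if_no_primes_3mod4 by blast
      moreover have "k mod 4 = 3" using p kp by simp
      ultimately have "n mod 4 = 3" unfolding m by (simp add: mod_mult_eq[of k 4 m, symmetric])
      then show False using n by simp
    qed
  qed
qed

text \<open>Without primes 3 mod 4 only D = 1 contributes; with such a prime, the truncated divisor
  sum is cancelled by the separated pairs. The condition that the least prime of k is the least
  prime 3 mod 4 of n is expressed through k and m = n div k separately, which is what makes the
  second sum bilinear.\<close>

lemma b_decomposition:
  fixes N :: nat and z :: real
  assumes n: "n mod 4 = 1" "n \<le> N" and z: "z > 1" "z ^ 3 \<le> real N"
  shows "b n = (\<Sum>D | D dvd n \<and> real D < z. moebius_3mod4 D) +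
               (\<Sum>k | k dvd n \<and> least_prime k \<le> least_prime_3mod4 N (n div k). critical_weight N z k)"
proof -
  have n0: "n > 0" using n by presburger
  have fin: "finite {D. D dvd n \<and> Q D}" for Q
    by (rule finite_subset[of _ "{D. D dvd n}"]) (use n0 in auto)
  have critical_weight: "critical_weight N z k = moebius_3mod4 k \<and> moebius_3mod4 k \<noteq> 0 \<and> z \<le> real k \<and> real k / real (least_prime k) < z" if "critical_weight N z k \<noteq> 0" for k
    using that by (auto simp: critical_weight_def split: if_splits)
  have lpin: "least_prime k \<in> prime_factors k \<and> prime_factors k \<noteq> {} \<and> prime_factors k \<subseteq> primes_3mod4 n"
    if "moebius_3mod4 k \<noteq> 0" "z \<le> real k" "k dvd n" for k
  proof -
    have "k > 1" using that z by auto
    then have "prime_factors k \<noteq> {}" by (simp add: prime_factorization_empty_iff)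
    moreover from this have "least_prime k \<in> prime_factors k" unfolding least_prime_def by (intro Min_in) auto
    ultimately show ?thesis using moebius_3mod4_prime_factor[OF that(1)] that(3) n0
      by (auto simp: primes_3mod4_def in_prime_factors_iff intro: dvd_trans)
  qed
  show ?thesis
  proof (cases "primes_3mod4 n = {}")
    case True
    have 1: "moebius_3mod4 D = 0" if "D dvd n" "D \<noteq> 1" for D
    proof (rule ccontr)
      assume "moebius_3mod4 D \<noteq> 0"
      have "D \<noteq> 0" using that n0 by auto
      then have "prime_factors D \<noteq> {}" using that by (simp add: prime_factorization_empty_iff)
      then obtain p where "p \<in> prime_factors D" by blast
      then have "p \<in> primes_3mod4 n" using moebius_3mod4_prime_factor[OF \<open>moebius_3mod4 D \<noteq> 0\<close>] that(1) n0
        by (auto simp: primes_3mod4_def in_prime_factors_iff intro: dvd_trans)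
      then show False using True by simp
    qed
    have "(\<Sum>D | D dvd n \<and> real D < z. moebius_3mod4 D) = (\<Sum>D \<in> {1}. moebius_3mod4 D)"
      using 1 z fin by (intro sum.mono_neutral_right) auto
    moreover have "(\<Sum>k | k dvd n \<and> least_prime k \<le> least_prime_3mod4 N (n div k). critical_weight N z k) = 0"
    proof (rule sum.neutral, safe, rule ccontr)
      fix k assume "k dvd n" "critical_weight N z k \<noteq> 0"
      then show False using critical_weight[of k] lpin[of k] True by auto
    qed
    moreover have "b n = 1" using mem_BB_iff_primes_3mod4[OF n(1)] True by (simp add: b_def)
    ultimately show ?thesis by simp
  next
    case False
    define p where "p = Min (primes_3mod4 n)"
    let ?K = "{k. k dvd n \<and> moebius_3mod4 k \<noteq> 0 \<and> z \<le> real k \<and> least_prime k = p \<and> real k / real p < z}"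
    have primes_3mod4_split: "primes_3mod4 n = prime_factors k \<union> primes_3mod4 m" if "n = k * m" "moebius_3mod4 k \<noteq> 0" for k m
      using that n0 moebius_3mod4_prime_factor[OF that(2)]
      by (auto simp: primes_3mod4_def in_prime_factors_iff prime_dvd_mult_iff)
    have iff: "least_prime k = p \<longleftrightarrow> least_prime k \<le> least_prime_3mod4 N (n div k)" if k: "k dvd n" "moebius_3mod4 k \<noteq> 0" "z \<le> real k" for k
    proof -
      obtain m where m: "n = k * m" using k(1) by blast
      have k0: "k > 0" using m n0 by (cases k) auto
      have nk: "n div k = m" using m k0 by simp
      have L: "least_prime k \<in> prime_factors k" "prime_factors k \<noteq> {}" using lpin[OF k(2,3,1)] by auto
      show ?thesis
      proof (cases "primes_3mod4 m = {}")
        case True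
        \<comment> \<open>Here \<open>least_prime_3mod4 N m\<close> is the placeholder N + 1, which
          exceeds every prime factor of k, so the coupling holds automatically.\<close>
        have "least_prime k \<le> k" using L(1) k0 by (auto simp: dvd_imp_le)
        also have "k \<le> N" using k(1) n0 n(2) by (meson dvd_imp_le le_trans)
        finally show ?thesis using True primes_3mod4_split[OF m k(2)] nk by (simp add: least_prime_3mod4_def least_prime_def p_def)
      next
        case False
        have "p = min (least_prime k) (Min (primes_3mod4 m))"
          unfolding p_def primes_3mod4_split[OF m k(2)] least_prime_def using L False by (intro Min_Un) auto
        moreover have "least_prime_3mod4 N (n div k) = Min (primes_3mod4 m)" using False nk by (simp add: least_prime_3mod4_def)
        ultimately show ?thesis by (metis min.absorb_iff1)
      qed
    qed
    have "(\<Sum>k | k dvd n \<and> least_prime k \<le> least_prime_3mod4 N (n div k). critical_weight N z k) = (\<Sum>k \<in> ?K. moebius_3mod4 k)"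
    proof (rule sum.mono_neutral_cong_right)
      show "?K \<subseteq> {k. k dvd n \<and> least_prime k \<le> least_prime_3mod4 N (n div k)}" using iff by auto
      show "\<forall>k \<in> {k. k dvd n \<and> least_prime k \<le> least_prime_3mod4 N (n div k)} - ?K. critical_weight N z k = 0"
        using critical_weight iff by (auto; metis)
      show "critical_weight N z k = moebius_3mod4 k" if "k \<in> ?K" for k
        using that critical_divisor_le[OF n(1) _ z, of k] n(2) by (auto simp: critical_weight_def p_def)
    qed (rule fin)
    moreover have "b n = 0" using mem_BB_iff_primes_3mod4[OF n(1)] False by (simp add: b_def)
    ultimately show ?thesis using sum_moebius_3mod4_divisors_truncated[OF n0 False p_def z(1)] by simp
  qed
qed

section \<open>Exponential sums\<close>

definition dist_int :: "real \<Rightarrow> real" where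
  "dist_int x = \<bar>x - of_int (round x)\<bar>"

text \<open>Comparable to \<open>min U (1 / d)\<close>, without the junk value at \<open>d = 0\<close>.\<close>
definition geom_majorant :: "real \<Rightarrow> real \<Rightarrow> real" where
  "geom_majorant U d = U / (1 + U * d)"

lemma dist_int_nonneg [simp]: "dist_int x \<ge> 0"
  by (simp add: dist_int_def)

lemma dist_int_le: "dist_int x \<le> \<bar>x - of_int m\<bar>"
  unfolding dist_int_def by (rule round_diff_minimal)

lemma dist_int_perturb: "dist_int x \<ge> dist_int y - \<bar>x - y\<bar>"
  using dist_int_le[of y "round x"] unfolding dist_int_def by linarith

lemma dist_int_int_div_ge:
  fixes x q :: int
  assumes "q > 0"
  shows "dist_int (of_int x / of_int q) \<ge> min (of_int (x mod q)) (of_int (q - x mod q)) / of_int q"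
proof -
  define m where "m = round (of_int x / of_int q :: real)"
  have "dist_int (of_int x / of_int q) = \<bar>of_int (x - q * m)\<bar> / real_of_int q"
    unfolding dist_int_def m_def[symmetric] using assms by (simp add: field_simps abs_if)
  moreover have "\<bar>x - q * m\<bar> \<ge> min (x mod q) (q - x mod q)"
  proof (cases "m \<le> x div q")
    case True
    have "x - q * m = x mod q + q * (x div q - m)"
      by (metis add.commute add_diff_eq int_distrib(4) mult_div_mod_eq)
    moreover have "q * (x div q - m) \<ge> 0" using True assms by simp
    ultimately show ?thesis by linarith
  next
    case False
    have "q * m - x = (q - x mod q) + q * (m - x div q - 1)"
      using mult_div_mod_eq[of q x] by (simp add: algebra_simps)
    moreover have "q * (m - x div q - 1) \<ge> 0" using False assms by simp
    ultimately show ?thesis by linarith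
  qed
  then have "min (of_int (x mod q)) (of_int (q - x mod q)) \<le> \<bar>real_of_int (x - q * m)\<bar>"
    by (metis of_int_abs of_int_le_iff of_int_min)
  ultimately show ?thesis using assms by (simp add: divide_right_mono)
qed

lemma geom_majorant_nonneg [simp]: "U \<ge> 0 \<Longrightarrow> d \<ge> 0 \<Longrightarrow> geom_majorant U d \<ge> 0"
  by (simp add: geom_majorant_def)

lemma geom_majorant_le: "U \<ge> 0 \<Longrightarrow> d \<ge> 0 \<Longrightarrow> geom_majorant U d \<le> U"
  unfolding geom_majorant_def by (subst pos_divide_le_eq) (auto simp: add_pos_nonneg algebra_simps)

lemma geom_majorant_le_inverse:
  assumes "U \<ge> 0" "c > 0" "d \<ge> c"
  shows "geom_majorant U d \<le> 1 / c"
proof -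
  have "U * c \<le> U * d" using assms by (intro mult_left_mono)
  then show ?thesis using assms unfolding geom_majorant_def
    by (simp add: frac_le_eq divide_le_eq pos_divide_le_eq add_pos_nonneg field_simps)
qed

section \<open>The additive character and Weyl differencing\<close>

lemma e_add: "e (x + y) = e x * e y"
  by (simp add: e_def algebra_simps exp_add)

lemma e_0 [simp]: "e 0 = 1"
  by (simp add: e_def)

lemma e_eq_cis: "e x = cis (2 * pi * x)"
  by (simp add: e_def cis_conv_exp mult_ac)

lemma norm_e [simp]: "norm (e x) = 1"
  by (simp add: e_eq_cis)

lemma cnj_e: "cnj (e x) = e (- x)"
  by (simp add: e_eq_cis cis_cnj)

lemma e_of_int [simp]: "e (of_int k) = 1"
  unfolding e_eq_cis by (rule cis_multiple_2pi) simp

lemma e_power: "e x ^ n = e (real n * x)"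
  by (induction n) (simp_all add: algebra_simps flip: e_add)

text \<open>Jordan's inequality: sine is concave on [0, pi], hence lies above its chord over
  [0, pi/2].\<close>

lemma sin_ge_linear:
  assumes "0 \<le> x" "x \<le> pi / 2"
  shows "sin x \<ge> 2 / pi * x"
proof -
  have "convex_on {0..pi} (\<lambda>x. - sin x)"
    by (rule f''_ge0_imp_convex[where f' = "\<lambda>x. - cos x" and f'' = sin])
       (auto intro!: derivative_eq_intros sin_ge_zero)
  from convex_onD[OF this, of "2 / pi * x" 0 "pi / 2"] assms
  show ?thesis by (simp add: field_simps)
qed

lemma norm_one_minus_e_ge: "norm (1 - e x) \<ge> 4 * dist_int x"
proof -
  define d where "d = x - of_int (round x)"
  have ndd: "dist_int x = \<bar>d\<bar>" by (simp add: dist_int_def d_def)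
  have d: "\<bar>d\<bar> \<le> 1 / 2" unfolding d_def using of_int_round_abs_le[of x] by (simp add: abs_minus_commute)
  have "e (d + of_int (round x)) = e d" by (subst e_add) simp
  then have ed: "e x = e d" by (simp add: d_def)
  have "(norm (1 - e d))\<^sup>2 = (1 - cos (2 * pi * d))\<^sup>2 + (sin (2 * pi * d))\<^sup>2"
    by (simp add: e_eq_cis cmod_power2)
  also have "\<dots> = 2 - 2 * cos (2 * (pi * d))"
    using sin_cos_squared_add[of "2 * pi * d"] by (simp add: power2_eq_square algebra_simps)
  also have "\<dots> = (2 * sin (pi * d))\<^sup>2"
    unfolding cos_double_sin by (simp add: power2_eq_square)
  finally have n: "norm (1 - e d) = 2 * \<bar>sin (pi * d)\<bar>"
    by (metis abs_mult abs_numeral norm_ge_zero power2_eq_iff_nonneg power2_abs abs_ge_zero)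
  have "\<bar>sin (pi * d)\<bar> = \<bar>sin (pi * \<bar>d\<bar>)\<bar>" by (cases "d \<ge> 0") auto
  moreover have "sin (pi * \<bar>d\<bar>) \<ge> 2 / pi * (pi * \<bar>d\<bar>)"
    using d by (intro sin_ge_linear) (auto simp: field_simps)
  ultimately have "\<bar>sin (pi * d)\<bar> \<ge> 2 * \<bar>d\<bar>" by (simp add: abs_if split: if_splits)
  then show ?thesis using n ed ndd by simp
qed

text \<open>The trivial bound norm s <= U and U times the geometric bound dist_int x * norm s <= 1
  are added, so no case distinction at integers arises. Allowing any U >= n gives the differenced
  sums, whose lengths vary, a common majorant.\<close>

lemma norm_sum_e_linear_le:
  assumes "n \<le> U"
  shows "norm (\<Sum>i<n. e (x * real i)) \<le> 2 * geom_majorant (real U) (dist_int x)"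
proof -
  define s where "s = (\<Sum>i<n. e (x * real i))"
  have "(1 - e x) * s = 1 - e x ^ n"
    unfolding s_def by (subst one_diff_power_eq) (simp add: e_power mult.commute)
  then have "norm (1 - e x) * norm s = norm (1 - e x ^ n)" by (metis norm_mult)
  also have "\<dots> \<le> 2" by (rule order_trans[OF norm_triangle_ineq4]) (simp add: norm_power)
  finally have *: "norm (1 - e x) * norm s \<le> 2" .
  have "4 * dist_int x * norm s \<le> norm (1 - e x) * norm s"
    using norm_one_minus_e_ge by (intro mult_right_mono) auto
  then have "dist_int x * norm s \<le> 1" using * by linarith
  then have "real U * (dist_int x * norm s) \<le> real U * 1" by (intro mult_left_mono) auto
  moreover have "norm s \<le> real U"
  proof -
    have "norm s \<le> (\<Sum>i<n. 1)" unfolding s_def by (intro order_trans[OF norm_sum] sum_mono) simp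
    then show ?thesis using assms by simp
  qed
  ultimately have "norm s * (1 + real U * dist_int x) \<le> 2 * real U" by (simp add: algebra_simps)
  moreover have "1 + real U * dist_int x > 0" by (simp add: add_pos_nonneg)
  ultimately show ?thesis unfolding s_def[symmetric] geom_majorant_def by (simp add: field_simps)
qed

lemma norm_sum_squared_eq:
  fixes x :: "nat \<Rightarrow> complex"
  assumes "\<And>i. norm (x i) = 1"
  shows "(norm (\<Sum>i<n. x i))\<^sup>2 = real n + 2 * Re (\<Sum>j<n. \<Sum>i<j. x j * cnj (x i))"
proof (induction n)
  case (Suc n)
  define s where "s = (\<Sum>i<n. x i)"
  have "(norm (s + x n))\<^sup>2 = (norm s)\<^sup>2 + (norm (x n))\<^sup>2 + 2 * Re (x n * cnj s)"
    unfolding cmod_power2 by (simp add: power2_eq_square algebra_simps)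
  then show ?case using Suc assms[of n] by (simp add: s_def sum_distrib_left cnj_sum)
qed simp

lemma sum_triangle_shift:
  fixes f :: "nat \<Rightarrow> nat \<Rightarrow> 'a :: comm_monoid_add"
  shows "(\<Sum>j<n. \<Sum>i<j. f j i) = (\<Sum>l\<in>{1..<n}. \<Sum>i<n - l. f (i + l) i)"
proof -
  have "(\<Sum>j<n. \<Sum>i<j. f j i) = (\<Sum>(j, i)\<in>(SIGMA j:{..<n}. {..<j}). f j i)"
    by (rule sum.Sigma) auto
  also have "\<dots> = (\<Sum>(l, i)\<in>(SIGMA l:{1..<n}. {..<n - l}). f (i + l) i)"
    by (rule sum.reindex_bij_witness[where i = "\<lambda>(l, i). (i + l, i)" and j = "\<lambda>(j, i). (j - i, i)"]) auto
  also have "\<dots> = (\<Sum>l\<in>{1..<n}. \<Sum>i<n - l. f (i + l) i)"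
    by (rule sum.Sigma[symmetric]) auto
  finally show ?thesis .
qed

text \<open>Pairing the terms i + l and i makes the phase linear in i with frequency 2 A l, while B
  and C only enter unimodular factors. The bound therefore depends on A and U alone, whatever
  residue class or starting point produced the polynomial.\<close>

lemma weyl_quadratic:
  assumes "n \<le> U"
  shows "(norm (\<Sum>i<n. e (A * (real i)\<^sup>2 + B * real i + C)))\<^sup>2
           \<le> real U + 4 * (\<Sum>l = 1..U. geom_majorant (real U) (dist_int (2 * A * real l)))"
proof -
  define x where "x = (\<lambda>i. e (A * (real i)\<^sup>2 + B * real i + C))"
  have "(norm (\<Sum>i<n. x i))\<^sup>2 = real n + 2 * Re (\<Sum>l\<in>{1..<n}. \<Sum>i<n - l. x (i + l) * cnj (x i))"
    by (subst norm_sum_squared_eq) (simp_all add: x_def sum_triangle_shift[of "\<lambda>j i. x j * cnj (x i)" n, unfolded x_def])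
  also have "Re (\<Sum>l\<in>{1..<n}. \<Sum>i<n - l. x (i + l) * cnj (x i))
      \<le> (\<Sum>l\<in>{1..<n}. norm (\<Sum>i<n - l. x (i + l) * cnj (x i)))"
    by (intro order_trans[OF complex_Re_le_cmod] norm_sum)
  also have "\<dots> \<le> (\<Sum>l\<in>{1..<n}. 2 * geom_majorant (real U) (dist_int (2 * A * real l)))"
  proof (rule sum_mono)
    fix l assume "l \<in> {1..<n}"
    have "x (i + l) * cnj (x i) = e (A * (real l)\<^sup>2 + B * real l) * e (2 * A * real l * real i)" for i
      by (simp add: x_def cnj_e power2_eq_square algebra_simps flip: e_add)
    then have "norm (\<Sum>i<n - l. x (i + l) * cnj (x i)) = norm (\<Sum>i<n - l. e (2 * A * real l * real i))"
      by (simp add: norm_mult flip: sum_distrib_left)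
    also have "\<dots> \<le> 2 * geom_majorant (real U) (dist_int (2 * A * real l))"
      using assms by (intro norm_sum_e_linear_le) auto
    finally show "norm (\<Sum>i<n - l. x (i + l) * cnj (x i)) \<le> 2 * geom_majorant (real U) (dist_int (2 * A * real l))" .
  qed
  also have "\<dots> \<le> (\<Sum>l = 1..U. 2 * geom_majorant (real U) (dist_int (2 * A * real l)))"
    using assms by (intro sum_mono2) auto
  finally show ?thesis using assms unfolding x_def by (simp flip: sum_distrib_left)
qed

section \<open>Sums of the geometric majorant over multiples of alpha\<close>

lemma harm_eq: "(\<Sum>r = 1..n. 1 / real r) = harm n"
  by (simp add: harm_def inverse_eq_divide)

text \<open>Over q consecutive indices the point gamma + i alpha stays within 3/(2q) of (c + i a)/q,
  and the residues c + i a run through all classes modulo q exactly once. The three classes nearest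
  to 0 get the trivial bound U, the others form two harmonic sums, one for each side of an
  integer.\<close>

lemma sum_geom_majorant_block:
  fixes a :: int and q :: nat
  assumes q: "q \<ge> 1" and cop: "coprime a (int q)"
    and al: "\<bar>\<alpha> - of_int a / real q\<bar> \<le> 1 / (real q)\<^sup>2" and U: "U \<ge> 0"
  shows "(\<Sum>i<q. geom_majorant U (dist_int (\<gamma> + real i * \<alpha>))) \<le> 3 * U + 8 * real q * harm q"
proof -
  define c where "c = round (real q * \<gamma>)"
  define r where "r = (\<lambda>i::nat. nat ((c + int i * a) mod int q))"
  \<comment> \<open>The residues 0, 1 and q - 1 are those for which the error 3/(2q) may swallow the
    distance to the nearest integer. For the others 1 / min r (q - r) is bounded by 1/r + 1/(q - r),
    which avoids ordering the residues.\<close>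
  define G where "G = (\<lambda>r::nat. (if r \<in> {0, 1, q - 1} then U else 0) + 4 * real q / real r + 4 * real q / real (q - r))"
  have r: "int (r i) = (c + int i * a) mod int q" for i using q by (simp add: r_def)
  have rq: "r i < q" for i using r[of i] q by (metis of_nat_0_less_iff of_nat_less_iff pos_mod_bound zero_less_one less_le_trans)
  have inj: "inj_on r {..<q}"
  proof (rule inj_onI)
    fix i j assume ij: "i \<in> {..<q}" "j \<in> {..<q}" "r i = r j"
    then have "[c + int i * a = c + int j * a] (mod int q)" using r[of i] r[of j] by (simp add: cong_def)
    then have "[int i * a = int j * a] (mod int q)" by (simp add: cong_add_lcancel)
    then have "[int i = int j] (mod int q)" using cop by (simp add: cong_mult_rcancel)
    then show "i = j" using ij by (simp add: cong_int_iff cong_less_modulus_unique_nat)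
  qed
  have pt: "geom_majorant U (dist_int (\<gamma> + real i * \<alpha>)) \<le> G (r i)" if i: "i < q" for i
  proof (cases "r i \<in> {0, 1, q - 1}")
    case True
    have "geom_majorant U (dist_int (\<gamma> + real i * \<alpha>)) \<le> U" using U by (intro geom_majorant_le) auto
    then show ?thesis using True by (auto simp: G_def intro: order_trans add_nonneg_nonneg)
  next
    case False
    define s where "s = min (r i) (q - r i)"
    have s2: "s \<ge> 2" using False rq[of i] by (auto simp: s_def)
    have d1: "\<bar>\<gamma> - of_int c / real q\<bar> \<le> 1 / (2 * real q)"
    proof -
      have "\<bar>real q * \<gamma> - of_int c\<bar> \<le> 1 / 2" unfolding c_def
        using of_int_round_abs_le[of "real q * \<gamma>"] by (simp add: abs_minus_commute)
      moreover have "\<gamma> - of_int c / real q = (real q * \<gamma> - of_int c) / real q" using q by (simp add: field_simps)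
      ultimately show ?thesis using q by (simp add: field_simps)
    qed
    have d2: "\<bar>real i * (\<alpha> - of_int a / real q)\<bar> \<le> 1 / real q"
    proof -
      have "real i * \<bar>\<alpha> - of_int a / real q\<bar> \<le> real q * (1 / (real q)\<^sup>2)"
        using i al by (intro mult_mono) auto
      then show ?thesis using q by (simp add: abs_mult power2_eq_square)
    qed
    have eq: "\<gamma> + real i * \<alpha> - of_int (c + int i * a) / real q
        = (\<gamma> - of_int c / real q) + real i * (\<alpha> - of_int a / real q)"
      using q by (simp add: field_simps)
    have d3: "\<bar>\<gamma> + real i * \<alpha> - of_int (c + int i * a) / real q\<bar> \<le> 3 / (2 * real q)"
    proof -
      have "\<bar>\<gamma> + real i * \<alpha> - of_int (c + int i * a) / real q\<bar> \<le> 1 / (2 * real q) + 1 / real q"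
        unfolding eq using d1 d2 by (rule order_trans[OF abs_triangle_ineq add_mono])
      also have "1 / (2 * real q) + 1 / real q = 3 / (2 * real q)" using q by (simp add: field_simps)
      finally show ?thesis .
    qed
    have "dist_int (of_int (c + int i * a) / of_int (int q)) \<ge>
        min (of_int ((c + int i * a) mod int q)) (of_int (int q - (c + int i * a) mod int q)) / of_int (int q)"
      using q by (intro dist_int_int_div_ge) simp
    also have "min (of_int ((c + int i * a) mod int q)) (of_int (int q - (c + int i * a) mod int q)) = real s"
      unfolding r[symmetric] s_def using rq[of i] by (simp add: of_nat_diff of_nat_min)
    finally have "dist_int (of_int (c + int i * a) / real q) \<ge> real s / real q" by simp
    then have "dist_int (\<gamma> + real i * \<alpha>) \<ge> real s / real q - 3 / (2 * real q)"
      using dist_int_perturb[of "of_int (c + int i * a) / real q" "\<gamma> + real i * \<alpha>"] d3 by linarith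
    \<comment> \<open>This is equivalent to s >= 2, which explains the choice of exceptional
      residues.\<close>
    moreover have "real s / real q - 3 / (2 * real q) \<ge> real s / (4 * real q)"
      using s2 q by (simp add: field_simps)
    ultimately have "geom_majorant U (dist_int (\<gamma> + real i * \<alpha>)) \<le> 1 / (real s / (4 * real q))"
      using U s2 q by (intro geom_majorant_le_inverse) auto
    also have "\<dots> = 4 * real q / real s" by simp
    also have "\<dots> \<le> G (r i)" using U unfolding G_def s_def min_def by auto
    finally show ?thesis .
  qed
  have G0: "G r \<ge> 0" for r using U by (simp add: G_def)
  have "(\<Sum>i<q. geom_majorant U (dist_int (\<gamma> + real i * \<alpha>))) \<le> (\<Sum>i<q. G (r i))" using pt by (intro sum_mono) auto
  also have "\<dots> = sum G (r ` {..<q})" using inj by (simp add: sum.reindex)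
  also have "\<dots> \<le> sum G {..<q}" using rq G0 by (intro sum_mono2) auto
  also have "\<dots> = (\<Sum>r<q. if r \<in> {0, 1, q - 1} then U else 0) + (\<Sum>r<q. 4 * real q / real r) + (\<Sum>r<q. 4 * real q / real (q - r))"
    by (simp add: G_def sum.distrib)
  also have "(\<Sum>r<q. if r \<in> {0, 1, q - 1} then U else 0) \<le> 3 * U"
  proof -
    have "(\<Sum>r<q. if r \<in> {0, 1, q - 1} then U else 0) = U * real (card ({..<q} \<inter> {0, 1, q - 1}))"
      by (subst sum.inter_restrict[symmetric]) (simp_all add: mult.commute)
    also have "card ({..<q} \<inter> {0, 1, q - 1}) \<le> card {0, 1, q - 1}" by (intro card_mono) auto
    also have "card {0, 1, q - 1} \<le> 3" by (simp add: card_insert_if)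
    finally show ?thesis using U by (simp add: mult.commute mult_left_mono)
  qed
  also have "(\<Sum>r<q. 4 * real q / real r) \<le> 4 * real q * harm q"
  proof -
    have "(\<Sum>r<q. 4 * real q / real r) = 4 * real q * (\<Sum>r<q. 1 / real r)" by (simp add: sum_distrib_left)
    \<comment> \<open>The index r = 0 contributes 1 / 0 = 0; that residue is already covered by U in
      \<open>G\<close>.\<close>
    also have "(\<Sum>r<q. 1 / real r) = (\<Sum>r\<in>{1..<q}. 1 / real r)"
      by (rule sum.mono_neutral_right) auto
    also have "\<dots> \<le> (\<Sum>r = 1..q. 1 / real r)" by (intro sum_mono2) auto
    finally show ?thesis unfolding harm_eq by (simp add: mult_left_mono)
  qed
  also have "(\<Sum>r<q. 4 * real q / real (q - r)) = 4 * real q * harm q"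
  proof -
    have "(\<Sum>r<q. 4 * real q / real (q - r)) = 4 * real q * (\<Sum>r<q. 1 / real (q - r))" by (simp add: sum_distrib_left)
    also have "(\<Sum>r<q. 1 / real (q - r)) = (\<Sum>r = 1..q. 1 / real r)"
      by (rule sum.reindex_bij_witness[where i = "\<lambda>r. q - r" and j = "\<lambda>r. q - r"]) auto
    finally show ?thesis unfolding harm_eq .
  qed
  finally show ?thesis by (simp add: algebra_simps)
qed

lemma sum_geom_majorant_le:
  fixes a :: int and q :: nat
  assumes q: "q \<ge> 1" and cop: "coprime a (int q)"
    and al: "\<bar>\<alpha> - of_int a / real q\<bar> \<le> 1 / (real q)\<^sup>2" and U: "U \<ge> 0"
  shows "(\<Sum>t = 1..T. geom_majorant U (dist_int (real t * \<alpha>))) \<le> (real T / real q + 1) * (3 * U + 8 * real q * harm q)"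
proof -
  define m where "m = T div q + 1"
  have "T < m * q" unfolding m_def using q by (metis Suc_eq_plus1 div_less_iff_less_mult less_Suc_eq less_le_trans zero_less_one)
  have "(\<Sum>t = 1..T. geom_majorant U (dist_int (real t * \<alpha>))) \<le> (\<Sum>t<m * q. geom_majorant U (dist_int (real t * \<alpha>)))"
    using U \<open>T < m * q\<close> by (intro sum_mono2) auto
  also have "\<dots> = (\<Sum>j<m. \<Sum>t = j * q..<j * q + q. geom_majorant U (dist_int (real t * \<alpha>)))"
    by (rule sum.nat_group[symmetric])
  also have "\<dots> \<le> (\<Sum>j<m. 3 * U + 8 * real q * harm q)"
  proof (rule sum_mono)
    fix j
    have "(\<Sum>t = j * q..<j * q + q. geom_majorant U (dist_int (real t * \<alpha>))) = (\<Sum>i<q. geom_majorant U (dist_int (real (j * q) * \<alpha> + real i * \<alpha>)))"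
      by (rule sum.reindex_bij_witness[where i = "\<lambda>i. j * q + i" and j = "\<lambda>t. t - j * q"]) (auto simp: algebra_simps)
    also have "\<dots> \<le> 3 * U + 8 * real q * harm q" by (rule sum_geom_majorant_block[OF assms])
    finally show "(\<Sum>t = j * q..<j * q + q. geom_majorant U (dist_int (real t * \<alpha>))) \<le> 3 * U + 8 * real q * harm q" .
  qed
  also have "\<dots> = real m * (3 * U + 8 * real q * harm q)" by simp
  also have "real m \<le> real T / real q + 1" unfolding m_def using real_of_nat_div[of T q] by (simp add: of_nat_div_le_of_nat)
  finally show ?thesis using U harm_nonneg[of q, where 'a = real] by (simp add: mult_right_mono)
qed

section \<open>The divisor bound\<close>

lemma card_divisors_prime_power_mult_le:
  fixes p m :: nat
  assumes "prime p" "m > 0"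
  shows "card {d. d dvd p ^ k * m} \<le> (k + 1) * card {d. d dvd m}"
proof -
  have "{d. d dvd p ^ k * m} \<subseteq> (\<lambda>(i, d). p ^ i * d) ` ({..k} \<times> {d. d dvd m})"
  proof
    fix d assume "d \<in> {d. d dvd p ^ k * m}"
    then obtain x y where xy: "d = x * y" "x dvd p ^ k" "y dvd m" using division_decomp by blast
    then obtain i where "i \<le> k" "x = p ^ i" using divides_primepow_nat[OF assms(1)] by blast
    then show "d \<in> (\<lambda>(i, d). p ^ i * d) ` ({..k} \<times> {d. d dvd m})" using xy by auto
  qed
  then have "card {d. d dvd p ^ k * m} \<le> card ({..k} \<times> {d. d dvd m})"
    by (rule surj_card_le[rotated]) (use assms in auto)
  then show ?thesis by (simp add: card_cartesian_product)
qed

text \<open>The inequality 1 + x <= exp x is applied at x = k eta ln 2. When eta ln 2 < 1 the slope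
  is too small, and the constant 1 / c compensates.\<close>

lemma linear_le_exponential:
  fixes \<eta> :: real
  assumes "\<eta> > 0"
  shows "\<exists>M\<ge>1. \<forall>k. real k + 1 \<le> M * (2 powr \<eta>) ^ k"
proof -
  define c where "c = min 1 (\<eta> * ln 2)"
  have c: "c > 0" "c \<le> 1" "c \<le> \<eta> * ln 2" using assms by (auto simp: c_def)
  have "real k + 1 \<le> 1 / c * (2 powr \<eta>) ^ k" for k
  proof -
    have "c * (real k + 1) \<le> 1 + real k * (\<eta> * ln 2)"
      using c mult_left_mono[OF c(3), of "real k"] by (simp add: algebra_simps)
    also have "\<dots> \<le> exp (real k * (\<eta> * ln 2))" by (rule exp_ge_add_one_self)
    also have "\<dots> = (2 powr \<eta>) ^ k" by (simp add: powr_def exp_of_nat_mult)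
    finally show ?thesis using c by (simp add: field_simps)
  qed
  moreover have "1 / c \<ge> 1" using c by simp
  ultimately show ?thesis by blast
qed

text \<open>Only the primes \<open>p < P\<close> with \<open>p\<^sup>\<eta> < 2\<close> cost a constant factor.\<close>
lemma divisor_bound:
  fixes \<eta> :: real
  assumes "\<eta> > 0"
  shows "\<exists>C\<ge>1. \<forall>n::nat. n > 0 \<longrightarrow> real (card {d. d dvd n}) \<le> C * real n powr \<eta>"
proof -
  obtain M where M: "M \<ge> 1" "\<And>k. real k + 1 \<le> M * (2 powr \<eta>) ^ k"
    using linear_le_exponential[OF assms] by blast
  define P where "P = nat \<lceil>2 powr (1 / \<eta>)\<rceil>"
  have P: "2 \<le> real p powr \<eta>" if "p \<ge> P" for p
  proof -
    have "2 powr (1 / \<eta>) \<le> real p" using that unfolding P_def by linarith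
    then have "(2 powr (1 / \<eta>)) powr \<eta> \<le> real p powr \<eta>" using assms by (intro powr_mono2) auto
    then show ?thesis using assms by (simp add: powr_powr)
  qed
  have main: "real (card {d. d dvd n}) \<le> M ^ card {p \<in> prime_factors n. p < P} * real n powr \<eta>" if "n > 0" for n :: nat
    using that
  proof (induction n rule: less_induct)
    case (less n)
    show ?case
    proof (cases "n = 1")
      case False
      then obtain p where p: "prime p" "p dvd n" using prime_factor_nat by blast
      define k where "k = multiplicity p n"
      obtain m where m: "n = p ^ k * m" "\<not> p dvd m"
        using multiplicity_decompose'[of n p] less.prems p(1) not_prime_unit unfolding k_def by blast
      have k1: "k \<ge> 1" using p less.prems unfolding k_def
        by (metis One_nat_def Suc_leI not_prime_unit multiplicity_gt_zero_iff neq0_conv)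
      have m0: "m > 0" using m less.prems by (cases m) auto
      have "p ^ k > 1" using k1 prime_gt_1_nat[OF p(1)] by (metis one_less_power not_one_le_zero neq0_conv)
      then have "m < n" using m m0 by simp
      have IH: "real (card {d. d dvd m}) \<le> M ^ card {p \<in> prime_factors m. p < P} * real m powr \<eta>"
        by (rule less.IH[OF \<open>m < n\<close> m0])
      have pf: "prime_factors n = insert p (prime_factors m)"
        unfolding m(1) using m0 p(1) k1
        by (subst prime_factors_product) (auto simp: prime_factors_power prime_prime_factors)
      have pnm: "p \<notin> prime_factors m" using m(2) by auto
      define c where "c = card {p \<in> prime_factors m. p < P}"
      have step: "(real k + 1) * M ^ c \<le> M ^ card {p \<in> prime_factors n. p < P} * (real p powr \<eta>) ^ k"
      proof (cases "p < P")
        case True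
        have "{r \<in> prime_factors n. r < P} = insert p {r \<in> prime_factors m. r < P}" using pf True by auto
        then have cd: "card {r \<in> prime_factors n. r < P} = Suc c" using pnm by (simp add: c_def)
        have "2 powr \<eta> \<le> real p powr \<eta>" using prime_ge_2_nat[OF p(1)] assms by (intro powr_mono2) auto
        then have "(2 powr \<eta>) ^ k \<le> (real p powr \<eta>) ^ k" by (intro power_mono) auto
        then have "M * (2 powr \<eta>) ^ k \<le> M * (real p powr \<eta>) ^ k" using M by (intro mult_left_mono) auto
        then have "real k + 1 \<le> M * (real p powr \<eta>) ^ k" using M(2)[of k] by linarith
        then have "(real k + 1) * M ^ c \<le> (M * (real p powr \<eta>) ^ k) * M ^ c" using M by (intro mult_right_mono) auto
        then show ?thesis unfolding cd by (simp add: mult_ac)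
      next
        case False
        have "{r \<in> prime_factors n. r < P} = {r \<in> prime_factors m. r < P}" using pf False by auto
        then have cd: "card {r \<in> prime_factors n. r < P} = c" by (simp add: c_def)
        have "real k + 1 \<le> 2 ^ k" using Suc_leI[OF less_exp[of k]] by (metis of_nat_Suc of_nat_le_iff of_nat_numeral of_nat_power add.commute)
        also have "\<dots> \<le> (real p powr \<eta>) ^ k" using P[of p] False by (intro power_mono) auto
        finally show ?thesis unfolding cd using M by (simp add: mult.commute mult_left_mono)
      qed
      have "real (card {d. d dvd n}) \<le> real ((k + 1) * card {d. d dvd m})"
        unfolding m(1) by (simp only: of_nat_le_iff card_divisors_prime_power_mult_le[OF p(1) m0])
      also have "\<dots> = (real k + 1) * real (card {d. d dvd m})" by (simp add: algebra_simps)
      also have "\<dots> \<le> (real k + 1) * (M ^ c * real m powr \<eta>)" using IH unfolding c_def by (intro mult_left_mono) auto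
      also have "\<dots> = ((real k + 1) * M ^ c) * real m powr \<eta>" by simp
      also have "\<dots> \<le> (M ^ card {p \<in> prime_factors n. p < P} * (real p powr \<eta>) ^ k) * real m powr \<eta>"
        using step by (intro mult_right_mono) auto
      also have "\<dots> = M ^ card {p \<in> prime_factors n. p < P} * real n powr \<eta>"
        by (simp add: m(1) powr_mult powr_power powr_realpow[symmetric] powr_powr mult_ac prime_gt_0_nat[OF p(1)])
      finally show ?thesis .
    qed simp
  qed
  have "real (card {d. d dvd n}) \<le> M ^ P * real n powr \<eta>" if "n > 0" for n :: nat
  proof -
    have "card {p \<in> prime_factors n. p < P} \<le> card {..<P}" by (intro card_mono) auto
    then have "M ^ card {p \<in> prime_factors n. p < P} \<le> M ^ P" using M by (intro power_increasing) auto
    then show ?thesis using main[OF that] by (meson mult_right_mono order_trans powr_ge_zero)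
  qed
  moreover have "M ^ P \<ge> 1" using M by simp
  ultimately show ?thesis by blast
qed

text \<open>Differencing yields majorants evaluated at products of several variables. Grouping by
  the value t of the product leaves a sum over consecutive t, at the cost of the largest number R of
  representations.\<close>

lemma sum_le_fiber_bound:
  fixes g :: "nat \<Rightarrow> real"
  assumes fin: "finite I" and rng: "\<And>i. i \<in> I \<Longrightarrow> 1 \<le> f i \<and> f i \<le> T"
    and fib: "\<And>t. 1 \<le> t \<Longrightarrow> t \<le> T \<Longrightarrow> real (card {i \<in> I. f i = t}) \<le> R"
    and nonneg: "\<And>t. g t \<ge> 0"
  shows "(\<Sum>i\<in>I. g (f i)) \<le> R * (\<Sum>t = 1..T. g t)"
proof -
  have "(\<Sum>i\<in>I. g (f i)) = (\<Sum>t = 1..T. \<Sum>i\<in>{i \<in> I. f i = t}. g (f i))"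
    by (rule sum.group[symmetric]) (use fin rng in auto)
  also have "\<dots> = (\<Sum>t = 1..T. real (card {i \<in> I. f i = t}) * g t)"
    by (intro sum.cong) auto
  also have "\<dots> \<le> (\<Sum>t = 1..T. R * g t)"
    using fib nonneg by (intro sum_mono mult_right_mono) auto
  finally show ?thesis by (simp add: sum_distrib_left)
qed

section \<open>Type I and bilinear sums\<close>

lemma norm_sum_squared_le:
  fixes f :: "'a \<Rightarrow> complex"
  shows "(norm (\<Sum>i\<in>I. f i))\<^sup>2 \<le> real (card I) * (\<Sum>i\<in>I. (norm (f i))\<^sup>2)"
proof -
  have "(norm (\<Sum>i\<in>I. f i))\<^sup>2 \<le> (\<Sum>i\<in>I. norm (f i))\<^sup>2"
    by (intro power_mono norm_sum) auto
  also have "\<dots> \<le> (\<Sum>i\<in>I. (norm (f i))\<^sup>2) * card I" by (rule sum_squared_le_sum_of_squares)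
  finally show ?thesis by (simp add: mult.commute)
qed

text \<open>Counts representations of t one divisor at a time: the map \<open>g\<close> exhibits one
  coordinate as a divisor of t, and X collects the remaining data, usually further divisors.\<close>

lemma card_divisor_tuples_le:
  fixes t :: nat and B :: real
  assumes "t > 0" "real (card {d. d dvd t}) \<le> B" "inj_on g J" "\<And>x. x \<in> J \<Longrightarrow> g x \<in> {d. d dvd t} \<times> X" "finite X"
  shows "real (card J) \<le> B * real (card X)"
proof -
  have "card J \<le> card ({d. d dvd t} \<times> X)"
  proof (rule card_inj_on_le[OF assms(3)])
    show "g ` J \<subseteq> {d. d dvd t} \<times> X" using assms(4) by blast
    show "finite ({d. d dvd t} \<times> X)" using assms(1,5) by simp
  qed
  then have "real (card J) \<le> real (card {d. d dvd t}) * real (card X)"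
    by (simp add: card_cartesian_product flip: of_nat_mult)
  also have "\<dots> \<le> B * real (card X)" using assms by (intro mult_right_mono) auto
  finally show ?thesis .
qed

text \<open>An odd D is its own inverse modulo 4, so D l = 1 (mod 4) means l = D (mod 4). With l = D
  mod 4 + 4 i the sum runs over an initial segment of i, and n^2 becomes a quadratic polynomial in
  i.\<close>

lemma sum_progression_eq:
  assumes D: "odd D" "D > 0" and f: "f = (\<lambda>i. D * (D mod 4 + 4 * i))"
  shows "\<exists>n \<le> N div D. (\<forall>g :: nat \<Rightarrow> complex. (\<Sum>m | m \<in> {1..N} \<and> D dvd m \<and> m mod 4 = 1. g m) = (\<Sum>i<n. g (f i)))"
proof -
  define r where "r = D mod 4"
  have r: "r = 1 \<or> r = 3" using D unfolding r_def by presburger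
  define n where "n = (if r \<le> N div D then (N div D - r) div 4 + 1 else 0)"
  have n_le: "n \<le> N div D" unfolding n_def using r by auto
  have lt: "i < n \<longleftrightarrow> D * (r + 4 * i) \<le> N" for i
  proof -
    have "D * (r + 4 * i) \<le> N \<longleftrightarrow> r + 4 * i \<le> N div D"
      using D by (simp add: less_eq_div_iff_mult_less_eq mult.commute)
    also have "\<dots> \<longleftrightarrow> i < n" unfolding n_def by (auto split: if_splits)
    finally show ?thesis by simp
  qed
  have inj: "inj_on f X" for X using D by (auto simp: f inj_on_def)
  have img: "{m. m \<in> {1..N} \<and> D dvd m \<and> m mod 4 = 1} = f ` {..<n}"
  proof (intro equalityI subsetI)
    fix m assume m: "m \<in> {m. m \<in> {1..N} \<and> D dvd m \<and> m mod 4 = 1}"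
    then obtain l where l: "m = D * l" by blast
    have "(r * (l mod 4)) mod 4 = 1" using m l unfolding r_def by (simp add: mod_mult_eq)
    moreover have "l mod 4 \<in> {0, 1, 2, 3}" by auto
    ultimately have "l mod 4 = r" using r by auto
    then have "l = r + 4 * (l div 4)" by (metis add.commute mult_div_mod_eq)
    then obtain i where i: "l = r + 4 * i" by blast
    then have "m = f i" using l by (simp add: f r_def)
    moreover have "i < n" using m l i lt by auto
    ultimately show "m \<in> f ` {..<n}" by blast
  next
    fix m assume "m \<in> f ` {..<n}"
    then obtain i where i: "m = D * (r + 4 * i)" "i < n" by (auto simp: f r_def)
    have "m mod 4 = (r * (r mod 4)) mod 4" unfolding i(1) r_def
      by (metis mod_mult_eq mod_mult_self2 mod_mod_trivial)
    also have "\<dots> = 1" using r by auto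
    finally have "m mod 4 = 1" .
    moreover have "m \<le> N" using i lt by auto
    moreover have "m > 0" using i D r by auto
    ultimately show "m \<in> {m. m \<in> {1..N} \<and> D dvd m \<and> m mod 4 = 1}" using i by auto
  qed
  show ?thesis
    using n_le by (intro exI[of _ n] conjI allI) (simp_all only: img sum.reindex[OF inj] o_def)
qed

text \<open>Cauchy-Schwarz over the D0 values of D, then Weyl differencing in i. The quadratic
  coefficient is (4 D)^2 h alpha, so the frequencies are 32 D^2 h l alpha, and D < 2 D0 with l <= N
  / D0 bounds 32 D^2 h l by 128 D0 N H. The factor B^3 counts h, D and l as divisors of this
  product.\<close>

lemma type_I_bound:
  fixes \<alpha> B :: real and a :: int and q N H D0 :: nat and c :: "nat \<Rightarrow> complex"
  assumes q: "q \<ge> 1" and cop: "coprime a (int q)"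
    and al: "\<bar>\<alpha> - of_int a / real q\<bar> \<le> 1 / (real q)\<^sup>2"
    and c: "\<And>D. norm (c D) \<le> 1" and D0: "1 \<le> D0" 
    and B: "\<And>t. 1 \<le> t \<Longrightarrow> t \<le> 128 * D0 * N * H \<Longrightarrow> real (card {d. d dvd t}) \<le> B" "B \<ge> 0"
  shows "(\<Sum>h = 1..H. (norm (\<Sum>D\<in>{D0..<2*D0}. c D *
            (\<Sum>n | n \<in> {1..N} \<and> D dvd n \<and> n mod 4 = 1. e ((real n)\<^sup>2 * (real h * \<alpha>)))))\<^sup>2)
         \<le> real H * real N * real D0
           + 4 * B ^ 3 * ((128 * real D0 * real N * real H) / real q + 1) * (3 * real N + 8 * real q * real D0 * harm q)"
proof -
  define U where "U = N div D0"
  define A where "A = (\<lambda>D h. \<Sum>n | n \<in> {1..N} \<and> D dvd n \<and> n mod 4 = 1. e ((real n)\<^sup>2 * (real h * \<alpha>)))"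
  define F where "F = (\<lambda>t::nat. geom_majorant (real U) (dist_int (real t * \<alpha>)))"
  have F0: "F t \<ge> 0" for t by (simp add: F_def)
  have UD: "D0 * U \<le> N" unfolding U_def by simp
  have A_le: "(norm (A D h))\<^sup>2 \<le> real U + 4 * (\<Sum>l = 1..U. F (32 * D\<^sup>2 * h * l))" if D: "D \<in> {D0..<2*D0}" for D h
  proof (cases "odd D")
    case True
    define f where "f = (\<lambda>i. D * (D mod 4 + 4 * i))"
    have "D > 0" using D D0 by simp
    from sum_progression_eq[OF True this f_def, of N] obtain n where n: "n \<le> N div D"
      "\<And>g :: nat \<Rightarrow> complex. (\<Sum>m | m \<in> {1..N} \<and> D dvd m \<and> m mod 4 = 1. g m) = (\<Sum>i<n. g (f i))" by blast
    have "N div D \<le> U" unfolding U_def using D D0 by (intro div_le_mono2) auto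
    then have nU: "n \<le> U" using n(1) by simp
    define r where "r = real (D mod 4)"
    have "A D h = (\<Sum>i<n. e ((real (f i))\<^sup>2 * (real h * \<alpha>)))" unfolding A_def by (rule n(2))
    also have "\<dots> = (\<Sum>i<n. e ((16 * (real D)\<^sup>2 * real h * \<alpha>) * (real i)\<^sup>2 +
        (8 * r * (real D)\<^sup>2 * real h * \<alpha>) * real i + r\<^sup>2 * (real D)\<^sup>2 * real h * \<alpha>))"
      by (intro sum.cong refl arg_cong[of _ _ e]) (simp add: f_def r_def power2_eq_square algebra_simps)
    finally have AD: "A D h = (\<Sum>i<n. e ((16 * (real D)\<^sup>2 * real h * \<alpha>) * (real i)\<^sup>2 +
        (8 * r * (real D)\<^sup>2 * real h * \<alpha>) * real i + r\<^sup>2 * (real D)\<^sup>2 * real h * \<alpha>))" .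
    have "(norm (A D h))\<^sup>2 \<le> real U + 4 * (\<Sum>l = 1..U. geom_majorant (real U) (dist_int (2 * (16 * (real D)\<^sup>2 * real h * \<alpha>) * real l)))"
      unfolding AD by (rule weyl_quadratic[OF nU])
    also have "(\<Sum>l = 1..U. geom_majorant (real U) (dist_int (2 * (16 * (real D)\<^sup>2 * real h * \<alpha>) * real l))) = (\<Sum>l = 1..U. F (32 * D\<^sup>2 * h * l))"
      by (intro sum.cong refl) (simp add: F_def mult_ac)
    finally show ?thesis .
  next
    case False
    have "{n. n \<in> {1..N} \<and> D dvd n \<and> n mod 4 = 1} = {}"
    proof -
      have "odd n" if "n mod 4 = 1" for n :: nat using that by presburger
      then show ?thesis using False dvd_trans by blast
    qed
    then have "A D h = 0" unfolding A_def by (simp only: sum.empty)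
    then show ?thesis using F0 by (simp add: sum_nonneg)
  qed
  define I where "I = {1..H} \<times> {D0..<2*D0} \<times> {1..U}"
  define \<tau> where "\<tau> = (\<lambda>(h::nat, D::nat, l::nat). 32 * D\<^sup>2 * h * l)"
  define T where "T = 128 * D0 * N * H"
  have S: "(\<Sum>h = 1..H. (norm (\<Sum>D\<in>{D0..<2*D0}. c D * A D h))\<^sup>2)
     \<le> (\<Sum>h = 1..H. real D0 * (\<Sum>D\<in>{D0..<2*D0}. real U + 4 * (\<Sum>l = 1..U. F (32 * D\<^sup>2 * h * l))))"
  proof (rule sum_mono)
    fix h
    have "(norm (\<Sum>D\<in>{D0..<2*D0}. c D * A D h))\<^sup>2 \<le> real (card {D0..<2*D0}) * (\<Sum>D\<in>{D0..<2*D0}. (norm (c D * A D h))\<^sup>2)"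
      by (rule norm_sum_squared_le)
    also have "\<dots> \<le> real D0 * (\<Sum>D\<in>{D0..<2*D0}. real U + 4 * (\<Sum>l = 1..U. F (32 * D\<^sup>2 * h * l)))"
    proof -
      have "(norm (c D * A D h))\<^sup>2 \<le> real U + 4 * (\<Sum>l = 1..U. F (32 * D\<^sup>2 * h * l))" if "D \<in> {D0..<2*D0}" for D
      proof -
        have "norm (c D * A D h) \<le> 1 * norm (A D h)" unfolding norm_mult using c by (intro mult_right_mono) auto
        then have "(norm (c D * A D h))\<^sup>2 \<le> (norm (A D h))\<^sup>2" by (intro power_mono) auto
        then show ?thesis using A_le[OF that, of h] by linarith
      qed
      then show ?thesis by (auto intro!: mult_left_mono sum_mono)
    qed
    finally show "(norm (\<Sum>D\<in>{D0..<2*D0}. c D * A D h))\<^sup>2 \<le> real D0 * (\<Sum>D\<in>{D0..<2*D0}. real U + 4 * (\<Sum>l = 1..U. F (32 * D\<^sup>2 * h * l)))" .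
  qed
  also have "\<dots> = real D0 * (real H * real D0 * real U + 4 * (\<Sum>h = 1..H. \<Sum>D\<in>{D0..<2*D0}. \<Sum>l = 1..U. F (32 * D\<^sup>2 * h * l)))"
    by (simp add: sum.distrib sum_distrib_left algebra_simps)
  also have "(\<Sum>h = 1..H. \<Sum>D\<in>{D0..<2*D0}. \<Sum>l = 1..U. F (32 * D\<^sup>2 * h * l)) = (\<Sum>x\<in>I. F (\<tau> x))"
    unfolding I_def by (simp add: sum.cartesian_product \<tau>_def case_prod_beta)
  also have "(\<Sum>x\<in>I. F (\<tau> x)) \<le> B ^ 3 * (\<Sum>t = 1..T. F t)"
  proof (rule sum_le_fiber_bound)
    show "finite I" by (simp add: I_def)
    show "1 \<le> \<tau> x \<and> \<tau> x \<le> T" if "x \<in> I" for x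
    proof -
      obtain h D l where x: "x = (h, D, l)" by (cases x)
      have b: "1 \<le> h" "h \<le> H" "D0 \<le> D" "D \<le> 2 * D0" "1 \<le> l" "l \<le> U" using that x by (auto simp: I_def)
      have "D\<^sup>2 * h * l \<le> (2 * D0)\<^sup>2 * H * U" using b by (intro mult_mono power_mono) auto
      also have "\<dots> = 4 * D0 * H * (D0 * U)" by (simp add: power2_eq_square)
      also have "\<dots> \<le> 4 * D0 * H * N" using UD by (intro mult_left_mono) auto
      finally have "32 * (D\<^sup>2 * h * l) \<le> T" unfolding T_def by (simp add: mult_ac)
      moreover have "D\<^sup>2 * h * l \<ge> 1" using b D0 by (simp add: Suc_le_eq)
      ultimately show ?thesis unfolding x \<tau>_def by (simp add: mult_ac)
    qed
    show "real (card {x \<in> I. \<tau> x = t}) \<le> B ^ 3" if t: "1 \<le> t" "t \<le> T" for t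
    proof -
      let ?d = "{d. d dvd t}"
      have "real (card {x \<in> I. \<tau> x = t}) \<le> B * real (card (?d \<times> ?d))"
        by (rule card_divisor_tuples_le[of t _ "\<lambda>x. x"]) (use t B in \<open>auto simp: I_def \<tau>_def T_def\<close>)
      also have "\<dots> = B * (real (card ?d) * real (card ?d))" by (simp add: card_cartesian_product)
      also have "\<dots> \<le> B * (B * B)" using B t by (intro mult_left_mono mult_mono) (auto simp: T_def)
      finally show ?thesis by (simp add: power3_eq_cube)
    qed
  qed (rule F0)
  also have "(\<Sum>t = 1..T. F t) \<le> (real T / real q + 1) * (3 * real U + 8 * real q * harm q)"
    unfolding F_def by (rule sum_geom_majorant_le[OF q cop al]) simp
  finally have *: "(\<Sum>h = 1..H. (norm (\<Sum>D\<in>{D0..<2*D0}. c D * A D h))\<^sup>2)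
     \<le> real D0 * (real H * real D0 * real U + 4 * (B ^ 3 * ((real T / real q + 1) * (3 * real U + 8 * real q * harm q))))"
    using B(2) by (auto simp: mult_left_mono)
  also have "\<dots> = real H * real D0 * real (D0 * U) + 4 * B ^ 3 * (real T / real q + 1) * (3 * real (D0 * U) + 8 * real q * real D0 * harm q)"
    by (simp add: algebra_simps)
  also have "\<dots> \<le> real H * real D0 * real N + 4 * B ^ 3 * (real T / real q + 1) * (3 * real N + 8 * real q * real D0 * harm q)"
    using UD B(2) by (intro add_mono mult_left_mono) (auto simp del: of_nat_mult)
  finally show ?thesis unfolding A_def T_def by (simp add: mult_ac)
qed

text \<open>The coupling of \<open>u\<close> and \<open>v\<close> through labels \<open>\<phi> u = \<psi> v\<close> is free of charge: each \<open>u\<close> sees a single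
  label class of the \<open>v\<close>, and the classes are disjoint.\<close>
lemma bilinear_cauchy:
  fixes A C :: "nat \<Rightarrow> complex" and \<phi> \<psi> :: "nat \<Rightarrow> 'l"
  assumes A: "\<And>u. norm (A u) \<le> 1" and C: "\<And>v. norm (C v) \<le> 1"
  shows "(norm (\<Sum>u = 1..U. \<Sum>v = 1..V. if \<phi> u = \<psi> v \<and> u * v \<le> N
              then A u * C v * e ((real (u * v))\<^sup>2 * \<theta>) else 0))\<^sup>2
         \<le> real U * (\<Sum>v = 1..V. \<Sum>w = 1..V.
             norm (\<Sum>u | u \<in> {1..U} \<and> u * v \<le> N \<and> u * w \<le> N. e ((real u)\<^sup>2 * (((real v)\<^sup>2 - (real w)\<^sup>2) * \<theta>))))"
proof -
  define f where "f = (\<lambda>u v. if u * v \<le> N then C v * e ((real (u * v))\<^sup>2 * \<theta>) else 0)"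
  define G where "G = (\<lambda>v w. \<Sum>u | u \<in> {1..U} \<and> u * v \<le> N \<and> u * w \<le> N. e ((real u)\<^sup>2 * (((real v)\<^sup>2 - (real w)\<^sup>2) * \<theta>)))"
  define X where "X = (\<lambda>l u. \<Sum>v | v \<in> {1..V} \<and> \<psi> v = l. f u v)"
  define L where "L = \<psi> ` {1..V}"
  have finL: "finite L" by (simp add: L_def)
  have eq: "(\<Sum>v = 1..V. if \<phi> u = \<psi> v \<and> u * v \<le> N then A u * C v * e ((real (u * v))\<^sup>2 * \<theta>) else 0)
        = A u * X (\<phi> u) u" for u
  proof -
    have "A u * X (\<phi> u) u = (\<Sum>v\<in>{v \<in> {1..V}. \<psi> v = \<phi> u}. A u * f u v)"
      by (simp add: X_def sum_distrib_left)
    also have "\<dots> = (\<Sum>v = 1..V. if \<psi> v = \<phi> u then A u * f u v else 0)"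
      by (rule sum.inter_filter) simp
    also have "\<dots> = (\<Sum>v = 1..V. if \<phi> u = \<psi> v \<and> u * v \<le> N then A u * C v * e ((real (u * v))\<^sup>2 * \<theta>) else 0)"
      by (intro sum.cong) (auto simp: f_def)
    finally show ?thesis by simp
  qed
  have single: "(norm (A u * X (\<phi> u) u))\<^sup>2 \<le> (\<Sum>l\<in>L. (norm (X l u))\<^sup>2)" for u
  proof (cases "\<phi> u \<in> L")
    case True
    have "norm (A u * X (\<phi> u) u) \<le> 1 * norm (X (\<phi> u) u)"
      unfolding norm_mult using A by (intro mult_right_mono) auto
    then have "(norm (A u * X (\<phi> u) u))\<^sup>2 \<le> (norm (X (\<phi> u) u))\<^sup>2" by (intro power_mono) auto
    also have "\<dots> \<le> (\<Sum>l\<in>L. (norm (X l u))\<^sup>2)"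
      using True finL by (intro member_le_sum) auto
    finally show ?thesis .
  next
    case False
    then have "\<psi> v \<noteq> \<phi> u" if "v \<in> {1..V}" for v using that unfolding L_def by (metis image_eqI)
    then have "{v. v \<in> {1..V} \<and> \<psi> v = \<phi> u} = {}" by blast
    then have "X (\<phi> u) u = 0" unfolding X_def by (simp only: sum.empty)
    then show ?thesis by (simp add: sum_nonneg)
  qed
  have sq: "(norm (X l u))\<^sup>2 = Re (\<Sum>v = 1..V. \<Sum>w = 1..V. if \<psi> v = l \<and> \<psi> w = l then f u v * cnj (f u w) else 0)" for l u
  proof -
    have X': "X l u = (\<Sum>v = 1..V. if \<psi> v = l then f u v else 0)"
      unfolding X_def by (subst sum.inter_filter[symmetric]) auto
    have "complex_of_real ((norm (X l u))\<^sup>2) = X l u * cnj (X l u)" by (rule complex_norm_square)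
    also have "\<dots> = (\<Sum>v = 1..V. \<Sum>w = 1..V. if \<psi> v = l \<and> \<psi> w = l then f u v * cnj (f u w) else 0)"
      unfolding X' cnj_sum sum_product by (intro sum.cong refl) auto
    finally show ?thesis by (metis Re_complex_of_real)
  qed
  have G: "(\<Sum>u = 1..U. f u v * cnj (f u w)) = C v * cnj (C w) * G v w" for v w
  proof -
    have "f u v * cnj (f u w) = (if u * v \<le> N \<and> u * w \<le> N then
        C v * cnj (C w) * e ((real u)\<^sup>2 * (((real v)\<^sup>2 - (real w)\<^sup>2) * \<theta>)) else 0)" for u
    proof -
      have "e ((real u)\<^sup>2 * (((real v)\<^sup>2 - (real w)\<^sup>2) * \<theta>)) = e ((real (u * v))\<^sup>2 * \<theta>) * e (- ((real (u * w))\<^sup>2 * \<theta>))"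
        by (subst e_add[symmetric]) (simp add: power2_eq_square algebra_simps)
      then show ?thesis by (auto simp: f_def cnj_e)
    qed
    then have "(\<Sum>u = 1..U. f u v * cnj (f u w)) = (\<Sum>u\<in>{u \<in> {1..U}. u * v \<le> N \<and> u * w \<le> N}.
        C v * cnj (C w) * e ((real u)\<^sup>2 * (((real v)\<^sup>2 - (real w)\<^sup>2) * \<theta>)))"
      by (subst sum.inter_filter) auto
    then show ?thesis by (simp add: G_def sum_distrib_left)
  qed
  have CG: "Re (C v * cnj (C w) * G v w) \<le> norm (G v w)" for v w
  proof -
    have "norm (C v) * norm (C w) \<le> 1 * 1" using C by (intro mult_mono) auto
    then have "norm (C v * cnj (C w) * G v w) \<le> 1 * norm (G v w)"
      unfolding norm_mult complex_mod_cnj by (intro mult_right_mono) auto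
    then show ?thesis using complex_Re_le_cmod[of "C v * cnj (C w) * G v w"] by linarith
  qed
  have "(norm (\<Sum>u = 1..U. A u * X (\<phi> u) u))\<^sup>2 \<le> real U * (\<Sum>u = 1..U. (norm (A u * X (\<phi> u) u))\<^sup>2)"
    using norm_sum_squared_le[of "\<lambda>u. A u * X (\<phi> u) u" "{1..U}"] by simp
  also have "\<dots> \<le> real U * (\<Sum>u = 1..U. \<Sum>l\<in>L. (norm (X l u))\<^sup>2)"
    by (intro mult_left_mono sum_mono single) auto
  also have "(\<Sum>u = 1..U. \<Sum>l\<in>L. (norm (X l u))\<^sup>2)
      = Re (\<Sum>u = 1..U. \<Sum>l\<in>L. \<Sum>v = 1..V. \<Sum>w = 1..V. if \<psi> v = l \<and> \<psi> w = l then f u v * cnj (f u w) else 0)"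
    by (simp add: sq)
  \<comment> \<open>Summing over all labels l removes \<open>\<phi>\<close> from the expression:
    only the condition \<open>\<psi> v = \<psi> w\<close> is left, which is independent of u. The
    inner sum over u is then unweighted, and passing to norms discards the condition.\<close>
  also have "(\<Sum>u = 1..U. \<Sum>l\<in>L. \<Sum>v = 1..V. \<Sum>w = 1..V. if \<psi> v = l \<and> \<psi> w = l then f u v * cnj (f u w) else 0)
      = (\<Sum>u = 1..U. \<Sum>v = 1..V. \<Sum>w = 1..V. if \<psi> v = \<psi> w then f u v * cnj (f u w) else 0)"
  proof (rule sum.cong[OF refl])
    fix u
    have "(\<Sum>l\<in>L. \<Sum>v = 1..V. \<Sum>w = 1..V. if \<psi> v = l \<and> \<psi> w = l then f u v * cnj (f u w) else 0)
      = (\<Sum>v = 1..V. \<Sum>w = 1..V. \<Sum>l\<in>L. if \<psi> v = l \<and> \<psi> w = l then f u v * cnj (f u w) else 0)"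
      by (subst sum.swap) (intro sum.cong refl sum.swap)
    also have "\<dots> = (\<Sum>v = 1..V. \<Sum>w = 1..V. if \<psi> v = \<psi> w then f u v * cnj (f u w) else 0)"
    proof (intro sum.cong refl)
      fix v w assume "v \<in> {1..V}" "w \<in> {1..V}"
      then have "\<psi> v \<in> L" by (simp add: L_def)
      have "(\<Sum>l\<in>L. if \<psi> v = l \<and> \<psi> w = l then f u v * cnj (f u w) else 0)
          = (\<Sum>l\<in>L. if \<psi> v = l then (if \<psi> v = \<psi> w then f u v * cnj (f u w) else 0) else 0)"
        by (intro sum.cong) auto
      also have "\<dots> = (if \<psi> v = \<psi> w then f u v * cnj (f u w) else 0)"
        using \<open>\<psi> v \<in> L\<close> finL by (simp add: sum.delta)
      finally show "(\<Sum>l\<in>L. if \<psi> v = l \<and> \<psi> w = l then f u v * cnj (f u w) else 0)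
          = (if \<psi> v = \<psi> w then f u v * cnj (f u w) else 0)" .
    qed
    finally show "(\<Sum>l\<in>L. \<Sum>v = 1..V. \<Sum>w = 1..V. if \<psi> v = l \<and> \<psi> w = l then f u v * cnj (f u w) else 0)
      = (\<Sum>v = 1..V. \<Sum>w = 1..V. if \<psi> v = \<psi> w then f u v * cnj (f u w) else 0)" .
  qed
  also have "\<dots> = (\<Sum>v = 1..V. \<Sum>w = 1..V. \<Sum>u = 1..U. if \<psi> v = \<psi> w then f u v * cnj (f u w) else 0)"
    by (subst sum.swap) (intro sum.cong refl sum.swap)
  also have "\<dots> = (\<Sum>v = 1..V. \<Sum>w = 1..V. if \<psi> v = \<psi> w then C v * cnj (C w) * G v w else 0)"
  proof (intro sum.cong refl)
    fix v w
    show "(\<Sum>u = 1..U. if \<psi> v = \<psi> w then f u v * cnj (f u w) else 0)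
        = (if \<psi> v = \<psi> w then C v * cnj (C w) * G v w else 0)"
      using G[of v w] by (cases "\<psi> v = \<psi> w") simp_all
  qed
  also have "Re \<dots> \<le> (\<Sum>v = 1..V. \<Sum>w = 1..V. norm (G v w))"
    unfolding Re_sum using CG by (intro sum_mono) auto
  finally show ?thesis unfolding eq G_def by (simp add: mult_left_mono)
qed

text \<open>After \<open>bilinear_cauchy\<close> the diagonal v = w is estimated trivially, and off
  the diagonal a second Cauchy-Schwarz over (h, v, w) prepares Weyl differencing in u. The
  frequencies are 2 l |v - w| (v + w) h up to sign, at most 2 U V^2 H, and the representations of
  one value are counted by four divisors.\<close>

lemma bilinear_bound:
  fixes \<alpha> B :: real and a :: int and q N H U V :: nat
    and A C :: "nat \<Rightarrow> complex" and \<phi> \<psi> :: "nat \<Rightarrow> 'l"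
  assumes q: "q \<ge> 1" and cop: "coprime a (int q)"
    and al: "\<bar>\<alpha> - of_int a / real q\<bar> \<le> 1 / (real q)\<^sup>2"
    and A: "\<And>u. norm (A u) \<le> 1" and C: "\<And>v. norm (C v) \<le> 1"
    and B: "\<And>t. 1 \<le> t \<Longrightarrow> t \<le> 2 * U * V\<^sup>2 * H \<Longrightarrow> real (card {d. d dvd t}) \<le> B" "B \<ge> 0"
  shows "(\<Sum>h = 1..H. (norm (\<Sum>u = 1..U. \<Sum>v = 1..V. if \<phi> u = \<psi> v \<and> u * v \<le> N
              then A u * C v * e ((real (u * v))\<^sup>2 * (real h * \<alpha>)) else 0))\<^sup>2)
         \<le> real U * (real H * real V * real U + sqrt (real H * (real V)\<^sup>2 *
             (real H * (real V)\<^sup>2 * real U + 8 * B ^ 4 * ((2 * real U * (real V)\<^sup>2 * real H) / real q + 1)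
                * (3 * real U + 8 * real q * harm q))))"
proof -
  define G where "G = (\<lambda>h v w. \<Sum>u | u \<in> {1..U} \<and> u * v \<le> N \<and> u * w \<le> N.
      e ((real u)\<^sup>2 * (((real v)\<^sup>2 - (real w)\<^sup>2) * (real h * \<alpha>))))"
  define F where "F = (\<lambda>t::nat. geom_majorant (real U) (dist_int (real t * \<alpha>)))"
  have F0: "F t \<ge> 0" for t by (simp add: F_def)
  \<comment> \<open>The absolute difference in natural numbers: truncated subtraction makes one of
    the two summands 0. It keeps the frequency a positive integer, and the lost sign is harmless
    because \<open>dist_int\<close> is even.\<close>
  define ad where "ad = (\<lambda>v w::nat. (v - w) + (w - v))"
  define T where "T = 2 * U * V\<^sup>2 * H"
  define \<tau> where "\<tau> = (\<lambda>(h::nat, v::nat, w::nat, l::nat). 2 * l * (ad v w * (v + w)) * h)"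
  have G_le: "(norm (G h v w))\<^sup>2 \<le> real U + 4 * (\<Sum>l = 1..U. F (\<tau> (h, v, w, l)))" if vw: "v \<ge> 1" "w \<ge> 1" for h v w
  proof -
    define W where "W = min U (N div max v w)"
    define g where "g = ((real v)\<^sup>2 - (real w)\<^sup>2) * (real h * \<alpha>)"
    have "{u. u \<in> {1..U} \<and> u * v \<le> N \<and> u * w \<le> N} = {1..W}"
    proof -
      have "u * v \<le> N \<and> u * w \<le> N \<longleftrightarrow> u \<le> N div max v w" for u
      proof -
        have "u * v \<le> N \<and> u * w \<le> N \<longleftrightarrow> u * max v w \<le> N"
          by (metis le_trans max.absorb1 max.absorb2 mult_le_mono2 nat_le_linear)
        then show ?thesis using vw by (simp add: less_eq_div_iff_mult_less_eq)
      qed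
      then have "{u. u \<in> {1..U} \<and> u * v \<le> N \<and> u * w \<le> N} = {u. u \<in> {1..U} \<and> u \<le> N div max v w}"
        by (simp only:)
      also have "\<dots> = {1..W}" unfolding W_def by auto
      finally show ?thesis .
    qed
    then have "G h v w = (\<Sum>u = 1..W. e ((real u)\<^sup>2 * g))" by (simp add: G_def g_def)
    also have "\<dots> = (\<Sum>i<W. e (g * (real i)\<^sup>2 + 2 * g * real i + g))"
      by (rule sum.reindex_bij_witness[where i = Suc and j = "\<lambda>u. u - 1"])
         (auto simp: power2_eq_square algebra_simps of_nat_diff)
    finally have GG: "G h v w = (\<Sum>i<W. e (g * (real i)\<^sup>2 + 2 * g * real i + g))" .
    have "(norm (G h v w))\<^sup>2 \<le> real U + 4 * (\<Sum>l = 1..U. geom_majorant (real U) (dist_int (2 * g * real l)))"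
      unfolding GG by (rule weyl_quadratic) (simp add: W_def)
    also have "(\<Sum>l = 1..U. geom_majorant (real U) (dist_int (2 * g * real l))) = (\<Sum>l = 1..U. F (\<tau> (h, v, w, l)))"
    proof (rule sum.cong[OF refl])
      fix l
      have dist_int_minus: "dist_int (- x) = dist_int x" for x
        using dist_int_perturb[of "-x" "-x"] dist_int_le[of x "- round (-x)"] dist_int_le[of "-x" "- round x"]
        unfolding dist_int_def by linarith
      have \<tau>: "real (\<tau> (h, v, w, l)) = 2 * real l * (real (ad v w) * (real v + real w)) * real h"
        by (simp add: \<tau>_def)
      have "real (\<tau> (h, v, w, l)) * \<alpha> = 2 * g * real l \<or> real (\<tau> (h, v, w, l)) * \<alpha> = - (2 * g * real l)"
      proof (cases "w \<le> v")
        case True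
        then have ad: "real (ad v w) = real v - real w" by (simp add: ad_def)
        show ?thesis unfolding \<tau> ad g_def by (intro disjI1) (simp add: power2_eq_square algebra_simps)
      next
        case False
        then have ad: "real (ad v w) = real w - real v" by (simp add: ad_def)
        show ?thesis unfolding \<tau> ad g_def by (intro disjI2) (simp add: power2_eq_square algebra_simps)
      qed
      then show "geom_majorant (real U) (dist_int (2 * g * real l)) = F (\<tau> (h, v, w, l))"
        unfolding F_def using dist_int_minus by metis
    qed
    finally show ?thesis .
  qed
  have G_diag: "norm (G h v v) \<le> real U" for h v
  proof -
    have "norm (G h v v) \<le> (\<Sum>u | u \<in> {1..U} \<and> u * v \<le> N \<and> u * v \<le> N. 1)"
      unfolding G_def by (intro order_trans[OF norm_sum] sum_mono) simp
    also have "\<dots> \<le> (\<Sum>u = 1..U. 1)" by (intro sum_mono2) auto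
    finally show ?thesis by simp
  qed
  define Q where "Q = {(h, v, w). h \<in> {1..H} \<and> v \<in> {1..V} \<and> w \<in> {1..V} \<and> v \<noteq> w}"
  have Qsub: "Q \<subseteq> {1..H} \<times> {1..V} \<times> {1..V}" by (auto simp: Q_def)
  have finQ: "finite Q" by (rule finite_subset[OF Qsub]) simp
  have cardQ: "real (card Q) \<le> real H * (real V)\<^sup>2"
  proof -
    have "card Q \<le> card ({1..H} \<times> {1..V} \<times> {1..V})" by (intro card_mono Qsub) simp
    then show ?thesis by (simp add: card_cartesian_product power2_eq_square flip: of_nat_mult)
  qed
  define I where "I = (\<lambda>((h, v, w), l). (h, v, w, l)) ` (Q \<times> {1..U})"
  have sumI: "(\<Sum>(h, v, w)\<in>Q. \<Sum>l = 1..U. F (\<tau> (h, v, w, l))) = (\<Sum>x\<in>I. F (\<tau> x))"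
  proof -
    have "(\<Sum>(h, v, w)\<in>Q. \<Sum>l = 1..U. F (\<tau> (h, v, w, l))) = (\<Sum>((h, v, w), l)\<in>Q \<times> {1..U}. F (\<tau> (h, v, w, l)))"
      by (simp add: sum.cartesian_product case_prod_beta)
    also have "\<dots> = (\<Sum>x\<in>I. F (\<tau> x))"
      unfolding I_def by (subst sum.reindex) (auto simp: inj_on_def case_prod_beta)
    finally show ?thesis .
  qed
  have "(\<Sum>x\<in>I. F (\<tau> x)) \<le> (2 * B ^ 4) * (\<Sum>t = 1..T. F t)"
  proof (rule sum_le_fiber_bound)
    show "finite I" using finQ by (simp add: I_def)
    show "1 \<le> \<tau> x \<and> \<tau> x \<le> T" if "x \<in> I" for x
    proof -
      obtain h v w l where x: "x = (h, v, w, l)" by (cases x)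
      have b: "1 \<le> h" "h \<le> H" "1 \<le> v" "v \<le> V" "1 \<le> w" "w \<le> V" "v \<noteq> w" "1 \<le> l" "l \<le> U"
        using that x by (auto simp: I_def Q_def)
      have le: "ad v w * (v + w) \<le> V\<^sup>2"
      proof (cases "w \<le> v")
        case True
        have "ad v w * (v + w) + w\<^sup>2 = v\<^sup>2" using True
          by (auto simp: ad_def power2_eq_square le_iff_add algebra_simps)
        moreover have "v\<^sup>2 \<le> V\<^sup>2" using b by (intro power_mono) auto
        ultimately show ?thesis by linarith
      next
        case False
        then have "v \<le> w" by simp
        then have "ad v w * (v + w) + v\<^sup>2 = w\<^sup>2"
          by (auto simp: ad_def power2_eq_square le_iff_add algebra_simps)
        moreover have "w\<^sup>2 \<le> V\<^sup>2" using b by (intro power_mono) auto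
        ultimately show ?thesis by linarith
      qed
      have "2 * l * (ad v w * (v + w)) * h \<le> 2 * U * V\<^sup>2 * H" using b le by (intro mult_mono) auto
      moreover have "ad v w \<ge> 1" using b by (auto simp: ad_def)
      ultimately show ?thesis unfolding x \<tau>_def T_def using b by simp
    qed
    show "real (card {x \<in> I. \<tau> x = t}) \<le> 2 * B ^ 4" if t: "1 \<le> t" "t \<le> T" for t
    proof -
      let ?d = "{d. d dvd t}"
      \<comment> \<open>The pair v, w is recovered from its sum, its absolute difference and one bit
        for the order. That bit is the source of the factor 2 in front of B^4.\<close>
      let ?g = "\<lambda>(h, v, w, l). (h, l, ad v w, v + w, v \<le> w)"
      have "real (card {x \<in> I. \<tau> x = t}) \<le> B * real (card (?d \<times> ?d \<times> ?d \<times> (UNIV :: bool set)))"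
      proof (rule card_divisor_tuples_le[of t _ ?g])
        have "inj_on ?g UNIV"
        proof (rule inj_onI)
          fix x y assume eq: "?g x = ?g y"
          obtain h v w l where x: "x = (h, v, w, l)" by (cases x)
          obtain h' v' w' l' where y: "y = (h', v', w', l')" by (cases y)
          from eq have *: "h = h'" "l = l'" "ad v w = ad v' w'" "v + w = v' + w'" "(v \<le> w) = (v' \<le> w')"
            unfolding x y by simp_all
          then have "v = v' \<and> w = w'" unfolding ad_def by linarith
          with * show "x = y" unfolding x y by simp
        qed
        then show "inj_on ?g {x \<in> I. \<tau> x = t}" by (rule inj_on_subset) simp
      qed (use t B in \<open>auto simp: I_def \<tau>_def T_def\<close>)
      also have "\<dots> = B * (real (card ?d) * (real (card ?d) * (real (card ?d) * 2)))"
        by (simp add: card_cartesian_product)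
      also have "\<dots> \<le> B * (B * (B * (B * 2)))" using B t by (intro mult_left_mono mult_mono) (auto simp: T_def)
      finally show ?thesis by (simp add: power4_eq_xxxx mult_ac)
    qed
  qed (rule F0)
  also have "(\<Sum>t = 1..T. F t) \<le> (real T / real q + 1) * (3 * real U + 8 * real q * harm q)"
    unfolding F_def by (rule sum_geom_majorant_le[OF q cop al]) simp
  finally have FI: "(\<Sum>x\<in>I. F (\<tau> x)) \<le> (2 * B ^ 4) * ((real T / real q + 1) * (3 * real U + 8 * real q * harm q))"
    by (simp add: mult_left_mono)
  have G2: "(\<Sum>(h, v, w)\<in>Q. (norm (G h v w))\<^sup>2) \<le> real H * (real V)\<^sup>2 * real U
      + 8 * B ^ 4 * (real T / real q + 1) * (3 * real U + 8 * real q * harm q)"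
  proof -
    have "(\<Sum>(h, v, w)\<in>Q. (norm (G h v w))\<^sup>2) \<le> (\<Sum>(h, v, w)\<in>Q. real U + 4 * (\<Sum>l = 1..U. F (\<tau> (h, v, w, l))))"
      using G_le by (intro sum_mono) (auto simp: Q_def)
    also have "\<dots> = real (card Q) * real U + 4 * (\<Sum>x\<in>I. F (\<tau> x))"
      unfolding sumI[symmetric] by (simp add: sum.distrib sum_distrib_left case_prod_beta)
    also have "\<dots> \<le> (real H * (real V)\<^sup>2) * real U + 4 * ((2 * B ^ 4) * ((real T / real q + 1) * (3 * real U + 8 * real q * harm q)))"
      using cardQ FI by (intro add_mono mult_mono) (auto intro!: sum_nonneg F0)
    finally show ?thesis by (simp add: mult.assoc)
  qed
  have G1: "(\<Sum>(h, v, w)\<in>Q. norm (G h v w)) \<le> sqrt (real H * (real V)\<^sup>2 *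
      (real H * (real V)\<^sup>2 * real U + 8 * B ^ 4 * (real T / real q + 1) * (3 * real U + 8 * real q * harm q)))"
  proof (rule real_le_rsqrt)
    have "(\<Sum>(h, v, w)\<in>Q. norm (G h v w))\<^sup>2 \<le> (\<Sum>(h, v, w)\<in>Q. (norm (G h v w))\<^sup>2) * real (card Q)"
      using sum_squared_le_sum_of_squares[of "\<lambda>(h, v, w). norm (G h v w)" Q] by (simp add: case_prod_beta)
    also have "\<dots> \<le> (real H * (real V)\<^sup>2 * real U + 8 * B ^ 4 * (real T / real q + 1) * (3 * real U + 8 * real q * harm q)) * (real H * (real V)\<^sup>2)"
      using G2 cardQ by (intro mult_mono order_trans[OF _ G2]) (auto intro!: sum_nonneg)
    finally show "(\<Sum>(h, v, w)\<in>Q. norm (G h v w))\<^sup>2 \<le> real H * (real V)\<^sup>2 *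
      (real H * (real V)\<^sup>2 * real U + 8 * B ^ 4 * (real T / real q + 1) * (3 * real U + 8 * real q * harm q))"
      by (simp add: mult.commute)
  qed
  have "(\<Sum>h = 1..H. (norm (\<Sum>u = 1..U. \<Sum>v = 1..V. if \<phi> u = \<psi> v \<and> u * v \<le> N
              then A u * C v * e ((real (u * v))\<^sup>2 * (real h * \<alpha>)) else 0))\<^sup>2)
      \<le> (\<Sum>h = 1..H. real U * (\<Sum>v = 1..V. \<Sum>w = 1..V. norm (G h v w)))"
    unfolding G_def using A C by (intro sum_mono bilinear_cauchy)
  also have "\<dots> = real U * (\<Sum>(h, v, w)\<in>{1..H} \<times> {1..V} \<times> {1..V}. norm (G h v w))"
    by (simp add: sum_distrib_left sum.cartesian_product case_prod_beta)
  also have "(\<Sum>(h, v, w)\<in>{1..H} \<times> {1..V} \<times> {1..V}. norm (G h v w))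
      = (\<Sum>(h, v, w)\<in>Q. norm (G h v w)) + (\<Sum>(h, v, w)\<in>{1..H} \<times> {1..V} \<times> {1..V} - Q. norm (G h v w))"
    using sum.subset_diff[OF Qsub, of "\<lambda>(h, v, w). norm (G h v w)"] by simp
  also have "(\<Sum>(h, v, w)\<in>{1..H} \<times> {1..V} \<times> {1..V} - Q. norm (G h v w)) \<le> real H * real V * real U"
  proof -
    have eq: "{1..H} \<times> {1..V} \<times> {1..V} - Q = (\<lambda>(h, v). (h, v, v)) ` ({1..H} \<times> {1..V})" by (auto simp: Q_def)
    have inj: "inj_on (\<lambda>(h, v). (h, v, v)) ({1..H} \<times> {1..V})" by (auto simp: inj_on_def)
    have "(\<Sum>(h, v, w)\<in>{1..H} \<times> {1..V} \<times> {1..V} - Q. norm (G h v w))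
        = (\<Sum>(h, v)\<in>{1..H} \<times> {1..V}. norm (G h v v))"
      unfolding eq sum.reindex[OF inj] by (intro sum.cong) auto
    also have "\<dots> \<le> (\<Sum>(h, v)\<in>{1..H} \<times> {1..V}. real U)" using G_diag by (intro sum_mono) auto
    also have "\<dots> = real H * real V * real U" by (simp add: card_cartesian_product)
    finally show ?thesis .
  qed
  finally have "(\<Sum>h = 1..H. (norm (\<Sum>u = 1..U. \<Sum>v = 1..V. if \<phi> u = \<psi> v \<and> u * v \<le> N
              then A u * C v * e ((real (u * v))\<^sup>2 * (real h * \<alpha>)) else 0))\<^sup>2)
      \<le> real U * ((\<Sum>(h, v, w)\<in>Q. norm (G h v w)) + real H * real V * real U)"
    by (simp add: mult_left_mono)
  also have "\<dots> \<le> real U * (real H * real V * real U + sqrt (real H * (real V)\<^sup>2 *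
             (real H * (real V)\<^sup>2 * real U + 8 * B ^ 4 * ((2 * real U * (real V)\<^sup>2 * real H) / real q + 1)
                * (3 * real U + 8 * real q * harm q))))"
    using G1 by (intro mult_left_mono) (simp_all add: T_def)
  finally show ?thesis .
qed

section \<open>Dyadic decomposition of the exponential sum\<close>

text \<open>For u < v there is exactly one j such that the digits above position j agree while digit
  j is 0 in u and 1 in v; for u >= v there is none. Each summand couples u and v only by an equality
  of quotients, the form that \<open>bilinear_cauchy\<close> accepts, and there are only L of
  them.\<close>

lemma less_as_binary_digits:
  fixes u v :: nat
  assumes "u < 2 ^ L" "v < 2 ^ L"
  shows "(\<Sum>j<L. of_bool (u div 2 ^ (j+1) = v div 2 ^ (j+1) \<and> even (u div 2 ^ j) \<and> odd (v div 2 ^ j)))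
         = (of_bool (u < v) :: 'a :: semiring_1)"
  using assms
proof (induction L arbitrary: u v)
  case (Suc L)
  have lt: "u div 2 < 2 ^ L" "v div 2 < 2 ^ L" using Suc.prems by auto
  have d: "w div 2 ^ Suc j = (w div 2) div 2 ^ j" for w j :: nat by (simp add: div_mult2_eq)
  have "(\<Sum>j<Suc L. of_bool (u div 2 ^ (j+1) = v div 2 ^ (j+1) \<and> even (u div 2 ^ j) \<and> odd (v div 2 ^ j)))
      = (of_bool (u div 2 = v div 2 \<and> even u \<and> odd v) :: 'a) +
        (\<Sum>j<L. of_bool ((u div 2) div 2 ^ (j+1) = (v div 2) div 2 ^ (j+1) \<and> even ((u div 2) div 2 ^ j) \<and> odd ((v div 2) div 2 ^ j)))"
    by (subst sum.lessThan_Suc_shift) (simp only: add_Suc d power_0 div_by_1 add_0 power_one_right)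
  also have "\<dots> = of_bool (u div 2 = v div 2 \<and> even u \<and> odd v) + of_bool (u div 2 < v div 2)"
    by (simp only: Suc.IH[OF lt])
  also have "\<dots> = of_bool (u < v)"
  proof -
    have "u < v \<longleftrightarrow> u div 2 < v div 2 \<or> (u div 2 = v div 2 \<and> even u \<and> odd v)" by presburger
    moreover have "\<not> (u div 2 < v div 2 \<and> u div 2 = v div 2)" by simp
    ultimately show ?thesis by (auto simp: of_bool_def)
  qed
  finally show ?case .
qed simp

lemma sum_dyadic:
  fixes f :: "nat \<Rightarrow> 'a :: comm_monoid_add"
  shows "sum f {1..<2 ^ L} = (\<Sum>i<L. sum f {2 ^ i..<2 * 2 ^ i})"
proof (induction L)
  case (Suc L)
  have "sum f {1..<2 ^ Suc L} = sum f {1..<2 ^ L} + sum f {2 ^ L..<2 * 2 ^ L}"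
    by (subst sum.atLeastLessThan_concat) auto
  then show ?case unfolding sum.lessThan_Suc Suc.IH[symmetric] .
qed simp

lemma sum_dyadic_indicator:
  fixes k :: nat
  assumes "1 \<le> k" "k < 2 ^ L"
  shows "(\<Sum>i<L. of_bool (2 ^ i \<le> k \<and> k < 2 * 2 ^ i)) = (1 :: 'a :: semiring_1)"
  using assms
proof (induction L)
  case (Suc L)
  show ?case
  proof (cases "k < 2 ^ L")
    case True
    then show ?thesis using Suc by simp
  next
    case False
    have "\<not> k < 2 * 2 ^ i" if "i < L" for i
    proof -
      have "2 * 2 ^ i \<le> (2 :: nat) ^ L" using that by (metis Suc_leI one_le_numeral power_Suc power_increasing)
      then show ?thesis using False by linarith
    qed
    then have "(\<Sum>i<L. of_bool (2 ^ i \<le> k \<and> k < 2 * 2 ^ i)) = (0 :: 'a)" by (intro sum.neutral) auto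
    then show ?thesis using False Suc.prems by simp
  qed
qed simp

lemma sum_divisor_pairs:
  fixes f :: "nat \<Rightarrow> nat \<Rightarrow> 'a :: comm_monoid_add"
  shows "(\<Sum>n = 1..N. \<Sum>k | k dvd n. f k (n div k)) = (\<Sum>k = 1..N. \<Sum>m = 1..N. if k * m \<le> N then f k m else 0)"
proof -
  have fin: "finite {k. k dvd n}" if "n \<in> {1..N}" for n using that by simp
  have "(\<Sum>n = 1..N. \<Sum>k | k dvd n. f k (n div k)) = (\<Sum>(n, k)\<in>(SIGMA n:{1..N}. {k. k dvd n}). f k (n div k))"
    using fin by (intro sum.Sigma) auto
  also have "\<dots> = (\<Sum>(k, m)\<in>{x \<in> {1..N} \<times> {1..N}. fst x * snd x \<le> N}. f k m)"
  proof (rule sum.reindex_bij_witness[where i = "\<lambda>(k, m). (k * m, k)" and j = "\<lambda>(n, k). (k, n div k)"])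
    fix x assume x: "x \<in> (SIGMA n:{1..N}. {k. k dvd n})"
    then obtain n k m where nk: "x = (n, k)" "n = k * m" "1 \<le> n" "n \<le> N" by auto
    have km: "k \<ge> 1" "m \<ge> 1" using nk by (cases k; cases m; auto)+
    have "k \<le> k * m" "m \<le> k * m" using km by auto
    then have "k \<le> N" "m \<le> N" using nk(2,4) le_trans by metis+
    then show "(case x of (n, k) \<Rightarrow> (k, n div k)) \<in> {x \<in> {1..N} \<times> {1..N}. fst x * snd x \<le> N}"
      and "(case case x of (n, k) \<Rightarrow> (k, n div k) of (k, m) \<Rightarrow> (k * m, k)) = x"
      and "(case case x of (n, k) \<Rightarrow> (k, n div k) of (k, m) \<Rightarrow> f k m) = (case x of (n, k) \<Rightarrow> f k (n div k))"
      using nk km by auto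
  qed auto
  also have "\<dots> = (\<Sum>x\<in>{1..N} \<times> {1..N}. if fst x * snd x \<le> N then (case x of (k, m) \<Rightarrow> f k m) else 0)"
    by (rule sum.inter_filter) simp
  also have "\<dots> = (\<Sum>k = 1..N. \<Sum>m = 1..N. if k * m \<le> N then f k m else 0)"
    unfolding sum.cartesian_product by (intro sum.cong) auto
  finally show ?thesis .
qed

text \<open>Each term of the expanded product is at most X = H N^2 E times the harmonic factor. The
  assumption D E <= 1, that is D <= z, is what absorbs the terms growing with D. The constant is
  5677 = 1 + 4 (384 + 1024 + 3 + 8).\<close>

lemma type_I_numeric:
  fixes N H q D E B hq :: real
  assumes "N \<ge> 1" "H \<ge> 1" "q > 0" "E > 0" "E \<le> 1" "1 / q \<le> E\<^sup>2" "1 / N \<le> E ^ 4" "q \<le> H * N\<^sup>2 * E\<^sup>2"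
    and "D \<ge> 1" "D * E \<le> 1" "B \<ge> 1" "hq \<ge> 1"
  shows "H * N * D + 4 * B ^ 3 * ((128 * D * N * H) / q + 1) * (3 * N + 8 * q * D * hq)
         \<le> 5677 * B ^ 3 * hq * (H * N\<^sup>2 * E)"
proof -
  define X where "X = H * N\<^sup>2 * E"
  have X0: "X \<ge> 0" using assms by (simp add: X_def)
  have N4: "1 \<le> N * E ^ 4" using assms by (simp add: field_simps)
  have E2: "E\<^sup>2 \<le> E" using assms by (simp add: power2_eq_square mult_left_le)
  have E4: "E ^ 4 \<le> E"
    using assms power_decreasing[of 1 4 E] by simp
  have a1: "D * N\<^sup>2 * H / q \<le> X"
  proof -
    have "D * (1 / q) \<le> D * E\<^sup>2" using assms by (intro mult_left_mono) auto
    also have "\<dots> = (D * E) * E" by (simp add: power2_eq_square)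
    also have "\<dots> \<le> 1 * E" using assms by (intro mult_right_mono) auto
    finally have "(D * (1 / q)) * (N\<^sup>2 * H) \<le> E * (N\<^sup>2 * H)" using assms by (intro mult_right_mono) auto
    then show ?thesis by (simp add: X_def mult_ac)
  qed
  have a2: "D\<^sup>2 * N * H \<le> X"
  proof -
    have "D\<^sup>2 * 1 \<le> D\<^sup>2 * (N * E ^ 4)" using N4 by (intro mult_left_mono) auto
    also have "\<dots> = (D * E)\<^sup>2 * (N * E\<^sup>2)" by (simp add: power2_eq_square power4_eq_xxxx)
    also have "\<dots> \<le> 1 * (N * E\<^sup>2)" using assms by (intro mult_right_mono) (auto simp: power_le_one)
    also have "\<dots> \<le> N * E" using E2 assms by simp
    finally have "D\<^sup>2 * (N * H) \<le> (N * E) * (N * H)" using assms by (intro mult_right_mono) auto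
    then show ?thesis by (simp add: X_def power2_eq_square mult_ac)
  qed
  have a3: "N \<le> X"
  proof -
    have "N * 1 \<le> N * (N * E ^ 4)" using N4 assms by (intro mult_left_mono) auto
    also have "\<dots> \<le> N * (N * E)" using E4 assms by (intro mult_left_mono) auto
    also have "\<dots> = 1 * (N\<^sup>2 * E)" by (simp add: power2_eq_square)
    also have "\<dots> \<le> H * (N\<^sup>2 * E)" using assms by (intro mult_right_mono) auto
    finally show ?thesis by (simp add: X_def mult_ac)
  qed
  have a4: "q * D \<le> X"
  proof -
    have "q * D \<le> (H * N\<^sup>2 * E\<^sup>2) * D" using assms by (intro mult_right_mono) auto
    also have "\<dots> = (H * N\<^sup>2 * E) * (D * E)" by (simp add: power2_eq_square)
    also have "\<dots> \<le> (H * N\<^sup>2 * E) * 1" using assms by (intro mult_left_mono) auto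
    finally show ?thesis by (simp add: X_def)
  qed
  have a5: "H * N * D \<le> X"
  proof -
    have "D * (N * H) \<le> D\<^sup>2 * (N * H)" using assms by (intro mult_right_mono) (auto simp: power2_eq_square)
    then show ?thesis using a2 by (simp add: mult_ac)
  qed
  have Xh: "X \<le> X * hq" using X0 assms by (simp add: mult_le_cancel_left1)
  have "((128 * D * N * H) / q + 1) * (3 * N + 8 * q * D * hq)
      = 384 * (D * N\<^sup>2 * H / q) + 1024 * ((D\<^sup>2 * N * H) * hq) + 3 * N + 8 * ((q * D) * hq)"
    using assms by (simp add: field_simps power2_eq_square)
  also have "\<dots> \<le> 384 * X + 1024 * (X * hq) + 3 * X + 8 * (X * hq)"
    using a1 a2 a3 a4 assms by (intro add_mono mult_left_mono mult_right_mono) auto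
  also have "\<dots> \<le> 1419 * (X * hq)" using Xh by linarith
  finally have "4 * B ^ 3 * (((128 * D * N * H) / q + 1) * (3 * N + 8 * q * D * hq)) \<le> 4 * B ^ 3 * (1419 * (X * hq))"
    using assms by (intro mult_left_mono) auto
  moreover have "1 * (X * hq) \<le> B ^ 3 * (X * hq)" using assms X0 by (intro mult_right_mono) auto
  ultimately show ?thesis using a5 Xh unfolding X_def[symmetric] by (simp add: algebra_simps)
qed

text \<open>The diagonal saves 1/V, so V must be at least of order 1/E. The radicand must save E^2,
  which for its term with 1/U requires U at least of order 1/E^2. After multiplication by U^2 all
  terms are expressed through P = U V <= 2 N and compared with X^2.\<close>

lemma type_II_numeric:
  fixes N H q U V E B hq :: real
  assumes "N \<ge> 1" "H \<ge> 1" "q > 0" "E > 0" "E \<le> 1" "1 / q \<le> E\<^sup>2" "1 / N \<le> E ^ 4" "q \<le> H * N\<^sup>2 * E\<^sup>2"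
    and "U \<ge> 1" "V \<ge> 1" "U * V \<le> 2 * N" "1 / V \<le> 2 * E" "1 / U \<le> 2 * E\<^sup>2" "B \<ge> 1" "hq \<ge> 1"
  shows "U * (H * V * U + sqrt (H * V\<^sup>2 *
             (H * V\<^sup>2 * U + 8 * B ^ 4 * ((2 * U * V\<^sup>2 * H) / q + 1) * (3 * U + 8 * q * hq))))
         \<le> 82 * B ^ 4 * hq * (H * N\<^sup>2 * E)"
proof -
  define X where "X = H * N\<^sup>2 * E"
  define P where "P = U * V"
  have X0: "X \<ge> 0" using assms by (simp add: X_def)
  have P0: "P \<ge> 0" using assms by (simp add: P_def)
  have PN: "P \<le> 2 * N" using assms by (simp add: P_def)
  have P2: "P\<^sup>2 \<le> 4 * N\<^sup>2" using power_mono[OF PN P0, of 2] by (simp add: power_mult_distrib)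
  have P4: "P ^ 4 \<le> 16 * N ^ 4" using power_mono[OF PN P0, of 4] by (simp add: power_mult_distrib)
  have V1: "1 \<le> 2 * E * V" using assms by (simp add: field_simps)
  have U1: "1 \<le> 2 * E\<^sup>2 * U" using assms by (simp add: field_simps)
  have N4: "1 \<le> N * E ^ 4" using assms by (simp add: field_simps)
  have X2: "X\<^sup>2 = H\<^sup>2 * N ^ 4 * E\<^sup>2" by (simp add: X_def power_mult_distrib flip: power_mult)
  have first: "U * (H * V * U) \<le> 8 * X"
  proof -
    have "P * U * 1 \<le> P * U * (2 * E * V)" using V1 P0 assms by (intro mult_left_mono) auto
    also have "\<dots> = 2 * E * P\<^sup>2" by (simp add: P_def power2_eq_square)
    also have "\<dots> \<le> 2 * E * (4 * N\<^sup>2)" using P2 assms by (intro mult_left_mono) auto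
    finally have "H * (P * U) \<le> H * (2 * E * (4 * N\<^sup>2))" using assms by (intro mult_left_mono) auto
    then show ?thesis by (simp add: P_def X_def mult_ac)
  qed
  have c1: "H\<^sup>2 * (P\<^sup>2 * V\<^sup>2 * U) \<le> 32 * X\<^sup>2"
  proof -
    have "P\<^sup>2 * V\<^sup>2 * U * 1 \<le> P\<^sup>2 * V\<^sup>2 * U * (2 * E\<^sup>2 * U)" using U1 assms by (intro mult_left_mono) auto
    also have "\<dots> = 2 * E\<^sup>2 * P ^ 4" by (simp add: P_def power2_eq_square power4_eq_xxxx)
    also have "\<dots> \<le> 2 * E\<^sup>2 * (16 * N ^ 4)" using P4 assms by (intro mult_left_mono) auto
    finally have "H\<^sup>2 * (P\<^sup>2 * V\<^sup>2 * U) \<le> H\<^sup>2 * (2 * E\<^sup>2 * (16 * N ^ 4))" by (intro mult_left_mono) auto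
    then show ?thesis by (simp add: X2 mult_ac)
  qed
  have c2: "H\<^sup>2 * P ^ 4 / q \<le> 16 * X\<^sup>2"
  proof -
    have "P ^ 4 * (1 / q) \<le> (16 * N ^ 4) * E\<^sup>2" using P4 assms by (intro mult_mono) auto
    then have "H\<^sup>2 * (P ^ 4 * (1 / q)) \<le> H\<^sup>2 * ((16 * N ^ 4) * E\<^sup>2)" by (intro mult_left_mono) auto
    then show ?thesis by (simp add: X2 mult_ac)
  qed
  have c4: "H * P\<^sup>2 * U \<le> 8 * X\<^sup>2"
  proof -
    have "U * 1 \<le> U * V" using assms by (intro mult_left_mono) auto
    then have "U \<le> 2 * N" using PN by (simp add: P_def)
    then have "P\<^sup>2 * U \<le> (4 * N\<^sup>2) * (2 * N)" using P2 assms by (intro mult_mono) auto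
    also have "\<dots> = 8 * N ^ 3 * 1" by (simp add: power2_eq_square power3_eq_cube)
    also have "\<dots> \<le> 8 * N ^ 3 * (N * E ^ 4)" using N4 assms by (intro mult_left_mono) auto
    also have "\<dots> = 8 * N ^ 4 * E ^ 4" by (simp add: power3_eq_cube power4_eq_xxxx)
    also have "\<dots> \<le> 8 * N ^ 4 * E\<^sup>2" using assms power_decreasing[of 2 4 E] by (intro mult_left_mono) auto
    finally have "H * (P\<^sup>2 * U) \<le> H\<^sup>2 * (8 * N ^ 4 * E\<^sup>2)"
    proof (rule mult_mono[rotated 1])
      show "H \<le> H\<^sup>2" using assms by (simp add: power2_eq_square)
      show "0 \<le> P\<^sup>2 * U" using assms by simp
    qed auto
    then show ?thesis by (simp add: X2 mult_ac)
  qed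
  have c5: "H * P\<^sup>2 * q \<le> 4 * X\<^sup>2"
  proof -
    have "P\<^sup>2 * q \<le> (4 * N\<^sup>2) * (H * N\<^sup>2 * E\<^sup>2)" using P2 assms by (intro mult_mono) auto
    then have "H * (P\<^sup>2 * q) \<le> H * ((4 * N\<^sup>2) * (H * N\<^sup>2 * E\<^sup>2))" using assms by (intro mult_left_mono) auto
    then show ?thesis unfolding X2 by (simp add: power2_eq_square power4_eq_xxxx mult_ac)
  qed
  define Y where "Y = H * V\<^sup>2 * (H * V\<^sup>2 * U + 8 * B ^ 4 * ((2 * U * V\<^sup>2 * H) / q + 1) * (3 * U + 8 * q * hq))"
  have hB: "1 \<le> B ^ 4 * hq"
  proof -
    have "1 * 1 \<le> B ^ 4 * hq" using assms by (intro mult_mono) auto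
    then show ?thesis by simp
  qed
  have B4: "B ^ 4 \<ge> 1" using assms by simp
  have "U\<^sup>2 * Y = H\<^sup>2 * (P\<^sup>2 * V\<^sup>2 * U) + 8 * B ^ 4 * (6 * (H\<^sup>2 * P ^ 4 / q) +
      (16 * (H\<^sup>2 * (P\<^sup>2 * V\<^sup>2 * U))) * hq + 3 * (H * P\<^sup>2 * U) + (8 * (H * P\<^sup>2 * q)) * hq)"
    using assms by (simp add: Y_def P_def field_simps power2_eq_square power4_eq_xxxx)
  also have "\<dots> \<le> 32 * X\<^sup>2 + 8 * B ^ 4 * (6 * (16 * X\<^sup>2) + (16 * (32 * X\<^sup>2)) * hq + 3 * (8 * X\<^sup>2) + (8 * (4 * X\<^sup>2)) * hq)"
    using c1 c2 c4 c5 assms by (intro add_mono mult_left_mono mult_right_mono) auto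
  also have "\<dots> = 32 * X\<^sup>2 + 8 * B ^ 4 * (120 * X\<^sup>2 + 544 * X\<^sup>2 * hq)" by (simp add: algebra_simps)
  also have "\<dots> \<le> 32 * X\<^sup>2 * (B ^ 4 * hq) + 8 * B ^ 4 * (120 * X\<^sup>2 * hq + 544 * X\<^sup>2 * hq)"
    using assms hB by (intro add_mono mult_left_mono) (auto simp: mult_le_cancel_left1)
  also have "\<dots> = 5344 * (B ^ 4 * hq) * X\<^sup>2" by (simp add: algebra_simps)
  \<comment> \<open>The coefficient 5344 = 32 + 8 (120 + 544) is raised to the square 5476 = 74^2.
    Together with the 8 of the diagonal this gives 82.\<close>
  also have "\<dots> \<le> 5476 * (B ^ 4 * hq)\<^sup>2 * X\<^sup>2"
  proof -
    have "5344 * w \<le> 5476 * w\<^sup>2" if "w \<ge> 1" for w :: real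
      using mult_left_mono[OF that, of w] that unfolding power2_eq_square by linarith
    from this[OF hB] show ?thesis by (rule mult_right_mono) simp
  qed
  also have "\<dots> = (74 * (B ^ 4 * hq) * X)\<^sup>2" by (simp add: power_mult_distrib)
  finally have "sqrt (U\<^sup>2 * Y) \<le> 74 * (B ^ 4 * hq) * X"
    using X0 hB by (intro real_le_lsqrt) auto
  moreover have "sqrt (U\<^sup>2 * Y) = U * sqrt Y" using assms by (simp add: real_sqrt_mult)
  moreover have "8 * X * 1 \<le> 8 * X * (B ^ 4 * hq)" using hB X0 by (intro mult_left_mono) auto
  ultimately show ?thesis using first unfolding Y_def[symmetric] X_def[symmetric]
    by (simp add: algebra_simps)
qed

section \<open>The type I and bilinear pieces of the exponential sum\<close>

definition type_I_part :: "real \<Rightarrow> nat \<Rightarrow> nat \<Rightarrow> real \<Rightarrow> complex" where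
  "type_I_part z N i \<beta> = (\<Sum>D\<in>{2^i..<2*2^i}. of_real (if real D < z then moebius_3mod4 D else 0) *
      (\<Sum>n | n \<in> {1..N} \<and> D dvd n \<and> n mod 4 = 1. e ((real n)\<^sup>2 * \<beta>)))"

definition left_weight :: "real \<Rightarrow> nat \<Rightarrow> nat \<Rightarrow> nat \<Rightarrow> nat \<Rightarrow> complex" where
  "left_weight z N i j k =
     (if 2^i \<le> k \<and> k < 2*2^i \<and> odd k \<and> even (least_prime k div 2^j) then of_real (critical_weight (real N) z k) else 0)"

definition right_weight :: "nat \<Rightarrow> nat \<Rightarrow> nat \<Rightarrow> complex" where
  "right_weight N j m = (if odd m \<and> odd ((least_prime_3mod4 N m + 1) div 2^j) then 1 else 0)"

text \<open>The condition \<open>least_prime k < least_prime_3mod4 N m + 1\<close> restricted to the pairs whose highest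
  differing binary digit is the \<open>j\<close>-th one.\<close>
definition type_II_part :: "real \<Rightarrow> nat \<Rightarrow> nat \<Rightarrow> nat \<Rightarrow> real \<Rightarrow> complex" where
  "type_II_part z N i j \<beta> = (\<Sum>k = 1..N. \<Sum>m = 1..N.
     if (least_prime k div 2^(j+1), k mod 4) = ((least_prime_3mod4 N m + 1) div 2^(j+1), m mod 4) \<and> k * m \<le> N
     then left_weight z N i j k * right_weight N j m * e ((real (k * m))\<^sup>2 * \<beta>) else 0)"

lemma critical_weight_nonzero:
  assumes "critical_weight N z k \<noteq> 0" "z > 1"
  shows "k > 1" "z \<le> real k" "real k \<le> N / z" "least_prime k \<le> k"
proof -
  show 1: "z \<le> real k" "real k \<le> N / z" using assms by (auto simp: critical_weight_def split: if_splits)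
  then show "k > 1" using assms by linarith
  then have "prime_factors k \<noteq> {}" by (simp add: prime_factorization_empty_iff)
  then have "least_prime k \<in> prime_factors k" unfolding least_prime_def by (intro Min_in) auto
  then show "least_prime k \<le> k" using \<open>k > 1\<close> by (auto simp: dvd_imp_le)
qed

lemma least_prime_3mod4_le: "m \<ge> 1 \<Longrightarrow> m \<le> N \<Longrightarrow> least_prime_3mod4 N m \<le> N + 1"
proof (cases "primes_3mod4 m = {}")
  case False
  assume m: "m \<ge> 1" "m \<le> N"
  have "Min (primes_3mod4 m) \<in> primes_3mod4 m" using False by (intro Min_in) auto
  then have "Min (primes_3mod4 m) \<le> m" using m by (auto simp: primes_3mod4_def dvd_imp_le)
  then show ?thesis using False m by (simp add: least_prime_3mod4_def)
qed (simp add: least_prime_3mod4_def)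

text \<open>Converts a congruence on the product into two parity conditions, absorbed by the weights
  of k and m, and an equality of residues, absorbed by the labels.\<close>

lemma odd_mult_mod4_eq_1_iff:
  fixes k m :: nat
  shows "(k * m) mod 4 = 1 \<longleftrightarrow> odd k \<and> odd m \<and> k mod 4 = m mod 4"
proof -
  have "(k * m) mod 4 = ((k mod 4) * (m mod 4)) mod 4" by (simp add: mod_mult_eq)
  moreover have "k mod 4 \<in> {0,1,2,3}" "m mod 4 \<in> {0,1,2,3}" by auto
  moreover have "odd k \<longleftrightarrow> k mod 4 \<in> {1, 3}" "odd m \<longleftrightarrow> m mod 4 \<in> {1, 3}" by (simp; presburger)+
  ultimately show ?thesis by auto
qed

text \<open>Exactly one dyadic block i contains k, and the digits j add up to the indicator of
  \<open>least_prime k < least_prime_3mod4 N m + 1\<close>. The double sum of pieces therefore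
  restores the coupled term without error.\<close>

lemma type_II_pointwise:
  fixes z :: real and x :: complex
  assumes z: "z > 1" and L: "N + 2 < 2 ^ L" and k: "1 \<le> k" "k \<le> N" and m: "1 \<le> m" "m \<le> N"
  shows "(\<Sum>i<L. \<Sum>j<L. if (least_prime k div 2^(j+1), k mod 4) = ((least_prime_3mod4 N m + 1) div 2^(j+1), m mod 4) \<and> k * m \<le> N
            then left_weight z N i j k * right_weight N j m * x else 0)
         = (if k * m \<le> N then (if (k * m) mod 4 = 1 \<and> least_prime k \<le> least_prime_3mod4 N m then of_real (critical_weight (real N) z k) * x else 0) else 0)"
proof (cases "critical_weight (real N) z k = 0 \<or> \<not> k * m \<le> N \<or> (k * m) mod 4 \<noteq> 1")
  case True
  then show ?thesis unfolding odd_mult_mod4_eq_1_iff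
    by (auto simp: left_weight_def right_weight_def intro!: sum.neutral)
next
  case False
  then have c: "critical_weight (real N) z k \<noteq> 0" "k * m \<le> N" "(k * m) mod 4 = 1" by auto
  then have o: "odd k" "odd m" "k mod 4 = m mod 4" unfolding odd_mult_mod4_eq_1_iff by blast+
  define u v where "u = least_prime k" and "v = least_prime_3mod4 N m + 1"
  have "u \<le> N" using critical_weight_nonzero(4)[OF c(1) z] k by (simp add: u_def)
  then have uL: "u < 2 ^ L" using L by linarith
  \<comment> \<open>The shifted value v can be as large as N + 2, from the placeholder N + 1 plus 1
    for the strict inequality; this dictates N + 2 < 2^L.\<close>
  have vL: "v < 2 ^ L" using least_prime_3mod4_le[OF m] L by (simp add: v_def)
  have kL: "k < 2 ^ L" using k L by linarith
  have "(\<Sum>i<L. \<Sum>j<L. if (least_prime k div 2^(j+1), k mod 4) = ((least_prime_3mod4 N m + 1) div 2^(j+1), m mod 4) \<and> k * m \<le> N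
            then left_weight z N i j k * right_weight N j m * x else 0)
      = (\<Sum>i<L. \<Sum>j<L. of_bool (2 ^ i \<le> k \<and> k < 2 * 2 ^ i) *
          (of_bool (u div 2 ^ (j+1) = v div 2 ^ (j+1) \<and> even (u div 2 ^ j) \<and> odd (v div 2 ^ j)) * (of_real (critical_weight (real N) z k) * x)))"
    using o c(2) by (intro sum.cong refl) (auto simp: left_weight_def right_weight_def u_def v_def)
  also have "\<dots> = (\<Sum>i<L. of_bool (2 ^ i \<le> k \<and> k < 2 * 2 ^ i)) *
      ((\<Sum>j<L. of_bool (u div 2 ^ (j+1) = v div 2 ^ (j+1) \<and> even (u div 2 ^ j) \<and> odd (v div 2 ^ j))) * (of_real (critical_weight (real N) z k) * x))"
    unfolding sum_distrib_left[symmetric] sum_distrib_right[symmetric] ..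
  also have "\<dots> = of_bool (u < v) * (of_real (critical_weight (real N) z k) * x)"
    unfolding less_as_binary_digits[OF uL vL] sum_dyadic_indicator[OF k(1) kL] by simp
  finally show ?thesis using c by (simp add: u_def v_def less_Suc_eq_le)
qed

lemma S_decomposition:
  fixes z :: real
  assumes z: "z > 1" "z ^ 3 \<le> real N" and L: "N + 2 < 2 ^ L"
  shows "S \<beta> (real N) = (\<Sum>i<L. type_I_part z N i \<beta>) + (\<Sum>i<L. \<Sum>j<L. type_II_part z N i j \<beta>)"
proof -
  define c where "c = (\<lambda>D. complex_of_real (if real D < z then moebius_3mod4 D else 0))"
  define g where "g = (\<lambda>k m. if (k * m) mod 4 = 1 \<and> least_prime k \<le> least_prime_3mod4 N m then
      complex_of_real (critical_weight (real N) z k) * e ((real (k * m))\<^sup>2 * \<beta>) else 0)"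
  define x where "x = (\<lambda>n::nat. e ((real n)\<^sup>2 * \<beta>))"
  have term_eq: "complex_of_real (b n) * x n = (\<Sum>D | D dvd n. if n mod 4 = 1 then c D * x n else 0) + (\<Sum>k | k dvd n. g k (n div k))"
    if n: "n \<in> {1..N}" for n
  proof (cases "n mod 4 = 1")
    case True
    have "n \<le> N" "n > 0" using n by auto
    have fin: "finite {k. k dvd n}" using \<open>n > 0\<close> by simp
    have "complex_of_real (b n) = (\<Sum>D | D dvd n. c D) + (\<Sum>k | k dvd n. if least_prime k \<le> least_prime_3mod4 N (n div k) then complex_of_real (critical_weight (real N) z k) else 0)"
    proof -
      have "(\<Sum>D | D dvd n \<and> real D < z. moebius_3mod4 D) = (\<Sum>D\<in>{D \<in> {D. D dvd n}. real D < z}. moebius_3mod4 D)" by simp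
      also have "\<dots> = (\<Sum>D | D dvd n. if real D < z then moebius_3mod4 D else 0)" by (rule sum.inter_filter[OF fin])
      finally have 1: "(\<Sum>D | D dvd n \<and> real D < z. moebius_3mod4 D) = (\<Sum>D | D dvd n. if real D < z then moebius_3mod4 D else 0)" .
      have "(\<Sum>k | k dvd n \<and> least_prime k \<le> least_prime_3mod4 N (n div k). critical_weight (real N) z k)
          = (\<Sum>k\<in>{k \<in> {k. k dvd n}. least_prime k \<le> least_prime_3mod4 N (n div k)}. critical_weight (real N) z k)" by simp
      also have "\<dots> = (\<Sum>k | k dvd n. if least_prime k \<le> least_prime_3mod4 N (n div k) then critical_weight (real N) z k else 0)" by (rule sum.inter_filter[OF fin])
      finally have 2: "(\<Sum>k | k dvd n \<and> least_prime k \<le> least_prime_3mod4 N (n div k). critical_weight (real N) z k)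
        = (\<Sum>k | k dvd n. if least_prime k \<le> least_prime_3mod4 N (n div k) then critical_weight (real N) z k else 0)" .
      show ?thesis unfolding b_decomposition[OF True \<open>n \<le> N\<close> z] 1 2 c_def of_real_add of_real_sum
        by (intro arg_cong2[of _ _ _ _ "(+)"] sum.cong refl) auto
    qed
    then have "complex_of_real (b n) * x n = (\<Sum>D | D dvd n. c D * x n) +
        (\<Sum>k | k dvd n. (if least_prime k \<le> least_prime_3mod4 N (n div k) then complex_of_real (critical_weight (real N) z k) else 0) * x n)"
      by (simp only: distrib_right sum_distrib_right)
    also have "(\<Sum>k | k dvd n. (if least_prime k \<le> least_prime_3mod4 N (n div k) then complex_of_real (critical_weight (real N) z k) else 0) * x n)
        = (\<Sum>k | k dvd n. g k (n div k))"
      by (intro sum.cong refl) (auto simp: g_def x_def True)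
    finally show ?thesis using True by simp
  next
    case False
    then have "n \<notin> BB" using BB_mod4 by blast
    then have "complex_of_real (b n) = 0" by (simp add: b_def)
    moreover have "g k (n div k) = 0" if "k dvd n" for k using that False by (simp add: g_def)
    ultimately show ?thesis using False by simp
  qed
  have "S \<beta> (real N) = (\<Sum>n = 1..N. complex_of_real (b n) * x n)" by (simp add: S_def x_def)
  also have "\<dots> = (\<Sum>n = 1..N. (\<Sum>D | D dvd n. if n mod 4 = 1 then c D * x n else 0) + (\<Sum>k | k dvd n. g k (n div k)))"
    by (intro sum.cong refl term_eq)
  also have "\<dots> = (\<Sum>n = 1..N. \<Sum>D | D dvd n. if n mod 4 = 1 then c D * x n else 0) + (\<Sum>n = 1..N. \<Sum>k | k dvd n. g k (n div k))"
    by (rule sum.distrib)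
  also have "(\<Sum>n = 1..N. \<Sum>D | D dvd n. if n mod 4 = 1 then c D * x n else 0) = (\<Sum>i<L. type_I_part z N i \<beta>)"
  proof -
    have "(\<Sum>n = 1..N. \<Sum>D | D dvd n. if n mod 4 = 1 then c D * x n else 0)
        = (\<Sum>n = 1..N. \<Sum>D\<in>{1..<2^L}. if D dvd n \<and> n mod 4 = 1 then c D * x n else 0)"
    proof (rule sum.cong[OF refl])
      fix n assume n: "n \<in> {1..N}"
      have "D \<in> {1..<2^L}" if "D dvd n" for D
      proof -
        have "D \<le> n" "D > 0" using that n by (auto intro: dvd_imp_le dvd_pos_nat)
        then show ?thesis using n L by auto
      qed
      then have "{D. D dvd n} = {D \<in> {1..<2^L}. D dvd n}" by auto
      then show "(\<Sum>D | D dvd n. if n mod 4 = 1 then c D * x n else 0)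
          = (\<Sum>D\<in>{1..<2^L}. if D dvd n \<and> n mod 4 = 1 then c D * x n else 0)"
        by (simp only: sum.inter_filter finite_atLeastLessThan if_if_eq_conj)
    qed
    also have "\<dots> = (\<Sum>D\<in>{1..<2^L}. \<Sum>n = 1..N. if D dvd n \<and> n mod 4 = 1 then c D * x n else 0)"
      by (rule sum.swap)
    also have "\<dots> = (\<Sum>D\<in>{1..<2^L}. c D * (\<Sum>n | n \<in> {1..N} \<and> D dvd n \<and> n mod 4 = 1. x n))"
      by (intro sum.cong refl) (simp only: sum_distrib_left sum.inter_filter[symmetric] finite_atLeastAtMost)
    finally show ?thesis unfolding sum_dyadic by (simp add: type_I_part_def c_def x_def)
  qed
  also have "(\<Sum>n = 1..N. \<Sum>k | k dvd n. g k (n div k)) = (\<Sum>k = 1..N. \<Sum>m = 1..N. if k * m \<le> N then g k m else 0)"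
    by (rule sum_divisor_pairs)
  also have "\<dots> = (\<Sum>k = 1..N. \<Sum>m = 1..N. \<Sum>i<L. \<Sum>j<L.
      if (least_prime k div 2^(j+1), k mod 4) = ((least_prime_3mod4 N m + 1) div 2^(j+1), m mod 4) \<and> k * m \<le> N
      then left_weight z N i j k * right_weight N j m * e ((real (k * m))\<^sup>2 * \<beta>) else 0)"
    unfolding g_def by (intro sum.cong refl type_II_pointwise[symmetric] z L) auto
  also have "\<dots> = (\<Sum>k = 1..N. \<Sum>i<L. \<Sum>m = 1..N. \<Sum>j<L.
      if (least_prime k div 2^(j+1), k mod 4) = ((least_prime_3mod4 N m + 1) div 2^(j+1), m mod 4) \<and> k * m \<le> N
      then left_weight z N i j k * right_weight N j m * e ((real (k * m))\<^sup>2 * \<beta>) else 0)"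
    by (intro sum.cong refl sum.swap)
  also have "\<dots> = (\<Sum>i<L. \<Sum>k = 1..N. \<Sum>m = 1..N. \<Sum>j<L.
      if (least_prime k div 2^(j+1), k mod 4) = ((least_prime_3mod4 N m + 1) div 2^(j+1), m mod 4) \<and> k * m \<le> N
      then left_weight z N i j k * right_weight N j m * e ((real (k * m))\<^sup>2 * \<beta>) else 0)"
    by (rule sum.swap)
  also have "\<dots> = (\<Sum>i<L. \<Sum>k = 1..N. \<Sum>j<L. \<Sum>m = 1..N.
      if (least_prime k div 2^(j+1), k mod 4) = ((least_prime_3mod4 N m + 1) div 2^(j+1), m mod 4) \<and> k * m \<le> N
      then left_weight z N i j k * right_weight N j m * e ((real (k * m))\<^sup>2 * \<beta>) else 0)"
    by (intro sum.cong refl sum.swap)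
  also have "\<dots> = (\<Sum>i<L. \<Sum>j<L. type_II_part z N i j \<beta>)"
    unfolding type_II_part_def by (intro sum.cong refl sum.swap)
  finally show ?thesis .
qed

section \<open>Mean squares\<close>

text \<open>It suffices that both boxes contain the support. Used to shrink the box k, m <= N to the
  dyadic one before Cauchy-Schwarz, where the size of the box matters.\<close>

lemma sum_rectangle_cong:
  fixes F :: "nat \<Rightarrow> nat \<Rightarrow> 'a :: comm_monoid_add"
  assumes "\<And>k m. k \<ge> 1 \<Longrightarrow> m \<ge> 1 \<Longrightarrow> F k m \<noteq> 0 \<Longrightarrow> k \<le> K \<and> m \<le> M \<and> k \<le> K' \<and> m \<le> M'"
  shows "(\<Sum>k = 1..K. \<Sum>m = 1..M. F k m) = (\<Sum>k = 1..K'. \<Sum>m = 1..M'. F k m)"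
  unfolding sum.cartesian_product
proof (rule sum.mono_neutral_cong)
  show "\<And>i. i \<in> {1..K'} \<times> {1..M'} - {1..K} \<times> {1..M} \<Longrightarrow> (case i of (k, m) \<Rightarrow> F k m) = 0"
    using assms by fastforce
  show "\<And>i. i \<in> {1..K} \<times> {1..M} - {1..K'} \<times> {1..M'} \<Longrightarrow> (case i of (k, m) \<Rightarrow> F k m) = 0"
    using assms by fastforce
qed auto

lemma norm_left_weight_le: "norm (left_weight z N i j k) \<le> 1"
  using abs_moebius_3mod4_le[of k] by (simp add: left_weight_def critical_weight_def)

lemma norm_right_weight_le: "norm (right_weight N j m) \<le> 1"
  by (simp add: right_weight_def)

lemma norm_S_le: "norm (S \<beta> (real N)) \<le> real N"
proof -
  have "norm (S \<beta> (real N)) \<le> (\<Sum>n = 1..N. 1)"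
    unfolding S_def by (simp only: floor_of_nat nat_int, intro order_trans[OF norm_sum] sum_mono)
      (simp add: norm_mult b_def)
  then show ?thesis by simp
qed

lemma harm_ge_1:
  assumes "q \<ge> 1"
  shows "harm q \<ge> (1 :: real)"
proof -
  have "(\<Sum>k\<in>{1}. inverse (real k)) \<le> (\<Sum>k = 1..q. inverse (real k))" using assms by (intro sum_mono2) auto
  then show ?thesis by (simp add: harm_def)
qed

lemma nat_div_ge_half:
  fixes n d :: nat
  assumes "d > 0" "d \<le> n"
  shows "real n / real d \<le> 2 * real (n div d)"
proof -
  have "n div d \<ge> 1" using assms by (simp add: Suc_le_eq div_greater_zero_iff)
  then have "real (n div d) \<ge> 1" by (metis of_nat_1 of_nat_le_iff)
  moreover have "real n / real d < real (n div d) + 1"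
    using floor_divide_of_nat_eq[where 'a = real, of n d] floor_correct[of "real n / real d"] by linarith
  ultimately show ?thesis by linarith
qed

text \<open>The longer of the two variables takes the role of u in \<open>bilinear_bound\<close>: m
  when 4^i <= N, otherwise k. Its range has length at least sqrt N / 2, which yields the saving in U
  through 1 / sqrt N <= E^2. The range of the other variable has length at least z / 2 because the
  block meets [z, N/z].\<close>

lemma type_II_part_bound:
  fixes \<alpha> B E z :: real and a :: int and q N H i j :: nat
  assumes q: "q \<ge> 1" and cop: "coprime a (int q)"
    and al: "\<bar>\<alpha> - of_int a / real q\<bar> \<le> 1 / (real q)\<^sup>2"
    and NH: "N \<ge> 1" "H \<ge> 1" and E: "E > 0" "E < 1" "1 / real q \<le> E\<^sup>2" "1 / sqrt (real N) \<le> E\<^sup>2"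
      "real q \<le> real H * (real N)\<^sup>2 * E\<^sup>2" and z: "z = 1 / E"
    and B: "B \<ge> 1" "\<And>t. 1 \<le> t \<Longrightarrow> t \<le> 128 * N\<^sup>2 * H \<Longrightarrow> real (card {d. d dvd t}) \<le> B"
  shows "(\<Sum>h = 1..H. (norm (type_II_part z N i j (real h * \<alpha>)))\<^sup>2)
           \<le> 82 * B ^ 4 * harm q * (real H * (real N)\<^sup>2 * E)"
proof (cases "\<exists>k. left_weight z N i j k \<noteq> 0")
  case False
  then have "type_II_part z N i j \<beta> = 0" for \<beta> unfolding type_II_part_def using False by (simp cong: if_cong)
  then show ?thesis using B E harm_nonneg[of q, where 'a = real] by simp
next
  case True
  \<comment> \<open>One k with nonzero weight locates the whole block: 2^i <= k0 <= N/z and z <= k0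
    < 2 * 2^i. A block without such k contributes nothing.\<close>
  then obtain k0 where k0: "left_weight z N i j k0 \<noteq> 0" by blast
  have z1: "z > 1" using E z by simp
  have cw0: "critical_weight (real N) z k0 \<noteq> 0" "2 ^ i \<le> k0" "k0 < 2 * 2 ^ i" using k0 by (auto simp: left_weight_def split: if_splits)
  have zk: "z \<le> real k0" "real k0 \<le> real N / z" using critical_weight_nonzero[OF cw0(1) z1] by auto
  have i_le: "(2::real) ^ i \<le> real N * E"
  proof -
    have "(2::real) ^ i \<le> real k0" using cw0(2) by (metis of_nat_le_iff of_nat_numeral of_nat_power)
    also have "real k0 \<le> real N * E" using zk(2) by (simp add: z)
    finally show ?thesis .
  qed
  have E4: "1 / real N \<le> E ^ 4"
  proof -
    have "(1 / sqrt (real N))\<^sup>2 \<le> (E\<^sup>2)\<^sup>2" using E by (intro power_mono) auto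
    then show ?thesis using NH by (simp add: power_divide flip: power_mult)
  qed
  have "real N * E \<le> real N * 1" using E by (intro mult_left_mono) auto
  then have "(2::real) ^ i \<le> real N" using i_le by linarith
  then have iN: "2 ^ i \<le> N" by (metis of_nat_le_iff of_nat_numeral of_nat_power)
  define W where "W = N div 2 ^ i"
  have W_half: "real N / 2 ^ i \<le> 2 * real W"
    unfolding W_def using nat_div_ge_half[of "2 ^ i" N] iN by simp
  have W1: "W \<ge> 1" using iN unfolding W_def by (simp add: Suc_le_eq div_greater_zero_iff)
  have W2: "W * 2 ^ i \<le> N" unfolding W_def by simp
  have W2r: "2 * (real W * 2 ^ i) \<le> 2 * real N"
  proof -
    have "real (W * 2 ^ i) \<le> real N" using W2 by (simp only: of_nat_le_iff)
    then show ?thesis by simp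
  qed
  have p1: "real (2 * 2 ^ i) \<ge> 1"
  proof -
    have "(1::real) \<le> 2 ^ i" "real (2 * 2 ^ i) = 2 * 2 ^ i" by simp_all
    then show ?thesis by linarith
  qed
  have WN: "W \<le> N" unfolding W_def by simp
  have sN: "sqrt (real N) \<ge> 1" "sqrt (real N) * sqrt (real N) = real N" using NH by auto
  have hq: "harm q \<ge> (1 :: real)" using q by (rule harm_ge_1)
  have nz: "2 ^ i \<le> k \<and> k < 2 * 2 ^ i" if "left_weight z N i j k \<noteq> 0" for k
    using that by (auto simp: left_weight_def split: if_splits)
  have m_le: "m \<le> W" if "k * m \<le> N" "2 ^ i \<le> k" for k m
  proof -
    have "2 ^ i * m \<le> N" using that by (meson le_trans mult_le_mono1)
    then show ?thesis unfolding W_def by (simp add: less_eq_div_iff_mult_less_eq mult.commute)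
  qed
  define F where "F = (\<lambda>\<beta> k m. if (least_prime k div 2^(j+1), k mod 4) = ((least_prime_3mod4 N m + 1) div 2^(j+1), m mod 4) \<and> k * m \<le> N
     then left_weight z N i j k * right_weight N j m * e ((real (k * m))\<^sup>2 * \<beta>) else 0)"
  have F_nz: "k \<le> N \<and> m \<le> N \<and> k \<le> 2 * 2 ^ i \<and> m \<le> W" if km: "k \<ge> 1" "m \<ge> 1" and nz0: "F \<beta> k m \<noteq> 0" for \<beta> k m
  proof -
    have *: "k * m \<le> N" "left_weight z N i j k \<noteq> 0" using nz0 by (auto simp: F_def split: if_splits)
    have "k \<le> k * m" "m \<le> k * m" using km by auto
    then show ?thesis using * nz[OF *(2)] m_le[OF *(1)] by linarith
  qed
  have part: "type_II_part z N i j \<beta> = (\<Sum>k = 1..2*2^i. \<Sum>m = 1..W. F \<beta> k m)" for \<beta>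
  proof -
    have "type_II_part z N i j \<beta> = (\<Sum>k = 1..N. \<Sum>m = 1..N. F \<beta> k m)"
      by (simp only: type_II_part_def F_def)
    also have "\<dots> = (\<Sum>k = 1..2*2^i. \<Sum>m = 1..W. F \<beta> k m)"
      by (rule sum_rectangle_cong) (use F_nz in blast)
    finally show ?thesis .
  qed
  show ?thesis
  proof (cases "(2 ^ i)\<^sup>2 \<le> N")
    case True
    have "(2::real) ^ i \<le> sqrt (real N)"
      by (rule real_le_rsqrt) (use True in \<open>metis of_nat_le_iff of_nat_numeral of_nat_power\<close>)
    then have "sqrt (real N) * 2 ^ i \<le> sqrt (real N) * sqrt (real N)" using sN by (intro mult_left_mono) auto
    then have "sqrt (real N) \<le> real N / 2 ^ i" using sN by (simp add: field_simps)
    then have WsN: "sqrt (real N) / 2 \<le> real W" using W_half by linarith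
    have "(\<Sum>h = 1..H. (norm (type_II_part z N i j (real h * \<alpha>)))\<^sup>2)
        = (\<Sum>h = 1..H. (norm (\<Sum>m = 1..W. \<Sum>k = 1..2*2^i.
             if ((least_prime_3mod4 N m + 1) div 2^(j+1), m mod 4) = (least_prime k div 2^(j+1), k mod 4) \<and> m * k \<le> N
             then right_weight N j m * left_weight z N i j k * e ((real (m * k))\<^sup>2 * (real h * \<alpha>)) else 0))\<^sup>2)"
      unfolding part F_def
      by (subst sum.swap, intro sum.cong refl arg_cong[of _ _ "\<lambda>x. (norm x)\<^sup>2"] if_cong) (auto simp: mult_ac)
    also have "\<dots> \<le> real W * (real H * real (2*2^i) * real W + sqrt (real H * (real (2*2^i))\<^sup>2 *
             (real H * (real (2*2^i))\<^sup>2 * real W + 8 * B ^ 4 * ((2 * real W * (real (2*2^i))\<^sup>2 * real H) / real q + 1)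
                * (3 * real W + 8 * real q * harm q))))"
    proof (rule bilinear_bound[OF q cop al norm_right_weight_le norm_left_weight_le])
      fix t assume t: "1 \<le> t" "t \<le> 2 * W * (2 * 2 ^ i)\<^sup>2 * H"
      have "2 * W * (2 * 2 ^ i)\<^sup>2 * H = 8 * (W * 2 ^ i) * 2 ^ i * H" by (simp add: power2_eq_square)
      also have "\<dots> \<le> 8 * N * N * H" using W2 iN by (intro mult_mono) auto
      also have "\<dots> \<le> 128 * N\<^sup>2 * H" by (simp add: power2_eq_square)
      finally have "2 * W * (2 * 2 ^ i)\<^sup>2 * H \<le> 128 * N\<^sup>2 * H" .
      from B(2)[OF t(1) order.trans[OF t(2) this]] show "real (card {d. d dvd t}) \<le> B" .
    qed (use B in simp)
    also have "\<dots> \<le> 82 * B ^ 4 * harm q * (real H * (real N)\<^sup>2 * E)"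
    proof (rule type_II_numeric)
      have "real W * real (2 * 2 ^ i) = 2 * (real W * 2 ^ i)" by simp
      then show "real W * real (2 * 2 ^ i) \<le> 2 * real N" using W2r by (simp only:)
      have "k0 \<le> 2 * 2 ^ i" using cw0 by simp
      then have "1 / E \<le> real (2 * 2 ^ i)" using zk(1) unfolding z by linarith
      then have "1 / real (2 * 2 ^ i) \<le> E" using E by (simp add: field_simps)
      then show "1 / real (2 * 2 ^ i) \<le> 2 * E" using E by linarith
      have "1 / real W \<le> 1 / (sqrt (real N) / 2)" using WsN W1 NH by (intro divide_left_mono mult_pos_pos) auto
      also have "\<dots> = 2 * (1 / sqrt (real N))" by simp
      finally show "1 / real W \<le> 2 * E\<^sup>2" using E by linarith
      show "real (2 * 2 ^ i) \<ge> 1" by (rule p1)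
    qed (use NH q E E4 B W1 hq in auto)
    finally show ?thesis .
  next
    case False
    have "sqrt (real N) \<le> (2::real) ^ i"
      by (rule real_le_lsqrt) (use False in \<open>auto simp: not_le simp flip: of_nat_less_iff[where 'a = real]\<close>)
    moreover have "(0::real) \<le> 2 ^ i" "real (2 * 2 ^ i) = 2 * 2 ^ i" by simp_all
    ultimately have UsN: "sqrt (real N) \<le> real (2 * 2 ^ i)" by linarith
    have "(\<Sum>h = 1..H. (norm (type_II_part z N i j (real h * \<alpha>)))\<^sup>2)
        \<le> real (2*2^i) * (real H * real W * real (2*2^i) + sqrt (real H * (real W)\<^sup>2 *
             (real H * (real W)\<^sup>2 * real (2*2^i) + 8 * B ^ 4 * ((2 * real (2*2^i) * (real W)\<^sup>2 * real H) / real q + 1)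
                * (3 * real (2*2^i) + 8 * real q * harm q))))"
      unfolding part F_def
    proof (rule bilinear_bound[OF q cop al norm_left_weight_le norm_right_weight_le])
      fix t assume t: "1 \<le> t" "t \<le> 2 * (2 * 2 ^ i) * W\<^sup>2 * H"
      have "2 * (2 * 2 ^ i) * W\<^sup>2 * H = 4 * (W * 2 ^ i) * W * H" by (simp add: power2_eq_square)
      also have "\<dots> \<le> 4 * N * N * H" using W2 WN by (intro mult_mono) auto
      also have "\<dots> \<le> 128 * N\<^sup>2 * H" by (simp add: power2_eq_square)
      finally have "2 * (2 * 2 ^ i) * W\<^sup>2 * H \<le> 128 * N\<^sup>2 * H" .
      from B(2)[OF t(1) order.trans[OF t(2) this]] show "real (card {d. d dvd t}) \<le> B" .
    qed (use B in simp)
    also have "\<dots> \<le> 82 * B ^ 4 * harm q * (real H * (real N)\<^sup>2 * E)"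
    proof (rule type_II_numeric)
      have "real (2 * 2 ^ i) * real W = 2 * (real W * 2 ^ i)" by simp
      then show "real (2 * 2 ^ i) * real W \<le> 2 * real N" using W2r by (simp only:)
      have "1 / E \<le> real N / 2 ^ i" using i_le E by (simp add: field_simps)
      then have "1 / E \<le> 2 * real W" using W_half by linarith
      then show "1 / real W \<le> 2 * E" using E W1 by (simp add: field_simps)
      have "1 / real (2 * 2 ^ i) \<le> 1 / sqrt (real N)" using UsN NH by (intro divide_left_mono mult_pos_pos) auto
      then show "1 / real (2 * 2 ^ i) \<le> 2 * E\<^sup>2" using E zero_le_power2[of E] by linarith
      show "real (2 * 2 ^ i) \<ge> 1" by (rule p1)
    qed (use NH q E E4 B W1 hq in auto)
    finally show ?thesis .
  qed
qed

lemma type_I_part_bound: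
  fixes \<alpha> B E z :: real and a :: int and q N H i :: nat
  assumes q: "q \<ge> 1" and cop: "coprime a (int q)"
    and al: "\<bar>\<alpha> - of_int a / real q\<bar> \<le> 1 / (real q)\<^sup>2"
    and NH: "N \<ge> 1" "H \<ge> 1" and E: "E > 0" "E < 1" "1 / real q \<le> E\<^sup>2" "1 / real N \<le> E ^ 4"
      "real q \<le> real H * (real N)\<^sup>2 * E\<^sup>2" and z: "z = 1 / E"
    and B: "B \<ge> 1" "\<And>t. 1 \<le> t \<Longrightarrow> t \<le> 128 * N\<^sup>2 * H \<Longrightarrow> real (card {d. d dvd t}) \<le> B"
  shows "(\<Sum>h = 1..H. (norm (type_I_part z N i (real h * \<alpha>)))\<^sup>2)
           \<le> 5677 * B ^ 3 * harm q * (real H * (real N)\<^sup>2 * E)"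
proof (cases "2 ^ i < z")
  case False
  have "(if real D < z then moebius_3mod4 D else 0) = 0" if "D \<in> {2^i..<2*2^i}" for D
  proof -
    have "(2::real) ^ i \<le> real D" using that by (metis atLeastLessThan_iff of_nat_le_iff of_nat_numeral of_nat_power)
    then have "\<not> real D < z" using False by linarith
    then show ?thesis by simp
  qed
  then have "type_I_part z N i \<beta> = 0" for \<beta> unfolding type_I_part_def by (intro sum.neutral) auto
  then show ?thesis using B E harm_nonneg[of q, where 'a = real] by simp
next
  case True
  have "(2::real) ^ i * E \<le> 1" using True E by (simp add: z field_simps)
  have "1 \<le> real N * E ^ 4" using E NH by (simp add: field_simps)
  also have "\<dots> \<le> real N * E" using E power_decreasing[of 1 4 E] by (intro mult_left_mono) auto
  finally have "1 / E \<le> real N" using E by (simp add: field_simps)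
  then have "(2::real) ^ i \<le> real N" using True z by linarith
  then have iN: "2 ^ i \<le> N" by (metis of_nat_le_iff of_nat_numeral of_nat_power)
  have "(\<Sum>h = 1..H. (norm (type_I_part z N i (real h * \<alpha>)))\<^sup>2)
      \<le> real H * real N * real (2 ^ i) + 4 * B ^ 3 * ((128 * real (2 ^ i) * real N * real H) / real q + 1)
           * (3 * real N + 8 * real q * real (2 ^ i) * harm q)"
    unfolding type_I_part_def
  proof (rule type_I_bound[OF q cop al])
    show "norm (complex_of_real (if real D < z then moebius_3mod4 D else 0)) \<le> 1" for D using abs_moebius_3mod4_le[of D] by simp
    fix t assume t: "1 \<le> t" "t \<le> 128 * 2 ^ i * N * H"
    have "128 * 2 ^ i * N * H \<le> 128 * N * N * H" using iN by (intro mult_mono) auto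
    also have "\<dots> = 128 * N\<^sup>2 * H" by (simp add: power2_eq_square)
    finally have "128 * 2 ^ i * N * H \<le> 128 * N\<^sup>2 * H" .
    from B(2)[OF t(1) order.trans[OF t(2) this]] show "real (card {d. d dvd t}) \<le> B" .
  qed (use B in auto)
  also have "\<dots> \<le> 5677 * B ^ 3 * harm q * (real H * (real N)\<^sup>2 * E)"
    using NH q E B harm_ge_1[OF q] \<open>(2::real) ^ i * E \<le> 1\<close> one_le_power[of "2::real" i]
    by (intro type_I_numeric) auto
  finally show ?thesis .
qed

text \<open>For E >= 1 the trivial bound N on each sum suffices. Otherwise z = 1/E satisfies z^3 <=
  N because 1/N <= E^4 and E < 1, and Cauchy-Schwarz over the L + L^2 pieces costs at most L^4. The
  constant exceeds 2 (5677 + 82) = 11518.\<close>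

lemma sum_norm_S_squared_le:
  fixes \<alpha> B E :: real and a :: int and q N H L :: nat
  assumes q: "q \<ge> 1" and cop: "coprime a (int q)"
    and al: "\<bar>\<alpha> - of_int a / real q\<bar> \<le> 1 / (real q)\<^sup>2"
    and NH: "N \<ge> 1" "H \<ge> 1" and L: "N + 2 < 2 ^ L"
    and E: "E = sqrt (1 / real q + 1 / sqrt (real N) + real q / (real H * (real N)\<^sup>2))"
    and B: "B \<ge> 1" "\<And>t. 1 \<le> t \<Longrightarrow> t \<le> 128 * N\<^sup>2 * H \<Longrightarrow> real (card {d. d dvd t}) \<le> B"
  shows "(\<Sum>h = 1..H. (norm (S (real h * \<alpha>) (real N)))\<^sup>2)
           \<le> 11600 * (real L ^ 4 * B ^ 4 * harm q) * (real H * (real N)\<^sup>2 * E)"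
proof -
  define X where "X = real H * (real N)\<^sup>2 * E"
  define hq where "hq = (harm q :: real)"
  have hq: "hq \<ge> 1" unfolding hq_def using q by (rule harm_ge_1)
  have L1: "L \<ge> 1" using L by (cases L) auto
  have E2: "E\<^sup>2 = 1 / real q + 1 / sqrt (real N) + real q / (real H * (real N)\<^sup>2)"
    unfolding E by (rule real_sqrt_pow2) (auto intro!: add_nonneg_nonneg)
  have E0: "E > 0" unfolding E using q by (auto intro!: add_pos_nonneg)
  have X0: "X \<ge> 0" using E0 by (simp add: X_def)
  have BL: "B ^ 4 \<ge> 1" "real L ^ 4 \<ge> 1" using B L1 by auto
  show ?thesis
  proof (cases "E < 1")
    case False
    have "(\<Sum>h = 1..H. (norm (S (real h * \<alpha>) (real N)))\<^sup>2) \<le> (\<Sum>h = 1..H. (real N)\<^sup>2)"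
      using norm_S_le by (intro sum_mono power_mono) auto
    also have "\<dots> = real H * (real N)\<^sup>2 * 1" by simp
    also have "\<dots> \<le> X" unfolding X_def using False by (intro mult_left_mono) auto
    also have "\<dots> = 1 * X" by simp
    also have "\<dots> \<le> (11600 * (real L ^ 4 * B ^ 4 * hq)) * X"
    proof (intro mult_right_mono X0)
      have "1 * 1 * 1 \<le> real L ^ 4 * B ^ 4 * hq" using BL hq by (intro mult_mono) auto
      then show "1 \<le> 11600 * (real L ^ 4 * B ^ 4 * hq)" by simp
    qed
    finally show ?thesis unfolding X_def hq_def .
  next
    case True
    define z where "z = 1 / E"
    have z1: "z > 1" using True E0 by (simp add: z_def)
    have nn: "1 / real q \<ge> 0" "1 / sqrt (real N) \<ge> 0" "real q / (real H * (real N)\<^sup>2) \<ge> 0" by auto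
    have Eb: "1 / real q \<le> E\<^sup>2" "1 / sqrt (real N) \<le> E\<^sup>2" "real q / (real H * (real N)\<^sup>2) \<le> E\<^sup>2"
      unfolding E2 using nn by linarith+
    have Eq: "real q \<le> real H * (real N)\<^sup>2 * E\<^sup>2" using Eb(3) NH by (simp add: field_simps)
    have E4: "1 / real N \<le> E ^ 4"
    proof -
      have "(1 / sqrt (real N))\<^sup>2 \<le> (E\<^sup>2)\<^sup>2" using Eb by (intro power_mono) auto
      then show ?thesis using NH by (simp add: power_divide flip: power_mult)
    qed
    have "1 \<le> real N * E ^ 4" using E4 NH by (simp add: field_simps)
    also have "\<dots> \<le> real N * E ^ 3" using True E0 power_decreasing[of 3 4 E] by (intro mult_left_mono) auto
    finally have z3: "z ^ 3 \<le> real N" using E0 by (simp add: z_def field_simps power_divide)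
    define SI where "SI = (\<lambda>h. \<Sum>i<L. type_I_part z N i (real h * \<alpha>))"
    define SII where "SII = (\<lambda>h. \<Sum>i<L. \<Sum>j<L. type_II_part z N i j (real h * \<alpha>))"
    have dec: "S (real h * \<alpha>) (real N) = SI h + SII h" for h :: nat
      unfolding SI_def SII_def by (rule S_decomposition[OF z1 z3 L])
    have I: "(\<Sum>h = 1..H. (norm (SI h))\<^sup>2) \<le> real L ^ 4 * (5677 * B ^ 4 * hq * X)"
    proof -
      have "(\<Sum>h = 1..H. (norm (SI h))\<^sup>2) \<le> (\<Sum>h = 1..H. real L * (\<Sum>i<L. (norm (type_I_part z N i (real h * \<alpha>)))\<^sup>2))"
        unfolding SI_def using norm_sum_squared_le[of _ "{..<L}"] by (intro sum_mono) auto
      also have "\<dots> = real L * (\<Sum>i<L. \<Sum>h = 1..H. (norm (type_I_part z N i (real h * \<alpha>)))\<^sup>2)"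
        by (subst sum.swap) (simp add: sum_distrib_left)
      also have "\<dots> \<le> real L * (\<Sum>i<L. 5677 * B ^ 3 * hq * X)"
        unfolding hq_def X_def using type_I_part_bound[OF q cop al NH E0 True Eb(1) E4 Eq z_def B]
        by (intro mult_left_mono sum_mono) auto
      also have "\<dots> = real L ^ 2 * (5677 * B ^ 3 * hq * X)" by (simp add: power2_eq_square)
      also have "\<dots> \<le> real L ^ 4 * (5677 * B ^ 4 * hq * X)"
        using B L1 X0 hq by (intro mult_mono power_increasing) auto
      finally show ?thesis .
    qed
    have II: "(\<Sum>h = 1..H. (norm (SII h))\<^sup>2) \<le> real L ^ 4 * (82 * B ^ 4 * hq * X)"
    proof -
      have "(norm (SII h))\<^sup>2 \<le> real L ^ 2 * (\<Sum>i<L. \<Sum>j<L. (norm (type_II_part z N i j (real h * \<alpha>)))\<^sup>2)" for h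
        using norm_sum_squared_le[of "\<lambda>(i, j). type_II_part z N i j (real h * \<alpha>)" "{..<L} \<times> {..<L}"]
        unfolding SII_def by (simp add: sum.cartesian_product case_prod_beta power2_eq_square card_cartesian_product)
      then have "(\<Sum>h = 1..H. (norm (SII h))\<^sup>2) \<le> (\<Sum>h = 1..H. real L ^ 2 * (\<Sum>i<L. \<Sum>j<L. (norm (type_II_part z N i j (real h * \<alpha>)))\<^sup>2))"
        by (intro sum_mono)
      also have "\<dots> = real L ^ 2 * (\<Sum>i<L. \<Sum>j<L. \<Sum>h = 1..H. (norm (type_II_part z N i j (real h * \<alpha>)))\<^sup>2)"
      proof -
        have "(\<Sum>h = 1..H. \<Sum>i<L. \<Sum>j<L. (norm (type_II_part z N i j (real h * \<alpha>)))\<^sup>2)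
            = (\<Sum>i<L. \<Sum>h = 1..H. \<Sum>j<L. (norm (type_II_part z N i j (real h * \<alpha>)))\<^sup>2)" by (rule sum.swap)
        also have "\<dots> = (\<Sum>i<L. \<Sum>j<L. \<Sum>h = 1..H. (norm (type_II_part z N i j (real h * \<alpha>)))\<^sup>2)"
          by (intro sum.cong refl sum.swap)
        finally show ?thesis by (simp only: sum_distrib_left[symmetric])
      qed
      also have "\<dots> \<le> real L ^ 2 * (\<Sum>i<L. \<Sum>j<L. 82 * B ^ 4 * hq * X)"
        unfolding hq_def X_def using type_II_part_bound[OF q cop al NH E0 True Eb(1,2) Eq z_def B]
        by (intro mult_left_mono sum_mono) auto
      also have "\<dots> = real L ^ 4 * (82 * B ^ 4 * hq * X)" by (simp add: power2_eq_square power4_eq_xxxx)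
      finally show ?thesis .
    qed
    have "(\<Sum>h = 1..H. (norm (S (real h * \<alpha>) (real N)))\<^sup>2) \<le> (\<Sum>h = 1..H. 2 * (norm (SI h))\<^sup>2 + 2 * (norm (SII h))\<^sup>2)"
    proof (rule sum_mono)
      fix h
      have "(norm (SI h + SII h))\<^sup>2 \<le> (norm (SI h) + norm (SII h))\<^sup>2" by (intro power_mono norm_triangle_ineq) auto
      also have "\<dots> \<le> 2 * (norm (SI h))\<^sup>2 + 2 * (norm (SII h))\<^sup>2"
        using zero_le_power2[of "norm (SI h) - norm (SII h)"] by (simp add: power2_eq_square algebra_simps)
      finally show "(norm (S (real h * \<alpha>) (real N)))\<^sup>2 \<le> 2 * (norm (SI h))\<^sup>2 + 2 * (norm (SII h))\<^sup>2" unfolding dec .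
    qed
    also have "\<dots> = 2 * (\<Sum>h = 1..H. (norm (SI h))\<^sup>2) + 2 * (\<Sum>h = 1..H. (norm (SII h))\<^sup>2)"
      by (simp add: sum.distrib sum_distrib_left)
    also have "\<dots> \<le> 11518 * (real L ^ 4 * B ^ 4 * hq * X)" using I II by (simp add: algebra_simps)
    also have "\<dots> \<le> 11600 * (real L ^ 4 * B ^ 4 * hq * X)" using X0 B hq by (intro mult_right_mono) auto
    finally show ?thesis unfolding X_def hq_def by (simp add: mult.assoc)
  qed
qed

section \<open>Passage from H <= 2q to all H by positivity\<close>

lemma norm_S_squared_eq:
  "(norm (S \<theta> (real N)))\<^sup>2 = (\<Sum>n = 1..N. \<Sum>m = 1..N. b n * b m * Re (e (((real n)\<^sup>2 - (real m)\<^sup>2) * \<theta>)))"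
proof -
  have "complex_of_real ((norm (S \<theta> (real N)))\<^sup>2) = S \<theta> (real N) * cnj (S \<theta> (real N))" by (rule complex_norm_square)
  also have "\<dots> = (\<Sum>n = 1..N. \<Sum>m = 1..N. of_real (b n * b m) * e (((real n)\<^sup>2 - (real m)\<^sup>2) * \<theta>))"
  proof -
    have "e (((real n)\<^sup>2 - (real m)\<^sup>2) * \<theta>) = e ((real n)\<^sup>2 * \<theta>) * e (- ((real m)\<^sup>2 * \<theta>))" for n m :: nat
      by (simp add: left_diff_distrib flip: e_add)
    then show ?thesis unfolding S_def floor_of_nat nat_int cnj_sum sum_product
      by (intro sum.cong refl) (simp add: cnj_e)
  qed
  finally have "(norm (S \<theta> (real N)))\<^sup>2 = Re (\<Sum>n = 1..N. \<Sum>m = 1..N. of_real (b n * b m) * e (((real n)\<^sup>2 - (real m)\<^sup>2) * \<theta>))"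
    by (metis Re_complex_of_real)
  then show ?thesis by simp
qed

lemma norm_S_minus: "norm (S (- \<theta>) (real N)) = norm (S \<theta> (real N))"
proof -
  have "S (- \<theta>) (real N) = cnj (S \<theta> (real N))" by (simp add: S_def cnj_e)
  then show ?thesis by simp
qed

text \<open>The Fourier coefficients of \<open>\<bar>S\<bar>\<^sup>2\<close> are nonnegative because \<open>b \<ge> 0\<close>, so this average over
  differences is largest when it is centred at \<open>0\<close>.\<close>
lemma sum_norm_S_squared_shift_le:
  "(\<Sum>i<K. \<Sum>j<K. (norm (S (\<theta> + (real i - real j) * \<alpha>) (real N)))\<^sup>2)
     \<le> (\<Sum>i<K. \<Sum>j<K. (norm (S ((real i - real j) * \<alpha>) (real N)))\<^sup>2)"
proof -
  define d where "d = (\<lambda>n m :: nat. (real n)\<^sup>2 - (real m)\<^sup>2)"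
  \<comment> \<open>Averaging over all differences i - j multiplies the coefficient at frequency
    \<open>d n m\<close> by the Fejer weight (norm (g n m))^2. As this weight is nonnegative, every
    term is maximal at theta = 0.\<close>
  define g where "g = (\<lambda>n m. \<Sum>i<K. e (d n m * (real i * \<alpha>)))"
  have eq: "(\<Sum>i<K. \<Sum>j<K. (norm (S (\<theta> + (real i - real j) * \<alpha>) (real N)))\<^sup>2)
      = (\<Sum>n = 1..N. \<Sum>m = 1..N. b n * b m * ((norm (g n m))\<^sup>2 * Re (e (d n m * \<theta>))))" for \<theta>
  proof -
    have 1: "(\<Sum>i<K. \<Sum>j<K. Re (e (d n m * (\<theta> + (real i - real j) * \<alpha>)))) = (norm (g n m))\<^sup>2 * Re (e (d n m * \<theta>))" for n m
    proof -
      have "(\<Sum>i<K. \<Sum>j<K. e (d n m * (\<theta> + (real i - real j) * \<alpha>))) = e (d n m * \<theta>) * (g n m * cnj (g n m))"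
      proof -
        have "g n m * cnj (g n m) = (\<Sum>i<K. \<Sum>j<K. e (d n m * (real i * \<alpha>)) * e (- (d n m * (real j * \<alpha>))))"
          unfolding g_def cnj_sum sum_product by (simp only: cnj_e)
        then show ?thesis unfolding sum_distrib_left
          by (simp only: sum_distrib_left) (intro sum.cong refl, simp add: algebra_simps flip: e_add)
      qed
      also have "g n m * cnj (g n m) = of_real ((norm (g n m))\<^sup>2)" by (rule complex_norm_square[symmetric])
      finally have "Re (\<Sum>i<K. \<Sum>j<K. e (d n m * (\<theta> + (real i - real j) * \<alpha>))) = (norm (g n m))\<^sup>2 * Re (e (d n m * \<theta>))"
        by simp
      then show ?thesis by simp
    qed
    have "(\<Sum>i<K. \<Sum>j<K. (norm (S (\<theta> + (real i - real j) * \<alpha>) (real N)))\<^sup>2)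
        = (\<Sum>i<K. \<Sum>j<K. \<Sum>n = 1..N. \<Sum>m = 1..N. b n * b m * Re (e (d n m * (\<theta> + (real i - real j) * \<alpha>))))"
      by (simp only: norm_S_squared_eq d_def)
    also have "\<dots> = (\<Sum>i<K. \<Sum>n = 1..N. \<Sum>j<K. \<Sum>m = 1..N. b n * b m * Re (e (d n m * (\<theta> + (real i - real j) * \<alpha>))))"
      by (intro sum.cong refl sum.swap)
    also have "\<dots> = (\<Sum>n = 1..N. \<Sum>i<K. \<Sum>j<K. \<Sum>m = 1..N. b n * b m * Re (e (d n m * (\<theta> + (real i - real j) * \<alpha>))))"
      by (rule sum.swap)
    also have "\<dots> = (\<Sum>n = 1..N. \<Sum>i<K. \<Sum>m = 1..N. \<Sum>j<K. b n * b m * Re (e (d n m * (\<theta> + (real i - real j) * \<alpha>))))"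
      by (intro sum.cong refl sum.swap)
    also have "\<dots> = (\<Sum>n = 1..N. \<Sum>m = 1..N. \<Sum>i<K. \<Sum>j<K. b n * b m * Re (e (d n m * (\<theta> + (real i - real j) * \<alpha>))))"
      by (intro sum.cong refl sum.swap)
    also have "\<dots> = (\<Sum>n = 1..N. \<Sum>m = 1..N. b n * b m * ((norm (g n m))\<^sup>2 * Re (e (d n m * \<theta>))))"
      unfolding sum_distrib_left[symmetric] 1 ..
    finally show ?thesis .
  qed
  have "(\<Sum>n = 1..N. \<Sum>m = 1..N. b n * b m * ((norm (g n m))\<^sup>2 * Re (e (d n m * \<theta>))))
      \<le> (\<Sum>n = 1..N. \<Sum>m = 1..N. b n * b m * ((norm (g n m))\<^sup>2 * Re (e (d n m * 0))))"
  proof (intro sum_mono mult_left_mono)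
    fix n m
    show "Re (e (d n m * \<theta>)) \<le> Re (e (d n m * 0))"
      using complex_Re_le_cmod[of "e (d n m * \<theta>)"] by simp
  qed (auto simp: b_def)
  then show ?thesis unfolding eq[symmetric] using eq[of 0] by simp
qed

text \<open>In the 2q by 2q array of shifted differences i - j, each row j < q contains the whole
  block as i = j + h, so the array dominates q copies of it. Recentring at 0 does not decrease the
  array, and each of its 2q rows is then at most N^2 for i = j plus one mean square over h <= 2q for
  each sign of i - j. Division by q gives the bound.\<close>

lemma sum_norm_S_squared_block_le:
  assumes "q \<ge> 1"
  shows "(\<Sum>h<q. (norm (S ((real h0 + real h) * \<alpha>) (real N)))\<^sup>2)
     \<le> 2 * (real N)\<^sup>2 + 4 * (\<Sum>h = 1..2*q. (norm (S (real h * \<alpha>) (real N)))\<^sup>2)"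
proof -
  define F where "F = (\<lambda>\<theta>. (norm (S \<theta> (real N)))\<^sup>2)"
  have F0: "F \<theta> \<ge> 0" for \<theta> by (simp add: F_def)
  have Fm: "F (- \<theta>) = F \<theta>" for \<theta> by (simp add: F_def norm_S_minus)
  define M where "M = (\<Sum>h = 1..2*q. F (real h * \<alpha>))"
  have FN: "F 0 \<le> (real N)\<^sup>2" unfolding F_def by (intro power_mono norm_S_le) auto
  have up: "(\<Sum>i<2*q. F ((real i - real j) * \<alpha>)) \<le> (real N)\<^sup>2 + 2 * M" if j: "j < 2 * q" for j
  proof -
    have "{..<2*q} = {..<j} \<union> ({j} \<union> {j<..<2*q})" using j by auto
    then have "(\<Sum>i<2*q. F ((real i - real j) * \<alpha>)) = (\<Sum>i\<in>{..<j} \<union> ({j} \<union> {j<..<2*q}). F ((real i - real j) * \<alpha>))" by simp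
    also have "\<dots> = (\<Sum>i<j. F ((real i - real j) * \<alpha>)) + (\<Sum>i\<in>{j} \<union> {j<..<2*q}. F ((real i - real j) * \<alpha>))"
      by (rule sum.union_disjoint) auto
    also have "(\<Sum>i\<in>{j} \<union> {j<..<2*q}. F ((real i - real j) * \<alpha>)) = F 0 + (\<Sum>i\<in>{j<..<2*q}. F ((real i - real j) * \<alpha>))"
      by (subst sum.union_disjoint) auto
    also have "(\<Sum>i<j. F ((real i - real j) * \<alpha>)) = (\<Sum>h = 1..j. F (real h * \<alpha>))"
    proof (rule sum.reindex_bij_witness[where i = "\<lambda>h. j - h" and j = "\<lambda>i. j - i"])
      fix i assume "i \<in> {..<j}"
      then have "(real i - real j) * \<alpha> = - (real (j - i) * \<alpha>)" by (simp add: of_nat_diff algebra_simps)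
      then show "F (real (j - i) * \<alpha>) = F ((real i - real j) * \<alpha>)" using Fm by simp
    qed auto
    also have "\<dots> \<le> M" unfolding M_def using j F0 by (intro sum_mono2) auto
    also have "(\<Sum>i\<in>{j<..<2*q}. F ((real i - real j) * \<alpha>)) = (\<Sum>h\<in>{1..<2*q-j}. F (real h * \<alpha>))"
      by (rule sum.reindex_bij_witness[where i = "\<lambda>h. h + j" and j = "\<lambda>i. i - j"]) (auto simp: of_nat_diff)
    also have "\<dots> \<le> M" unfolding M_def using F0 by (intro sum_mono2) auto
    finally show ?thesis using FN by linarith
  qed
  have "real q * (\<Sum>h<q. F ((real h0 + real h) * \<alpha>)) = (\<Sum>j<q. \<Sum>h<q. F ((real h0 + real h) * \<alpha>))" by simp
  also have "\<dots> \<le> (\<Sum>j<2*q. \<Sum>i<2*q. F (real h0 * \<alpha> + (real i - real j) * \<alpha>))"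
  proof -
    have "(\<Sum>h<q. F ((real h0 + real h) * \<alpha>)) \<le> (\<Sum>i<2*q. F (real h0 * \<alpha> + (real i - real j) * \<alpha>))" if "j < q" for j
    proof -
      have "(\<Sum>h<q. F ((real h0 + real h) * \<alpha>)) = (\<Sum>i\<in>{j..<j+q}. F (real h0 * \<alpha> + (real i - real j) * \<alpha>))"
        by (rule sum.reindex_bij_witness[where i = "\<lambda>i. i - j" and j = "\<lambda>h. h + j"]) (auto simp: algebra_simps)
      also have "\<dots> \<le> (\<Sum>i<2*q. F (real h0 * \<alpha> + (real i - real j) * \<alpha>))"
        using that F0 by (intro sum_mono2) auto
      finally show ?thesis .
    qed
    then have "(\<Sum>j<q. \<Sum>h<q. F ((real h0 + real h) * \<alpha>)) \<le> (\<Sum>j<q. \<Sum>i<2*q. F (real h0 * \<alpha> + (real i - real j) * \<alpha>))"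
      by (intro sum_mono) auto
    also have "\<dots> \<le> (\<Sum>j<2*q. \<Sum>i<2*q. F (real h0 * \<alpha> + (real i - real j) * \<alpha>))"
      using F0 by (intro sum_mono2) (auto intro: sum_nonneg)
    finally show ?thesis .
  qed
  also have "\<dots> = (\<Sum>i<2*q. \<Sum>j<2*q. F (real h0 * \<alpha> + (real i - real j) * \<alpha>))" by (rule sum.swap)
  also have "\<dots> \<le> (\<Sum>i<2*q. \<Sum>j<2*q. F ((real i - real j) * \<alpha>))"
    unfolding F_def by (rule sum_norm_S_squared_shift_le)
  also have "\<dots> = (\<Sum>j<2*q. \<Sum>i<2*q. F ((real i - real j) * \<alpha>))" by (rule sum.swap)
  also have "\<dots> \<le> (\<Sum>j<2*q. (real N)\<^sup>2 + 2 * M)" using up by (intro sum_mono) auto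
  also have "\<dots> = real q * (2 * (real N)\<^sup>2 + 4 * M)" by (simp add: algebra_simps)
  finally show ?thesis using assms unfolding F_def M_def by simp
qed

text \<open>The divisor bound is required only up to 256 N^2 q, free of H. For H > 2q the range of h
  is cut into at most 2 H / q blocks of length q, each compared with the mean square over h <=
  2q.\<close>

lemma sum_norm_S_squared_le_all:
  fixes \<alpha> B E :: real and a :: int and q N H L :: nat
  assumes q: "q \<ge> 1" and cop: "coprime a (int q)"
    and al: "\<bar>\<alpha> - of_int a / real q\<bar> \<le> 1 / (real q)\<^sup>2"
    and NH: "N \<ge> 1" "H \<ge> 1" and L: "N + 2 < 2 ^ L"
    and E: "E = sqrt (1 / real q + 1 / sqrt (real N) + real q / (real H * (real N)\<^sup>2))"
    and B: "B \<ge> 1" "\<And>t. 1 \<le> t \<Longrightarrow> t \<le> 256 * N\<^sup>2 * q \<Longrightarrow> real (card {d. d dvd t}) \<le> B"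
  shows "(\<Sum>h = 1..H. (norm (S (real h * \<alpha>) (real N)))\<^sup>2)
           \<le> 400000 * (real L ^ 4 * B ^ 4 * harm q) * (real H * (real N)\<^sup>2 * E)"
proof -
  define Y where "Y = real L ^ 4 * B ^ 4 * harm q"
  have L1: "L \<ge> 1" using L by (cases L) auto
  have "1 * 1 * 1 \<le> Y" unfolding Y_def using B L1 harm_ge_1[OF q] by (intro mult_mono) auto
  then have Y1: "Y \<ge> 1" by simp
  have E2: "E\<^sup>2 = 1 / real q + 1 / sqrt (real N) + real q / (real H * (real N)\<^sup>2)"
    unfolding E by (rule real_sqrt_pow2) (auto intro!: add_nonneg_nonneg)
  have E0: "E \<ge> 0" unfolding E by (auto intro!: add_nonneg_nonneg)
  have B': "real (card {d. d dvd t}) \<le> B" if "1 \<le> t" "t \<le> 128 * N\<^sup>2 * K" "K \<le> 2 * q" for t K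
  proof -
    have "128 * N\<^sup>2 * K \<le> 128 * N\<^sup>2 * (2 * q)" using that(3) by (intro mult_left_mono) auto
    also have "\<dots> = 256 * N\<^sup>2 * q" by simp
    finally have "128 * N\<^sup>2 * K \<le> 256 * N\<^sup>2 * q" .
    from B(2)[OF that(1) order.trans[OF that(2) this]] show ?thesis .
  qed
  show ?thesis
  proof (cases "H \<le> 2 * q")
    case True
    have "(\<Sum>h = 1..H. (norm (S (real h * \<alpha>) (real N)))\<^sup>2) \<le> 11600 * Y * (real H * (real N)\<^sup>2 * E)"
      unfolding Y_def using B' True by (intro sum_norm_S_squared_le[OF q cop al NH L E B(1)]) auto
    also have "\<dots> \<le> 400000 * Y * (real H * (real N)\<^sup>2 * E)" using Y1 E0 by (intro mult_right_mono) auto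
    finally show ?thesis unfolding Y_def .
  next
    case False
    \<comment> \<open>This is E with H replaced by 2q. Its last summand is 1 / (2 N^2), below the
      summand 1 / sqrt N that E already has, so the replacement costs at most a factor 2.\<close>
    define E' where "E' = sqrt (1 / real q + 1 / sqrt (real N) + real q / (real (2 * q) * (real N)\<^sup>2))"
    have w: "real q / (real (2 * q) * (real N)\<^sup>2) \<le> 1 / sqrt (real N)"
    proof -
      have "sqrt (real N) * 1 \<le> sqrt (real N) * sqrt (real N)" using NH by (intro mult_left_mono) auto
      then have "sqrt (real N) \<le> real N" by simp
      also have "\<dots> \<le> (real N)\<^sup>2" using NH by (simp add: power2_eq_square)
      finally have "1 / (real N)\<^sup>2 \<le> 1 / sqrt (real N)" using NH by (intro divide_left_mono mult_pos_pos) auto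
      moreover have "real q / (real (2 * q) * (real N)\<^sup>2) = 1 / 2 * (1 / (real N)\<^sup>2)" using q by simp
      moreover have "1 / (real N)\<^sup>2 \<ge> 0" by simp
      ultimately show ?thesis by linarith
    qed
    have nn: "1 / real q \<ge> 0" "1 / sqrt (real N) \<ge> 0" "real q / (real H * (real N)\<^sup>2) \<ge> 0" by auto
    have "x + y + w' \<le> 4 * (x + y + w)" if "w' \<le> y" "x \<ge> 0" "y \<ge> 0" "w \<ge> 0" for x y w w' :: real
      using that unfolding distrib_left by linarith
    from this[OF w nn] have "1 / real q + 1 / sqrt (real N) + real q / (real (2 * q) * (real N)\<^sup>2) \<le> 4 * E\<^sup>2"
      unfolding E2 .
    also have "4 * E\<^sup>2 = (2 * E)\<^sup>2" by (simp add: power_mult_distrib)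
    finally have E': "E' \<le> 2 * E" unfolding E'_def using E0 by (intro real_le_lsqrt) auto
    \<comment> \<open>Each block carries a term 2 N^2 from h = 0; over 2 H / q blocks this is 4 H
      N^2 / q, absorbed by this inequality.\<close>
    have qE: "1 / real q \<le> E"
    proof -
      have "(1 / real q)\<^sup>2 \<le> 1 / real q" using q by (simp add: power2_eq_square divide_simps)
      then have "(1 / real q)\<^sup>2 \<le> E\<^sup>2" unfolding E2 using nn by linarith
      then show ?thesis using E0 by (rule power2_le_imp_le)
    qed
    define M where "M = (\<Sum>h = 1..2*q. (norm (S (real h * \<alpha>) (real N)))\<^sup>2)"
    have "M \<le> 11600 * Y * (real (2 * q) * (real N)\<^sup>2 * E')"
      unfolding M_def Y_def
    proof (rule sum_norm_S_squared_le[OF q cop al NH(1) _ L E'_def B(1)])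
      fix t assume "1 \<le> t" "t \<le> 128 * N\<^sup>2 * (2 * q)"
      then show "real (card {d. d dvd t}) \<le> B" by (rule B'[OF _ _ order.refl])
    qed (use q in simp)
    also have "\<dots> \<le> 11600 * Y * (real (2 * q) * (real N)\<^sup>2 * (2 * E))"
      using E' Y1 by (intro mult_left_mono) auto
    finally have M: "M \<le> 46400 * Y * (real q * (real N)\<^sup>2 * E)" by simp
    define m where "m = H div q + 1"
    have Hm: "H < m * q" unfolding m_def using q
      by (metis Suc_eq_plus1 div_less_iff_less_mult less_Suc_eq less_le_trans zero_less_one)
    have "real m \<le> real H / real q + 1" unfolding m_def by (simp add: of_nat_div_le_of_nat)
    also have "1 \<le> real H / real q" using False q by (simp add: field_simps)
    finally have m: "real m \<le> 2 * (real H / real q)" by simp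
    have "(\<Sum>h = 1..H. (norm (S (real h * \<alpha>) (real N)))\<^sup>2) \<le> (\<Sum>h<m * q. (norm (S (real h * \<alpha>) (real N)))\<^sup>2)"
      using Hm by (intro sum_mono2) auto
    also have "\<dots> = (\<Sum>j<m. \<Sum>h = j * q..<j * q + q. (norm (S (real h * \<alpha>) (real N)))\<^sup>2)"
      by (rule sum.nat_group[symmetric])
    also have "\<dots> \<le> (\<Sum>j<m. 2 * (real N)\<^sup>2 + 4 * M)"
    proof (rule sum_mono)
      fix j
      have "(\<Sum>h = j * q..<j * q + q. (norm (S (real h * \<alpha>) (real N)))\<^sup>2)
          = (\<Sum>i<q. (norm (S ((real (j * q) + real i) * \<alpha>) (real N)))\<^sup>2)"
        by (rule sum.reindex_bij_witness[where i = "\<lambda>i. j * q + i" and j = "\<lambda>t. t - j * q"]) auto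
      also have "\<dots> \<le> 2 * (real N)\<^sup>2 + 4 * M" unfolding M_def by (rule sum_norm_S_squared_block_le[OF q])
      finally show "(\<Sum>h = j * q..<j * q + q. (norm (S (real h * \<alpha>) (real N)))\<^sup>2) \<le> 2 * (real N)\<^sup>2 + 4 * M" .
    qed
    also have "\<dots> = real m * (2 * (real N)\<^sup>2 + 4 * M)" by simp
    also have "\<dots> \<le> (2 * (real H / real q)) * (2 * (real N)\<^sup>2 + 4 * (46400 * Y * (real q * (real N)\<^sup>2 * E)))"
    proof -
      have "M \<ge> 0" unfolding M_def by (simp add: sum_nonneg)
      then have "2 * (real N)\<^sup>2 + 4 * M \<ge> 0" by simp
      moreover have "2 * (real N)\<^sup>2 + 4 * M \<le> 2 * (real N)\<^sup>2 + 4 * (46400 * Y * (real q * (real N)\<^sup>2 * E))"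
        by (intro add_left_mono mult_left_mono M) simp
      ultimately show ?thesis using m by (intro mult_mono) simp_all
    qed
    \<comment> \<open>The constant is 371200 = 2 * 4 * 46400, where 46400 = 11600 * 2 * 2 accounts
      for H = 2q and for E' <= 2 E.\<close>
    also have "\<dots> = 4 * (real H * (real N)\<^sup>2) * (1 / real q) + 371200 * (Y * (real H * (real N)\<^sup>2 * E))"
      using q by (simp add: field_simps)
    also have "\<dots> \<le> 4 * (real H * (real N)\<^sup>2) * E + 371200 * (Y * (real H * (real N)\<^sup>2 * E))"
      using qE by (intro add_right_mono mult_left_mono) auto
    also have "4 * (real H * (real N)\<^sup>2) * E = 4 * (1 * (real H * (real N)\<^sup>2 * E))" by simp
    also have "\<dots> \<le> 4 * (Y * (real H * (real N)\<^sup>2 * E))"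
      using Y1 E0 by (intro mult_left_mono mult_right_mono) auto
    finally have "(\<Sum>h = 1..H. (norm (S (real h * \<alpha>) (real N)))\<^sup>2) \<le> 371204 * (Y * (real H * (real N)\<^sup>2 * E))"
      by (simp add: mult_ac)
    also have "\<dots> \<le> 400000 * (Y * (real H * (real N)\<^sup>2 * E))" using Y1 E0 by (intro mult_right_mono) auto
    finally show ?thesis unfolding Y_def by (simp add: mult.assoc)
  qed
qed

section \<open>Proof of the theorem\<close>

lemma harm_le: "q \<ge> 1 \<Longrightarrow> harm q \<le> 1 + ln (real q)"
proof -
  assume q: "q \<ge> 1"
  then obtain n where n: "q = Suc n" by (cases q) auto
  have "harm (Suc n) - ln (real (Suc n)) \<le> harm (Suc 0) - ln (real (Suc 0))"
    using decseq_harm_diff_ln[unfolded decseq_def, rule_format, of 0 n] by simp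
  then show ?thesis by (simp add: n harm_def)
qed

text \<open>Gathers all factors of subpolynomial size before the last square root is taken, hence
  the exponent 2 epsilon; ln N is the square of the normalising factor of the theorem, and M will be
  the integer part of N.\<close>

lemma epsilon_bound:
  fixes \<epsilon> :: real
  assumes "\<epsilon> > 0"
  shows "\<exists>C>0. \<forall>(N::real) (M::nat) (q::nat). N \<ge> 2 \<longrightarrow> M \<ge> 1 \<longrightarrow> real M \<le> N \<longrightarrow> q \<ge> 1 \<longrightarrow>
    (\<exists>(L::nat) B. M + 2 < 2 ^ L \<and> B \<ge> 1 \<and> (\<forall>t. 1 \<le> t \<longrightarrow> t \<le> 256 * M\<^sup>2 * q \<longrightarrow> real (card {d. d dvd t}) \<le> B) \<and>
       ln N * (real L ^ 4 * B ^ 4 * harm q) \<le> C * (N * real q) powr (2 * \<epsilon>))"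
proof -
  \<comment> \<open>With Y = (N q)^delta, each of ln N, L and the harmonic number is O(Y), and B is
    O(Y^2) because t <= 256 (N q)^2. The product has 1 + 4 + 8 + 1 = 14 powers of Y, and 14 delta =
    2 epsilon.\<close>
  define \<delta> where "\<delta> = \<epsilon> / 7"
  have d: "\<delta> > 0" using assms by (simp add: \<delta>_def)
  obtain C where C: "C \<ge> 1" "\<And>n::nat. n > 0 \<Longrightarrow> real (card {d. d dvd n}) \<le> C * real n powr \<delta>"
    using divisor_bound[OF d] by blast
  define c1 where "c1 = 1 / \<delta>"
  define c2 where "c2 = 4 + 1 / (\<delta> * ln 2)"
  define c3 where "c3 = C * 256 powr \<delta>"
  define c4 where "c4 = 1 + 1 / \<delta>"
  have cpos: "c1 > 0" "c2 > 0" "c3 > 0" "c4 > 0" using d C by (auto simp: c1_def c2_def c3_def c4_def intro!: add_pos_nonneg)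
  have main: "\<exists>(L::nat) B. M + 2 < 2 ^ L \<and> B \<ge> 1 \<and> (\<forall>t. 1 \<le> t \<longrightarrow> t \<le> 256 * M\<^sup>2 * q \<longrightarrow> real (card {d. d dvd t}) \<le> B) \<and>
       ln N * (real L ^ 4 * B ^ 4 * harm q) \<le> (c1 * (c2 ^ 4 * c3 ^ 4 * c4)) * (N * real q) powr (2 * \<epsilon>)"
    if NM: "N \<ge> 2" "M \<ge> 1" "real M \<le> N" and q: "q \<ge> 1" for N :: real and M q :: nat
  proof -
    define Y where "Y = (N * real q) powr \<delta>"
    have Nq: "N \<le> N * real q" "real q \<le> N * real q" "N * real q \<ge> 1"
    proof -
      have "N * 1 \<le> N * real q" using NM q by (intro mult_left_mono) auto
      then show "N \<le> N * real q" by simp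
      then show "N * real q \<ge> 1" using NM by linarith
      have "1 * real q \<le> N * real q" using NM by (intro mult_right_mono) auto
      then show "real q \<le> N * real q" by simp
    qed
    have Y1: "Y \<ge> 1" unfolding Y_def using Nq d by (intro ge_one_powr_ge_zero) auto
    have NY: "N powr \<delta> \<le> Y" unfolding Y_def using Nq NM d by (intro powr_mono2) auto
    have qY: "real q powr \<delta> \<le> Y" unfolding Y_def using Nq d by (intro powr_mono2) auto
    have lnN: "ln N \<le> c1 * Y"
    proof -
      have "ln N \<le> N powr \<delta> / \<delta>" using NM d by (intro ln_powr_bound) auto
      also have "\<dots> \<le> Y / \<delta>" using NY d by (intro divide_right_mono) auto
      finally show ?thesis by (simp add: c1_def)
    qed
    define L where "L = nat \<lceil>log 2 (N + 3)\<rceil>"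
    have L_ge: "log 2 (N + 3) \<le> real L" unfolding L_def by linarith
    have "N + 3 = 2 powr (log 2 (N + 3))" using NM by simp
    also have "\<dots> \<le> 2 powr (real L)" using L_ge by (intro powr_mono) auto
    also have "\<dots> = 2 ^ L" by (simp add: powr_realpow)
    finally have "real (M + 2) < 2 ^ L" using NM by simp
    then have M_less: "M + 2 < 2 ^ L" by (metis of_nat_less_iff of_nat_numeral of_nat_power)
    have L_le: "real L \<le> c2 * Y"
    proof -
      have "log 2 (N + 3) \<ge> 0" using NM by simp
      then have "real L \<le> log 2 (N + 3) + 1" unfolding L_def by linarith
      also have "log 2 (N + 3) \<le> log 2 (4 * N)" using NM by simp
      also have "log 2 (4 * N) = 2 + ln N / ln 2"
      proof -
        have "ln (4::real) = 2 * ln 2" using ln_realpow[of 2 2] by simp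
        then show ?thesis using NM by (simp add: log_def ln_mult add_divide_distrib)
      qed
      also have "ln N / ln 2 \<le> (c1 * Y) / ln 2" using lnN by (intro divide_right_mono) auto
      finally have "real L \<le> 3 + 1 / (\<delta> * ln 2) * Y" by (simp add: c1_def mult_ac)
      also have "\<dots> \<le> 4 * Y + 1 / (\<delta> * ln 2) * Y" using Y1 by simp
      finally show ?thesis by (simp add: c2_def algebra_simps)
    qed
    define B where "B = c3 * Y\<^sup>2"
    have c31: "c3 \<ge> 1"
    proof -
      have "1 * 1 \<le> C * 256 powr \<delta>" using C d by (intro mult_mono ge_one_powr_ge_zero) auto
      then show ?thesis by (simp add: c3_def)
    qed
    have B1: "B \<ge> 1"
    proof -
      have "1 * 1 \<le> c3 * Y\<^sup>2" using c31 Y1 by (intro mult_mono) auto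
      then show ?thesis by (simp add: B_def)
    qed
    have B: "real (card {d. d dvd t}) \<le> B" if t: "1 \<le> t" "t \<le> 256 * M\<^sup>2 * q" for t
    proof -
      have "real t \<le> real (256 * M\<^sup>2 * q)" using t by (simp only: of_nat_le_iff)
      also have "\<dots> = 256 * ((real M)\<^sup>2 * real q)" by simp
      also have "\<dots> \<le> 256 * (N\<^sup>2 * real q)" using NM by (intro mult_left_mono mult_right_mono power_mono) auto
      also have "\<dots> = 256 * (N * (N * real q))" by (simp add: power2_eq_square)
      also have "\<dots> \<le> 256 * ((N * real q) * (N * real q))" using Nq NM by (intro mult_left_mono mult_right_mono) auto
      finally have "real t powr \<delta> \<le> (256 * ((N * real q) * (N * real q))) powr \<delta>" using d by (intro powr_mono2) auto
      also have "\<dots> = 256 powr \<delta> * Y\<^sup>2" unfolding Y_def using NM by (simp add: powr_mult power2_eq_square)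
      finally have "C * real t powr \<delta> \<le> C * (256 powr \<delta> * Y\<^sup>2)" using C by (intro mult_left_mono) auto
      then show ?thesis using C(2)[of t] t unfolding B_def c3_def by (simp add: mult.assoc)
    qed
    have hq: "harm q \<le> c4 * Y"
    proof -
      have "harm q \<le> 1 + ln (real q)" using q by (rule harm_le)
      also have "ln (real q) \<le> real q powr \<delta> / \<delta>" using q d by (intro ln_powr_bound) auto
      also have "\<dots> \<le> Y / \<delta>" using qY d by (intro divide_right_mono) auto
      also have "1 + Y / \<delta> \<le> Y + Y / \<delta>" using Y1 by simp
      finally show ?thesis by (simp add: c4_def algebra_simps)
    qed
    have "ln N * (real L ^ 4 * B ^ 4 * harm q) \<le> (c1 * Y) * ((c2 * Y) ^ 4 * (c3 * Y\<^sup>2) ^ 4 * (c4 * Y))"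
      using lnN L_le hq cpos Y1 NM B1 harm_nonneg[of q, where 'a = real] unfolding B_def
      by (intro mult_mono power_mono mult_nonneg_nonneg) auto
    also have "\<dots> = (c1 * (c2 ^ 4 * c3 ^ 4 * c4)) * (Y * Y ^ 4 * (Y\<^sup>2) ^ 4 * Y)"
      by (simp add: power_mult_distrib mult_ac)
    also have "Y * Y ^ 4 * (Y\<^sup>2) ^ 4 * Y = Y ^ 14" by (simp add: power_mult[symmetric] power_Suc[symmetric] power_add[symmetric] mult.commute[of _ Y])
    also have "Y ^ 14 = (N * real q) powr (2 * \<epsilon>)"
    proof -
      have "Y ^ 14 = Y powr 14" using powr_realpow[of Y 14] Y1 by simp
      also have "\<dots> = (N * real q) powr (\<delta> * 14)" unfolding Y_def by (simp add: powr_powr)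
      also have "\<delta> * 14 = 2 * \<epsilon>" by (simp add: \<delta>_def)
      finally show ?thesis .
    qed
    finally show ?thesis using M_less B1 B by blast
  qed
  moreover have "c1 * (c2 ^ 4 * c3 ^ 4 * c4) > 0" using cpos by simp
  ultimately show ?thesis by blast
qed

lemma sqrt_sqrt_add3_le:
  fixes x y w :: real
  assumes "x \<ge> 0" "y \<ge> 0" "w \<ge> 0"
  shows "sqrt (sqrt (x + y + w)) \<le> sqrt (sqrt x) + sqrt (sqrt y) + sqrt (sqrt w)"
proof -
  have 2: "sqrt (sqrt (x + y)) \<le> sqrt (sqrt x) + sqrt (sqrt y)" if "x \<ge> 0" "y \<ge> 0" for x y :: real
  proof -
    have "sqrt (sqrt (x + y)) \<le> sqrt (sqrt x + sqrt y)" using that by (simp add: sqrt_add_le_add_sqrt)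
    also have "\<dots> \<le> sqrt (sqrt x) + sqrt (sqrt y)" using that by (intro sqrt_add_le_add_sqrt) auto
    finally show ?thesis .
  qed
  have "sqrt (sqrt ((x + y) + w)) \<le> sqrt (sqrt (x + y)) + sqrt (sqrt w)" using assms by (intro 2) auto
  also have "\<dots> \<le> sqrt (sqrt x) + sqrt (sqrt y) + sqrt (sqrt w)" using 2[of x y] assms by simp
  finally show ?thesis .
qed

lemma sqrt_sqrt_eq_powr: "x \<ge> 0 \<Longrightarrow> sqrt (sqrt x) = x powr (1/4)"
  by (simp add: powr_half_sqrt[symmetric] powr_powr)

theorem theorem1p2:
  fixes \<epsilon> :: real
  assumes "\<epsilon> > 0"
  shows "\<exists>C>0. \<forall>(\<alpha>::real) (a::int) (q::int) (N::real) (H::real).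
           q \<ge> 1 \<longrightarrow> coprime a q \<longrightarrow>
           \<bar>\<alpha> - real_of_int a / real_of_int q\<bar> < 1 / (real_of_int q)\<^sup>2 \<longrightarrow>
           N \<ge> 2 \<longrightarrow> H \<ge> 1 \<longrightarrow>
           sqrt (ln N) / N * (\<Sum>h = 1..nat \<lfloor>H\<rfloor>. norm (S (real h * \<alpha>) N))
             \<le> C * (H * (N * real_of_int q) powr \<epsilon> *
                  (real_of_int q powr (-1/4) + N powr (-1/8)
                   + H powr (-1/4) * N powr (-1/2) * real_of_int q powr (1/4)))"
proof -
  obtain C where C: "C > 0" "\<And>(N::real) (M::nat) (q::nat). N \<ge> 2 \<Longrightarrow> M \<ge> 1 \<Longrightarrow> real M \<le> N \<Longrightarrow> q \<ge> 1 \<Longrightarrow>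
    (\<exists>(L::nat) B. M + 2 < 2 ^ L \<and> B \<ge> 1 \<and> (\<forall>t. 1 \<le> t \<longrightarrow> t \<le> 256 * M\<^sup>2 * q \<longrightarrow> real (card {d. d dvd t}) \<le> B) \<and>
       ln N * (real L ^ 4 * B ^ 4 * harm q) \<le> C * (N * real q) powr (2 * \<epsilon>))"
    using epsilon_bound[OF assms] by blast
  \<comment> \<open>The factor 2 comes from sqrt E <= 2 T, where T is the bracket of the theorem;
    the root comes from Cauchy-Schwarz over h.\<close>
  define C' where "C' = 2 * sqrt (400000 * C)"
  have C': "C' > 0" using C(1) by (simp add: C'_def)
  have main: "sqrt (ln N) / N * (\<Sum>h = 1..nat \<lfloor>H\<rfloor>. norm (S (real h * \<alpha>) N))
             \<le> C' * (H * (N * real q) powr \<epsilon> *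
                  (real q powr (-1/4) + N powr (-1/8) + H powr (-1/4) * N powr (-1/2) * real q powr (1/4)))"
    if q: "q \<ge> 1" and cop: "coprime a (int q)" and al: "\<bar>\<alpha> - of_int a / real q\<bar> \<le> 1 / (real q)\<^sup>2"
      and N: "N \<ge> 2" and H: "H \<ge> 1" for \<alpha> N H :: real and a :: int and q :: nat
  proof -
    define M where "M = nat \<lfloor>N\<rfloor>"
    define K where "K = nat \<lfloor>H\<rfloor>"
    have M: "M \<ge> 1" "real M \<le> N" "N \<le> 2 * real M"
    proof -
      have "real M = of_int \<lfloor>N\<rfloor>" using N by (simp add: M_def)
      then show "real M \<le> N" "N \<le> 2 * real M" using N by linarith+
      then show "M \<ge> 1" using N by linarith
    qed
    have K: "K \<ge> 1" "real K \<le> H" "H \<le> 2 * real K"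
    proof -
      have "real K = of_int \<lfloor>H\<rfloor>" using H by (simp add: K_def)
      moreover have "\<lfloor>H\<rfloor> \<ge> 1" using H by simp
      ultimately show "real K \<le> H" "H \<le> 2 * real K" by linarith+
      then show "K \<ge> 1" using H by linarith
    qed
    have SM: "S \<beta> N = S \<beta> (real M)" for \<beta> by (simp add: S_def M_def)
    obtain L B where LB: "M + 2 < 2 ^ L" "B \<ge> 1"
        "\<And>t. 1 \<le> t \<Longrightarrow> t \<le> 256 * M\<^sup>2 * q \<Longrightarrow> real (card {d. d dvd t}) \<le> B"
        "ln N * (real L ^ 4 * B ^ 4 * harm q) \<le> C * (N * real q) powr (2 * \<epsilon>)"
      using C(2)[OF N M(1,2) q] by blast
    define Y where "Y = real L ^ 4 * B ^ 4 * harm q"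
    have Y0: "Y \<ge> 0" unfolding Y_def using LB(2) harm_nonneg[of q, where 'a = real] by simp
    define E where "E = sqrt (1 / real q + 1 / sqrt (real M) + real q / (real K * (real M)\<^sup>2))"
    have E0: "E \<ge> 0" unfolding E_def by (auto intro!: add_nonneg_nonneg)
    define \<Sigma> where "\<Sigma> = (\<Sum>h = 1..K. norm (S (real h * \<alpha>) (real M)))"
    define T where "T = real q powr (-1/4) + N powr (-1/8) + H powr (-1/4) * N powr (-1/2) * real q powr (1/4)"
    have "\<Sigma>\<^sup>2 \<le> (\<Sum>h = 1..K. (norm (S (real h * \<alpha>) (real M)))\<^sup>2) * real K"
      unfolding \<Sigma>_def using sum_squared_le_sum_of_squares[of "\<lambda>h. norm (S (real h * \<alpha>) (real M))" "{1..K}"] by simp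
    also have "\<dots> \<le> (400000 * Y * (real K * (real M)\<^sup>2 * E)) * real K"
      unfolding Y_def
      by (intro mult_right_mono sum_norm_S_squared_le_all[OF q cop al M(1) K(1) LB(1) E_def LB(2,3)]) auto
    also have "\<dots> = (real K * real M)\<^sup>2 * (400000 * Y * E)" by (simp add: power2_eq_square)
    finally have "\<Sigma> \<le> sqrt ((real K * real M)\<^sup>2 * (400000 * Y * E))" by (rule real_le_rsqrt)
    also have "\<dots> = (real K * real M) * sqrt (400000 * Y * E)" by (simp add: real_sqrt_mult)
    also have "\<dots> \<le> (H * N) * sqrt (400000 * Y * E)"
      using K M H Y0 E0 by (intro mult_right_mono mult_mono) auto
    finally have "sqrt (ln N) / N * \<Sigma> \<le> sqrt (ln N) / N * ((H * N) * sqrt (400000 * Y * E))"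
      using N by (intro mult_left_mono) auto
    also have "\<dots> = H * (sqrt (400000 * (ln N * Y)) * sqrt E)" using N by (simp add: real_sqrt_mult)
    also have "\<dots> \<le> H * (sqrt (400000 * (C * (N * real q) powr (2 * \<epsilon>))) * sqrt E)"
      using H LB(4) E0 unfolding Y_def by (intro mult_left_mono mult_right_mono real_sqrt_le_mono) auto
    also have "sqrt (400000 * (C * (N * real q) powr (2 * \<epsilon>))) = sqrt (400000 * C) * (N * real q) powr \<epsilon>"
    proof -
      have "(N * real q) powr (2 * \<epsilon>) = ((N * real q) powr \<epsilon>)\<^sup>2"
        by (simp add: power2_eq_square flip: powr_add)
      then show ?thesis by (simp add: real_sqrt_mult flip: mult.assoc)
    qed
    also have "sqrt E \<le> 2 * T"
    proof -
      \<comment> \<open>Replacing the real cut-offs N and H by their integer parts changes each by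
        at most a factor 2, hence Delta by at most 8. The value 16 is used because its fourth root
        is 2.\<close>
      have "1 / sqrt (real M) \<le> 16 * (1 / sqrt N)"
      proof -
        have "sqrt N \<le> sqrt (16\<^sup>2 * real M)" using M by (intro real_sqrt_le_mono) auto
        then have "sqrt N \<le> 16 * sqrt (real M)" by (simp add: real_sqrt_mult)
        then show ?thesis using M N by (simp add: field_simps)
      qed
      moreover have "real q / (real K * (real M)\<^sup>2) \<le> 16 * (real q / (H * N\<^sup>2))"
      proof -
        have "H * N\<^sup>2 \<le> (2 * real K) * (2 * real M)\<^sup>2" using K M N H by (intro mult_mono power_mono) auto
        also have "\<dots> = 8 * (real K * (real M)\<^sup>2)" by (simp add: power_mult_distrib)
        also have "\<dots> \<le> 16 * (real K * (real M)\<^sup>2)" by simp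
        finally have "real q * (H * N\<^sup>2) \<le> real q * (16 * (real K * (real M)\<^sup>2))" by (intro mult_left_mono) auto
        moreover have "real K * (real M)\<^sup>2 > 0" "H * N\<^sup>2 > 0" using K M N H by auto
        ultimately show ?thesis by (simp add: divide_simps mult_ac)
      qed
      moreover have "1 / real q \<le> 16 * (1 / real q)"
        using mult_right_mono[of 1 16 "1 / real q"] by simp
      ultimately have "1 / real q + 1 / sqrt (real M) + real q / (real K * (real M)\<^sup>2)
          \<le> 16 * (1 / real q) + 16 * (1 / sqrt N) + 16 * (real q / (H * N\<^sup>2))" by (intro add_mono)
      also have "\<dots> = 16 * (1 / real q + 1 / sqrt N + real q / (H * N\<^sup>2))" by (simp only: distrib_left)
      finally have "sqrt E \<le> sqrt (sqrt (16 * (1 / real q + 1 / sqrt N + real q / (H * N\<^sup>2))))"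
        unfolding E_def by (intro real_sqrt_le_mono)
      also have "\<dots> = 2 * sqrt (sqrt (1 / real q + 1 / sqrt N + real q / (H * N\<^sup>2)))"
      proof -
        have "sqrt (16 :: real) = 4" "sqrt (4 :: real) = 2" by (auto intro: real_sqrt_unique)
        then show ?thesis by (simp only: real_sqrt_mult)
      qed
      also have "sqrt (sqrt (1 / real q + 1 / sqrt N + real q / (H * N\<^sup>2)))
          \<le> sqrt (sqrt (1 / real q)) + sqrt (sqrt (1 / sqrt N)) + sqrt (sqrt (real q / (H * N\<^sup>2)))"
        using H N by (intro sqrt_sqrt_add3_le) auto
      also have "\<dots> = T"
      proof -
        have "sqrt (sqrt (1 / real q)) = real q powr (-1/4)"
          using q by (simp add: sqrt_sqrt_eq_powr powr_divide powr_minus_divide)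
        moreover have "sqrt (sqrt (1 / sqrt N)) = N powr (-1/8)"
          using N by (simp add: sqrt_sqrt_eq_powr powr_divide powr_minus_divide powr_half_sqrt[symmetric] powr_powr)
        moreover have "sqrt (sqrt (real q / (H * N\<^sup>2))) = H powr (-1/4) * N powr (-1/2) * real q powr (1/4)"
        proof -
          have "N\<^sup>2 = N powr 2" using powr_realpow[of N 2] N by simp
          then have "(N\<^sup>2) powr (1/4) = N powr (1/2)" by (simp only: powr_powr) simp
          then show ?thesis using N H
            by (simp add: sqrt_sqrt_eq_powr powr_divide powr_mult powr_minus_divide)
        qed
        ultimately show ?thesis unfolding T_def by simp
      qed
      finally show ?thesis by simp
    qed
    finally have "sqrt (ln N) / N * \<Sigma> \<le> H * ((sqrt (400000 * C) * (N * real q) powr \<epsilon>) * (2 * T))"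
      using H C(1) by (simp add: mult_left_mono)
    also have "\<dots> = C' * (H * (N * real q) powr \<epsilon> * T)" by (simp add: C'_def)
    finally show ?thesis unfolding \<Sigma>_def T_def K_def SM .
  qed
  show ?thesis
  proof (intro exI[of _ C'] conjI C' allI impI)
    fix \<alpha> :: real and a q :: int and N H :: real
    assume *: "q \<ge> 1" "coprime a q" "\<bar>\<alpha> - real_of_int a / real_of_int q\<bar> < 1 / (real_of_int q)\<^sup>2" "N \<ge> 2" "H \<ge> 1"
    then have qn: "real (nat q) = real_of_int q" "int (nat q) = q" "nat q \<ge> 1" by auto
    show "sqrt (ln N) / N * (\<Sum>h = 1..nat \<lfloor>H\<rfloor>. norm (S (real h * \<alpha>) N))
             \<le> C' * (H * (N * real_of_int q) powr \<epsilon> *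
                  (real_of_int q powr (-1/4) + N powr (-1/8)
                   + H powr (-1/4) * N powr (-1/2) * real_of_int q powr (1/4)))"
      using main[of "nat q" a \<alpha> N H] * qn by simp
  qed
qed

end
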